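(* Consider the symmetric simple exclusion process on $\mathbb Z$ with initial configuration $\eta_0(x)=\mathbf 1\{x \text{ even}\}$, $x\in\mathbb Z$, and let $J_t$ be the integrated flux of particles through the point $-1/2$ up to time $t$. Then $$\lim_{t\to\infty}\frac{\mathbb V J_t}{\sqrt t}=\frac{1}{4\sqrt\pi},$$ where $\mathbb V$ denotes variance.
   Context: The symmetric simple exclusion process is the Markov process on $\{0,1\}^{\mathbb Z}$ with generator $\mathcal L^{ex}f(\eta)=\frac12\sum_{x\in\mathbb Z}[f(\eta^{x,x+1})-f(\eta)]$, where $\eta^{x,x+1}$ is obtained from $\eta$ by exchanging the values at $x$ and $x+1$. It is constructed as follows. Let $(N_t(x))_{t\ge0}$, $x\in\mathbb Z$, be independent Poisson processes of rate $\frac12$, with $N_t(x)$ attached to the bond $\{x,x+1\}$. For each $x\in\mathbb Z$ the stirring particle $X^x_t$ starts at $X^x_0=x$ and, at each event of a Poisson process attached to a bond having the current position of the particle as an endpoint, it jumps to the other endpoint of that bond. Almost surely, for each $t$ the map $x\mapsto X^x_t$ is a bijection of $\mathbb Z$, and $\eta_t$ is defined by $\eta_t(X^x_t)=\eta_0(x)$. The integrated flux through $-1/2$ is $$J_t=\sum_{x<0}\eta_0(x)\mathbf 1\{X^x_t\ge 0\}-\sum_{x\ge 0}\eta_0(x)\mathbf 1\{X^x_t<0\}.$$ *)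

theory Defs
  imports "HOL-Probability.Probability"
begin

text \<open>
  Time is \<^typ>\<open>real\<close>, and only times \<open>t \<ge> 0\<close> are ever constrained.  The subtraction below is on
  \<^typ>\<open>nat\<close>; it is the true increment because almost every path is nondecreasing.
\<close>

definition (in prob_space) poisson_process :: "real \<Rightarrow> (real \<Rightarrow> 'a \<Rightarrow> nat) \<Rightarrow> bool" where
  "poisson_process r N \<longleftrightarrow>
     (\<forall>t\<ge>0. random_variable (count_space UNIV) (N t)) \<and>
     (\<forall>s t. 0 \<le> s \<and> s < t \<longrightarrow>
        distr M (count_space UNIV) (\<lambda>\<omega>. N t \<omega> - N s \<omega>) = measure_pmf (poisson_pmf (r * (t - s)))) \<and>
     (\<forall>u :: nat \<Rightarrow> real. 0 \<le> u 0 \<and> incseq u \<longrightarrow>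
        indep_vars (\<lambda>_. count_space UNIV) (\<lambda>i \<omega>. N (u (Suc i)) \<omega> - N (u i) \<omega>) UNIV) \<and>
     (AE \<omega> in M. N 0 \<omega> = 0 \<and> mono_on {0..} (\<lambda>t. N t \<omega>) \<and>
        (\<forall>t\<ge>0. \<forall>\<^sub>F s in at_right t. N s \<omega> = N t \<omega>))"

text \<open>Independence of whole processes, viewed as random elements of the path space.\<close>

definition (in prob_space) indep_processes :: "('i \<Rightarrow> real \<Rightarrow> 'a \<Rightarrow> nat) \<Rightarrow> bool" where
  "indep_processes N \<longleftrightarrow>
     indep_vars (\<lambda>_. PiM {0..} (\<lambda>_. count_space UNIV)) (\<lambda>x \<omega>. \<lambda>t\<in>{0..}. N x t \<omega>) UNIV"

definition event_at :: "(real \<Rightarrow> nat) \<Rightarrow> real \<Rightarrow> bool" where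
  "event_at n t \<longleftrightarrow> 0 < t \<and> \<not> (\<forall>\<^sub>F s in at_left t. n s = n t)"

text \<open>
  \<open>stirring_path n x \<xi>\<close>: the right-continuous path \<open>\<xi>\<close> started at \<open>x\<close> is driven by the counting paths
  \<open>n b\<close>, where \<open>n b\<close> belongs to the bond \<open>{b, b + 1}\<close>.  Here \<open>p\<close> is the position just before
  time \<open>t\<close>; the two bonds having \<open>p\<close> as an endpoint are those with index \<open>p\<close> and \<open>p - 1\<close>.
  Simultaneous events on both bonds, which have probability zero for independent Poisson processes,
  are incompatible with being a stirring path.
\<close>

definition stirring_path :: "(int \<Rightarrow> real \<Rightarrow> nat) \<Rightarrow> int \<Rightarrow> (real \<Rightarrow> int) \<Rightarrow> bool" where
  "stirring_path n x \<xi> \<longleftrightarrow>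
     \<xi> 0 = x \<and>
     (\<forall>t\<ge>0. \<forall>\<^sub>F s in at_right t. \<xi> s = \<xi> t) \<and>
     (\<forall>t>0. \<exists>p. (\<forall>\<^sub>F s in at_left t. \<xi> s = p) \<and>
        (event_at (n p) t \<longrightarrow> \<xi> t = p + 1) \<and>
        (event_at (n (p - 1)) t \<longrightarrow> \<xi> t = p - 1) \<and>
        (\<not> event_at (n p) t \<and> \<not> event_at (n (p - 1)) t \<longrightarrow> \<xi> t = p))"

text \<open>
  The graphical construction, with deterministic initial configuration \<open>\<eta>0\<close>.  Configurations in
  \<open>{0,1}\<^sup>\<int>\<close> are predicates on \<^typ>\<open>int\<close> (true = occupied).  \<open>N b\<close> drives the bond \<open>{b, b + 1}\<close>,
  \<open>X x t\<close> is the position at time \<open>t\<close> of the stirring particle started at \<open>x\<close>, and \<open>\<eta> t y\<close> is the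
  occupation of site \<open>y\<close> at time \<open>t\<close>.  Up to a null set, \<open>X\<close> is determined by \<open>N\<close> and \<open>\<eta>\<close> by \<open>X\<close>.
\<close>

locale ssep = prob_space M
  for M :: "'a measure" and N :: "int \<Rightarrow> real \<Rightarrow> 'a \<Rightarrow> nat" and X :: "int \<Rightarrow> real \<Rightarrow> 'a \<Rightarrow> int"
    and \<eta>0 :: "int \<Rightarrow> bool" and \<eta> :: "real \<Rightarrow> int \<Rightarrow> 'a \<Rightarrow> bool" +
  assumes clocks_poisson: "\<And>b. poisson_process (1 / 2) (N b)"
    and clocks_indep: "indep_processes N"
    and X_measurable: "\<And>x t. 0 \<le> t \<Longrightarrow> random_variable (count_space UNIV) (X x t)"
    and X_stirring: "AE \<omega> in M. \<forall>x. stirring_path (\<lambda>b t. N b t \<omega>) x (\<lambda>t. X x t \<omega>)"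
    and \<eta>_measurable: "\<And>t y. 0 \<le> t \<Longrightarrow> random_variable (count_space UNIV) (\<eta> t y)"
    and \<eta>_stirred: "AE \<omega> in M. \<forall>t\<ge>0. \<forall>x. \<eta> t (X x t \<omega>) \<omega> \<longleftrightarrow> \<eta>0 x"

text \<open>
  The integrated flux through \<open>-1/2\<close>; almost surely only finitely many summands are nonzero.
\<close>

definition integrated_flux ::
  "(int \<Rightarrow> bool) \<Rightarrow> (int \<Rightarrow> real \<Rightarrow> 'a \<Rightarrow> int) \<Rightarrow> real \<Rightarrow> 'a \<Rightarrow> real" where
  "integrated_flux \<eta>0 X t \<omega> =
     (\<Sum>\<^sub>\<infinity>x\<in>{..<0}. of_bool (\<eta>0 x) * of_bool (X x t \<omega> \<ge> 0)) -
     (\<Sum>\<^sub>\<infinity>x\<in>{0..}. of_bool (\<eta>0 x) * of_bool (X x t \<omega> < 0))"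

end

theory Submission
  imports Defs "HOL-Real_Asymp.Real_Asymp"
begin

text \<open>
  Only two stirring particles are needed. Their generator \<open>L\<close> is bounded on bounded functions, and
  their law at time \<open>t\<close> is \<open>exp (t L)\<close>, by comparison with a discrete-time chain that looks at the
  clocks on a grid and almost surely ends where the particles end once the grid is fine enough.
  Let \<open>p t\<close> be the kernel of a single particle and \<open>w t x\<close> the probability that it moves from \<open>x\<close>
  into \<open>{0..}\<close>, so that \<open>w t (b + 1) - w t b = p t (b + 1)\<close>. On the product of two copies of \<open>w s\<close> the
  generator acts like that of two independent particles, up to a term supported on equal and
  neighbouring positions. Duhamel's formula, summation over even starting points and the symmetry of
  \<open>exp (s L)\<close> express \<open>Var J t\<close> as the integral over \<open>s \<in> {0..t}\<close> of
  \<open>1/2 * (\<Sum>b. p (t - s) (b + 1) ^ 2 * E (\<eta> s b - \<eta> s (b + 1)) ^ 2)\<close>. The expectation is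
  \<open>(1 + p (2 * s) 0) / 2\<close>, because the backward equation started from \<open>(-1) ^ (x - y)\<close> has an explicit
  solution, and the sum of squares is \<open>p (2 * (t - s)) 0\<close>. Since \<open>p (2 * u) 0\<close> is asymptotic to
  \<open>1 / (2 * sqrt (pi * u))\<close>, the contribution of the product of two kernels is of lower order.
\<close>

text \<open>The flux is a sum over starting points of signed crossing indicators, so its variance is
  a double sum of covariances, and each covariance measures how far a stirring pair is from two
  independent walks. \<open>stirring_path\<close> describes the particles pathwise only; no Markov
  property of \<open>X\<close> is given. Hence the grid chain: its time slots are exactly
  independent, its error per step is of order h^2, and it meets the particles pathwise on fine
  grids. Symmetry is needed because the sum over even starting pairs of the evolved gradient term is
  not accessible directly. With the semigroup moved onto \<open>both_even\<close>, only a mixed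
  second difference across one bond remains, in which all one-particle terms cancel. Analytic bounds
  may be crude, like the growth exp (4 s), because t is fixed until the exact formula
  \<open>flux_variance\<close> is reached; the limit is taken only there. The integral of p (2 u) 0
  over {0..t} is asymptotic to sqrt t / sqrt pi, and its factor 1/4 gives the stated
  constant.\<close>

abbreviation counting :: "'a measure" where
  "counting \<equiv> count_space UNIV"

section \<open>The semigroup of a pair of stirring particles\<close>

definition swap_bond :: "int \<Rightarrow> int \<Rightarrow> int" where
  "swap_bond b x = (if x = b then b + 1 else if x = b + 1 then b else x)"

definition pair_swap :: "int \<Rightarrow> int \<times> int \<Rightarrow> int \<times> int" where
  "pair_swap b = map_prod (swap_bond b) (swap_bond b)"

text \<open>A set, so that coinciding indices count once: the bond between two neighbours moves both
  particles in one exchange, and equal positions move as one particle. These coincidences are the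
  whole difference from two independent walks.\<close>

definition pair_bonds :: "int \<times> int \<Rightarrow> int set" where
  "pair_bonds a = {fst a - 1, fst a, snd a - 1, snd a}"

definition pair_gen :: "(int \<times> int \<Rightarrow> real) \<Rightarrow> int \<times> int \<Rightarrow> real" where
  "pair_gen F a = (\<Sum>b\<in>pair_bonds a. F (pair_swap b a) - F a) / 2"

text \<open>The exponential series of the generator, taken pointwise. It is used on bounded
  functions only, where \<open>pair_gen_bound\<close> makes it absolutely convergent.\<close>

definition pair_sg :: "real \<Rightarrow> (int \<times> int \<Rightarrow> real) \<Rightarrow> int \<times> int \<Rightarrow> real" where
  "pair_sg s F a = (\<Sum>k. s ^ k / fact k * (pair_gen ^^ k) F a)"

lemma pair_swap_pair: "pair_swap b (x, y) = (swap_bond b x, swap_bond b y)"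
  by (simp add: pair_swap_def)

lemma swap_bond_swap_bond [simp]: "swap_bond b (swap_bond b x) = x"
  by (auto simp: swap_bond_def)

lemma pair_swap_pair_swap [simp]: "pair_swap b (pair_swap b a) = a"
  by (cases a) (simp add: pair_swap_pair)

lemma finite_pair_bonds [simp]: "finite (pair_bonds a)"
  by (simp add: pair_bonds_def)

lemma card_pair_bonds: "card (pair_bonds a) \<le> 4"
  unfolding pair_bonds_def by (simp add: card_insert_if)

lemma pair_swap_trivial: "b \<notin> pair_bonds a \<Longrightarrow> pair_swap b a = a"
  by (cases a) (auto simp: pair_swap_pair swap_bond_def pair_bonds_def)

text \<open>Bonds touching neither particle contribute zero, so generators at different pairs can be
  written over one common set of bonds.\<close>

lemma pair_gen_superset:
  assumes "finite B" "pair_bonds a \<subseteq> B"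
  shows "pair_gen F a = (\<Sum>b\<in>B. F (pair_swap b a) - F a) / 2"
  unfolding pair_gen_def
  by (intro arg_cong[where f="\<lambda>x. x / 2"] sum.mono_neutral_left) (use assms in \<open>auto simp: pair_swap_trivial\<close>)

lemma pair_gen_add: "pair_gen (\<lambda>a. F a + G a) a = pair_gen F a + pair_gen G a"
  unfolding pair_gen_def add_divide_distrib[symmetric] sum.distrib[symmetric]
  by (simp add: algebra_simps)

lemma pair_gen_diff: "pair_gen (\<lambda>a. F a - G a) a = pair_gen F a - pair_gen G a"
  unfolding pair_gen_def diff_divide_distrib[symmetric] sum_subtractf[symmetric]
  by (simp add: algebra_simps)

lemma pair_gen_cmult: "pair_gen (\<lambda>a. c * F a) a = c * pair_gen F a"
  unfolding pair_gen_def times_divide_eq_right sum_distrib_left by (simp add: algebra_simps)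

text \<open>Four bonds at most, differences of at most 2 K, and the clock rate 1/2 give the factor
  4.\<close>

lemma pair_gen_bound:
  assumes "\<And>a. \<bar>F a\<bar> \<le> K"
  shows "\<bar>pair_gen F a\<bar> \<le> 4 * K"
proof -
  have K: "0 \<le> K" using assms[of a] by linarith
  have "\<bar>F (pair_swap b a) - F a\<bar> \<le> 2 * K" for b
    using assms[of "pair_swap b a"] assms[of a] by linarith
  then have "\<bar>\<Sum>b\<in>pair_bonds a. F (pair_swap b a) - F a\<bar> \<le> (\<Sum>b\<in>pair_bonds a. 2 * K)"
    by (intro order_trans[OF sum_abs] sum_mono)
  also have "\<dots> \<le> 4 * (2 * K)"
    using mult_right_mono[of "real (card (pair_bonds a))" 4 "2 * K"] card_pair_bonds[of a] K by simp
  finally show ?thesis by (simp add: pair_gen_def)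
qed

lemma pair_gen_pow_add:
  "(pair_gen ^^ k) (\<lambda>a. F a + G a) = (\<lambda>a. (pair_gen ^^ k) F a + (pair_gen ^^ k) G a)"
  proof (induction k)
  case (Suc k)
  then show ?case by (intro ext) (simp add: pair_gen_add)
qed simp

lemma pair_gen_pow_diff:
  "(pair_gen ^^ k) (\<lambda>a. F a - G a) = (\<lambda>a. (pair_gen ^^ k) F a - (pair_gen ^^ k) G a)"
  proof (induction k)
  case (Suc k)
  then show ?case by (intro ext) (simp add: pair_gen_diff)
qed simp

lemma pair_gen_pow_cmult:
  "(pair_gen ^^ k) (\<lambda>a. c * F a) = (\<lambda>a. c * (pair_gen ^^ k) F a)"
  proof (induction k)
  case (Suc k)
  then show ?case by (intro ext) (simp add: pair_gen_cmult)
qed simp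

lemma pair_gen_pow_bound:
  assumes "\<And>a. \<bar>F a\<bar> \<le> K"
  shows "\<bar>(pair_gen ^^ k) F a\<bar> \<le> 4 ^ k * K"
proof (induction k arbitrary: a)
  case (Suc k)
  show ?case using pair_gen_bound[of "(pair_gen ^^ k) F", OF Suc] by (simp add: mult.assoc)
qed (use assms in simp)

lemma pair_sg_term_bound:
  assumes "\<And>a. \<bar>F a\<bar> \<le> K"
  shows "\<bar>s ^ n / fact n * (pair_gen ^^ n) F a\<bar> \<le> (4 * \<bar>s\<bar>) ^ n /\<^sub>R fact n * K"
proof -
  have "\<bar>s ^ n / fact n\<bar> * \<bar>(pair_gen ^^ n) F a\<bar> \<le> \<bar>s ^ n / fact n\<bar> * (4 ^ n * K)"
    by (intro mult_left_mono pair_gen_pow_bound assms) auto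
  then show ?thesis
    by (simp add: abs_mult power_mult_distrib divide_simps power_abs mult_ac)
qed

lemma pair_sg_summable:
  assumes "\<And>a. \<bar>F a\<bar> \<le> K"
  shows "summable (\<lambda>k. \<bar>s ^ k / fact k * (pair_gen ^^ k) F a\<bar>)"
proof (rule summable_comparison_test)
  show "\<exists>N. \<forall>n\<ge>N. norm \<bar>s ^ n / fact n * (pair_gen ^^ n) F a\<bar> \<le> (4 * \<bar>s\<bar>) ^ n /\<^sub>R fact n * K"
    unfolding real_norm_def abs_idempotent by (intro exI allI impI pair_sg_term_bound assms)
  show "summable (\<lambda>n. (4 * \<bar>s\<bar>) ^ n /\<^sub>R fact n * K)"
    by (intro summable_mult2 summable_exp_generic)
qed

lemma pair_sg_sums:
  assumes "\<And>a. \<bar>F a\<bar> \<le> K"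
  shows "(\<lambda>k. s ^ k / fact k * (pair_gen ^^ k) F a) sums pair_sg s F a"
  unfolding pair_sg_def
  by (rule summable_sums, rule summable_rabs_cancel, rule pair_sg_summable, rule assms)

text \<open>A growth bound from the operator norm alone. The sharp bound K is
  \<open>pair_sg_contraction\<close>, which has to wait for the identification of
  \<open>pair_sg\<close> with an expectation.\<close>

lemma pair_sg_bound:
  assumes "\<And>a. \<bar>F a\<bar> \<le> K"
  shows "\<bar>pair_sg s F a\<bar> \<le> exp (4 * \<bar>s\<bar>) * K"
proof -
  have "\<bar>pair_sg s F a\<bar> \<le> (\<Sum>k. \<bar>s ^ k / fact k * (pair_gen ^^ k) F a\<bar>)"
    unfolding pair_sg_def by (rule summable_rabs, rule pair_sg_summable, rule assms)
  also have "\<dots> \<le> (\<Sum>n. (4 * \<bar>s\<bar>) ^ n /\<^sub>R fact n * K)"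
    by (intro suminf_le pair_sg_term_bound pair_sg_summable[of F K] assms summable_mult2 summable_exp_generic)
  also have "\<dots> = exp (4 * \<bar>s\<bar>) * K"
    unfolding exp_def by (intro suminf_mult2[symmetric] summable_exp_generic)
  finally show ?thesis .
qed

lemma pair_sg_0 [simp]: "pair_sg 0 F a = F a"
proof -
  have "pair_sg 0 F a = (\<Sum>k. if k = 0 then F a else 0)"
    unfolding pair_sg_def by (intro suminf_cong) auto
  then show ?thesis using sums_single[of 0 "\<lambda>_. F a"] by (simp add: sums_iff)
qed

lemma pair_sg_diff:
  assumes "\<And>a. \<bar>F a\<bar> \<le> K" "\<And>a. \<bar>G a\<bar> \<le> K'"
  shows "pair_sg s (\<lambda>a. F a - G a) a = pair_sg s F a - pair_sg s G a"
  using sums_diff[OF pair_sg_sums[of F K s a] pair_sg_sums[of G K' s a]] assms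
  by (simp add: pair_sg_def pair_gen_pow_diff algebra_simps sums_iff)

lemma pair_sg_add:
  assumes "\<And>a. \<bar>F a\<bar> \<le> K" "\<And>a. \<bar>G a\<bar> \<le> K'"
  shows "pair_sg s (\<lambda>a. F a + G a) a = pair_sg s F a + pair_sg s G a"
  using sums_add[OF pair_sg_sums[of F K s a] pair_sg_sums[of G K' s a]] assms
  by (simp add: pair_sg_def pair_gen_pow_add algebra_simps sums_iff)

lemma pair_sg_cmult:
  assumes "\<And>a. \<bar>F a\<bar> \<le> K"
  shows "pair_sg s (\<lambda>a. c * F a) a = c * pair_sg s F a"
  using sums_mult[OF pair_sg_sums[of F K s a], of c] assms
  by (simp add: pair_sg_def pair_gen_pow_cmult algebra_simps sums_iff)

text \<open>At each point the generator is a finite sum, so it passes through the series term by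
  term.\<close>

lemma pair_sg_gen:
  assumes "\<And>a. \<bar>F a\<bar> \<le> K"
  shows "pair_gen (pair_sg s F) a = pair_sg s (pair_gen F) a"
proof -
  have "(\<lambda>k. (\<Sum>b\<in>pair_bonds a. s ^ k / fact k * (pair_gen ^^ k) F (pair_swap b a) -
          s ^ k / fact k * (pair_gen ^^ k) F a) / 2) sums pair_gen (pair_sg s F) a"
    unfolding pair_gen_def[of "pair_sg s F"] by (intro sums_divide sums_sum sums_diff pair_sg_sums[OF assms])
  moreover have "(\<Sum>b\<in>pair_bonds a. s ^ k / fact k * (pair_gen ^^ k) F (pair_swap b a) -
          s ^ k / fact k * (pair_gen ^^ k) F a) / 2 = s ^ k / fact k * (pair_gen ^^ k) (pair_gen F) a" for k
    by (simp add: funpow_swap1[symmetric] pair_gen_def sum_distrib_left right_diff_distrib)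
  ultimately show ?thesis by (simp add: pair_sg_def sums_iff)
qed

lemma pair_sg_deriv:
  assumes "\<And>a. \<bar>F a\<bar> \<le> K"
  shows "((\<lambda>s. pair_sg s F a) has_real_derivative pair_sg s (pair_gen F) a) (at s within A)"
proof -
  define c where "c k = (pair_gen ^^ k) F a / fact k" for k
  have "summable (\<lambda>k. c k * y ^ k)" for y
    using pair_sg_sums[where F=F and K=K and s=y and a=a, OF assms] by (simp add: c_def sums_iff mult_ac)
  from termdiffs_strong_converges_everywhere[OF this]
  have "((\<lambda>s. \<Sum>k. c k * s ^ k) has_real_derivative (\<Sum>k. diffs c k * s ^ k)) (at s)" .
  moreover have "diffs c k * s ^ k = s ^ k / fact k * (pair_gen ^^ k) (pair_gen F) a" for k
    by (simp add: diffs_def c_def funpow_swap1[symmetric] divide_simps)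
  ultimately show ?thesis
    by (simp add: pair_sg_def c_def mult_ac has_field_derivative_at_within)
qed

section \<open>Taylor estimates, Duhamel's formula and uniqueness for the backward equation\<close>

lemma taylor_bound_within:
  fixes f :: "real \<Rightarrow> real"
  assumes "convex A"
    and f: "\<And>u. u \<in> A \<Longrightarrow> (f has_real_derivative g u) (at u within A)"
    and g: "\<And>u. u \<in> A \<Longrightarrow> (g has_real_derivative h u) (at u within A)"
    and h: "\<And>u. u \<in> A \<Longrightarrow> \<bar>h u\<bar> \<le> M"
    and A: "s \<in> A" "s' \<in> A"
  shows "\<bar>f s' - f s - (s' - s) * g s\<bar> \<le> M * (s' - s)\<^sup>2"
proof -
  have M: "0 \<le> M" using h[OF A(1)] by linarith
  have lip: "\<bar>g u - g s\<bar> \<le> M * \<bar>u - s\<bar>" if "u \<in> A" for u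
    using field_differentiable_bound[where S=A and f=g and f'=h and B=M and x=u and y=s] assms(1) g h that A by auto
  have sub: "closed_segment s s' \<subseteq> A"
    using assms(1) A by (simp add: closed_segment_subset)
  \<comment> \<open>The mean value bound is applied to \<open>f u - u * g s\<close>, whose
    derivative \<open>g u - g s\<close> is small by the Lipschitz bound on \<open>g\<close>. The
    constant is twice the optimal one.\<close>
  have "norm ((f s' - s' * g s) - (f s - s * g s)) \<le> (M * \<bar>s' - s\<bar>) * norm (s' - s)"
  proof (rule field_differentiable_bound[where S="closed_segment s s'" and f'="\<lambda>u. g u - g s"])
    fix u assume u: "u \<in> closed_segment s s'"
    have "(f has_real_derivative g u) (at u within closed_segment s s')"
      using f[of u] u sub by (meson has_field_derivative_subset subsetD)
    then show "((\<lambda>u. f u - u * g s) has_real_derivative g u - g s) (at u within closed_segment s s')"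
      by (auto intro!: derivative_eq_intros)
    have "\<bar>u - s\<bar> \<le> \<bar>s' - s\<bar>"
      using u by (auto simp: closed_segment_eq_real_ivl split: if_splits)
    then show "norm (g u - g s) \<le> M * \<bar>s' - s\<bar>"
      using lip[of u] u sub M by (smt (verit, best) mult_left_mono real_norm_def subsetD)
  qed auto
  then show ?thesis by (simp add: power2_eq_square algebra_simps abs_mult_self_eq)
qed

lemma pair_sg_taylor:
  assumes F: "\<And>a. \<bar>F a\<bar> \<le> K" and s: "0 \<le> s" "s \<le> T" "0 \<le> s'" "s' \<le> T"
  shows "\<bar>pair_sg s' F a - pair_sg s F a - (s' - s) * pair_sg s (pair_gen F) a\<bar>
           \<le> 16 * K * exp (4 * T) * (s' - s)\<^sup>2"
proof -
  have K: "0 \<le> K" using F[of a] by linarith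
  show ?thesis
  proof (rule taylor_bound_within[where A="{0..T}" and h="\<lambda>u. pair_sg u (pair_gen (pair_gen F)) a"])
    fix u assume u: "u \<in> {0..T}"
    show "((\<lambda>s. pair_sg s F a) has_real_derivative pair_sg u (pair_gen F) a) (at u within {0..T})"
      by (rule pair_sg_deriv, rule F)
    show "((\<lambda>s. pair_sg s (pair_gen F) a) has_real_derivative pair_sg u (pair_gen (pair_gen F)) a) (at u within {0..T})"
      by (rule pair_sg_deriv, rule pair_gen_bound, rule F)
    have "\<bar>pair_sg u (pair_gen (pair_gen F)) a\<bar> \<le> exp (4 * \<bar>u\<bar>) * (4 * (4 * K))"
      by (intro pair_sg_bound pair_gen_bound F)
    also have "\<dots> \<le> exp (4 * T) * (4 * (4 * K))"
      using u K by (intro mult_right_mono) auto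
    finally show "\<bar>pair_sg u (pair_gen (pair_gen F)) a\<bar> \<le> 16 * K * exp (4 * T)"
      by (simp add: mult_ac)
  qed (use s in auto)
qed

text \<open>Time enters through the semigroup and through its argument. The first variation is
  controlled by the derivative in time, the second by the growth bound applied to a difference; the
  two contributions add up to the Lipschitz constant \<open>L\<close>.\<close>

lemma continuous_on_pair_sg_path:
  assumes H: "\<And>s a. s \<in> {0..T} \<Longrightarrow> \<bar>H s a\<bar> \<le> K"
    and lip: "\<And>s s' a. s \<in> {0..T} \<Longrightarrow> s' \<in> {0..T} \<Longrightarrow> \<bar>H s' a - H s a\<bar> \<le> K * \<bar>s' - s\<bar>"
  shows "continuous_on {0..T} (\<lambda>s. pair_sg s (H s) a)"
proof (cases "T \<ge> 0")
  case True
  have K: "0 \<le> K" using H[of 0 a] True by auto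
  define L where "L = exp (4 * T) * (4 * K) + exp (4 * T) * K"
  have L: "0 \<le> L" using K by (simp add: L_def)
  show ?thesis
  proof (rule continuous_on_iff[THEN iffD2], intro ballI allI impI)
    fix s e :: real assume s: "s \<in> {0..T}" and e: "0 < e"
    have *: "\<bar>pair_sg s' (H s') a - pair_sg s (H s) a\<bar> \<le> L * \<bar>s' - s\<bar>" if s': "s' \<in> {0..T}" for s'
    proof -
      have "norm (pair_sg s' (H s') a - pair_sg s (H s') a) \<le> (exp (4 * T) * (4 * K)) * norm (s' - s)"
      proof (rule field_differentiable_bound[where S="{0..T}"])
        fix u assume u: "u \<in> {0..T}"
        show "((\<lambda>s. pair_sg s (H s') a) has_real_derivative pair_sg u (pair_gen (H s')) a) (at u within {0..T})"
          by (rule pair_sg_deriv, rule H, rule s')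
        have "\<bar>pair_sg u (pair_gen (H s')) a\<bar> \<le> exp (4 * \<bar>u\<bar>) * (4 * K)"
          by (intro pair_sg_bound pair_gen_bound H s')
        also have "\<dots> \<le> exp (4 * T) * (4 * K)"
          using u K by (intro mult_right_mono) auto
        finally show "norm (pair_sg u (pair_gen (H s')) a) \<le> exp (4 * T) * (4 * K)" by simp
      qed (use s s' in auto)
      moreover have "\<bar>pair_sg s (H s') a - pair_sg s (H s) a\<bar> \<le> exp (4 * T) * (K * \<bar>s' - s\<bar>)"
      proof -
        have "pair_sg s (H s') a - pair_sg s (H s) a = pair_sg s (\<lambda>a. H s' a - H s a) a"
          by (intro pair_sg_diff[symmetric, of _ K _ K] H s s')
        also have "\<bar>\<dots>\<bar> \<le> exp (4 * \<bar>s\<bar>) * (K * \<bar>s' - s\<bar>)"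
          by (intro pair_sg_bound lip s s')
        also have "\<dots> \<le> exp (4 * T) * (K * \<bar>s' - s\<bar>)"
          using s K by (intro mult_right_mono) auto
        finally show ?thesis .
      qed
      ultimately show ?thesis by (simp add: L_def algebra_simps)
    qed
    have pos: "e / (L + 1) > 0" using e L by (intro divide_pos_pos) auto
    show "\<exists>d>0. \<forall>x'\<in>{0..T}. dist x' s < d \<longrightarrow> dist (pair_sg x' (H x') a) (pair_sg s (H s) a) < e"
    proof (intro exI[of _ "e / (L + 1)"] conjI ballI impI pos)
      fix x' assume x': "x' \<in> {0..T}" "dist x' s < e / (L + 1)"
      have "L * \<bar>x' - s\<bar> \<le> (L + 1) * \<bar>x' - s\<bar>" by (intro mult_right_mono) auto
      also have "\<dots> < e"
        using x'(2) L by (simp add: dist_real_def pos_less_divide_eq mult.commute)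
      finally show "dist (pair_sg x' (H x') a) (pair_sg s (H s) a) < e"
        using *[OF x'(1)] by (simp add: dist_real_def)
    qed
  qed
qed simp

text \<open>The path s -> \<open>pair_sg s (W (t - s))\<close> joins \<open>W t\<close> to the
  evolution of \<open>W 0\<close>, and its derivative is the evolved defect of \<open>W\<close> in
  the backward equation. Both the operator and its argument move with s, so the derivative is
  obtained from expansions uniform in the pair; the second derivative \<open>W2\<close> serves to
  bound their remainders.\<close>

lemma pair_sg_duhamel:
  assumes t: "0 \<le> t"
    and W: "\<And>s a. s \<in> {0..t} \<Longrightarrow> ((\<lambda>s. W s a) has_real_derivative W1 s a) (at s within {0..t})"
    and W1: "\<And>s a. s \<in> {0..t} \<Longrightarrow> ((\<lambda>s. W1 s a) has_real_derivative W2 s a) (at s within {0..t})"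
    and bd: "\<And>s a. s \<in> {0..t} \<Longrightarrow> \<bar>W s a\<bar> \<le> K" "\<And>s a. s \<in> {0..t} \<Longrightarrow> \<bar>W1 s a\<bar> \<le> K"
      "\<And>s a. s \<in> {0..t} \<Longrightarrow> \<bar>W2 s a\<bar> \<le> K"
  shows "continuous_on {0..t} (\<lambda>s. pair_sg s (\<lambda>c. pair_gen (W (t - s)) c - W1 (t - s) c) a)"
    and "((\<lambda>s. pair_sg s (\<lambda>c. pair_gen (W (t - s)) c - W1 (t - s) c) a) has_integral
           (pair_sg t (W 0) a - W t a)) {0..t}"
proof -
  have K: "0 \<le> K" using bd(1)[of 0 a] t by auto
  have lipW: "\<bar>W u a - W v a\<bar> \<le> K * \<bar>u - v\<bar>" if "u \<in> {0..t}" "v \<in> {0..t}" for u v a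
    using field_differentiable_bound[where S="{0..t}" and f="\<lambda>s. W s a" and f'="\<lambda>s. W1 s a" and B=K and x=u and y=v] W bd that by auto
  have lipW1: "\<bar>W1 u a - W1 v a\<bar> \<le> K * \<bar>u - v\<bar>" if "u \<in> {0..t}" "v \<in> {0..t}" for u v a
    using field_differentiable_bound[where S="{0..t}" and f="\<lambda>s. W1 s a" and f'="\<lambda>s. W2 s a" and B=K and x=u and y=v] W1 bd that by auto
  have lipg: "\<bar>pair_gen (W u) a - pair_gen (W v) a\<bar> \<le> 4 * (K * \<bar>u - v\<bar>)" if "u \<in> {0..t}" "v \<in> {0..t}" for u v a
    unfolding pair_gen_diff[symmetric] by (intro pair_gen_bound lipW that)
  show "continuous_on {0..t} (\<lambda>s. pair_sg s (\<lambda>c. pair_gen (W (t - s)) c - W1 (t - s) c) a)"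
  proof (rule continuous_on_pair_sg_path[where K="5 * K"])
    fix s a assume s: "s \<in> {0..t}"
    then show "\<bar>pair_gen (W (t - s)) a - W1 (t - s) a\<bar> \<le> 5 * K"
      using pair_gen_bound[of "W (t - s)" K a, OF bd(1)] bd(2)[of "t - s" a] by auto
  next
    fix s s' a assume s: "s \<in> {0..t}" "s' \<in> {0..t}"
    have "\<bar>W1 (t - s') a - W1 (t - s) a\<bar> \<le> K * \<bar>s' - s\<bar>"
      using lipW1[of "t - s'" "t - s" a] s by (auto simp: abs_minus_commute)
    moreover have "\<bar>pair_gen (W (t - s')) a - pair_gen (W (t - s)) a\<bar> \<le> 4 * (K * \<bar>s' - s\<bar>)"
      using lipg[of "t - s'" "t - s" a] s by (auto simp: abs_minus_commute)
    ultimately show "\<bar>pair_gen (W (t - s')) a - W1 (t - s') a - (pair_gen (W (t - s)) a - W1 (t - s) a)\<bar> \<le> 5 * K * \<bar>s' - s\<bar>"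
      by (simp add: algebra_simps)
  qed
  \<comment> \<open>Three quadratic errors: the Taylor remainder of the semigroup, the change of the
    generator term when \<open>W (t - s')\<close> is replaced by \<open>W (t - s)\<close>, and the
    Taylor remainder of \<open>W\<close> carried through the semigroup.\<close>
  define M where "M = 16 * K * exp (4 * t) + exp (4 * t) * (4 * K) + exp (4 * t) * K"
  have M: "0 \<le> M" using K by (simp add: M_def)
  have exp: "\<bar>pair_sg s' (W (t - s')) a - pair_sg s (W (t - s)) a
      - (s' - s) * pair_sg s (\<lambda>c. pair_gen (W (t - s)) c - W1 (t - s) c) a\<bar> \<le> M * (s' - s)\<^sup>2"
    if s: "s \<in> {0..t}" "s' \<in> {0..t}" for s s'
  proof -
    let ?h = "s' - s"
    have ts: "t - s \<in> {0..t}" "t - s' \<in> {0..t}" using s by auto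
    note b1 = bd(1)[OF ts(1)] bd(1)[OF ts(2)] bd(2)[OF ts(1)]
    have e1: "exp (4 * \<bar>s\<bar>) \<le> exp (4 * t)" using s by auto
    have 1: "\<bar>pair_sg s' (W (t - s')) a - pair_sg s (W (t - s')) a - ?h * pair_sg s (pair_gen (W (t - s'))) a\<bar>
        \<le> 16 * K * exp (4 * t) * ?h\<^sup>2"
      by (rule pair_sg_taylor) (use s b1 in auto)
    have "\<bar>pair_sg s (\<lambda>c. pair_gen (W (t - s')) c - pair_gen (W (t - s)) c) a\<bar> \<le> exp (4 * \<bar>s\<bar>) * (4 * (K * \<bar>?h\<bar>))"
      using lipg[OF ts(2) ts(1)] by (intro pair_sg_bound) (auto simp: abs_minus_commute)
    also have "\<dots> \<le> exp (4 * t) * (4 * (K * \<bar>?h\<bar>))" using e1 K by (intro mult_right_mono) auto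
    also have "pair_sg s (\<lambda>c. pair_gen (W (t - s')) c - pair_gen (W (t - s)) c) a =
        pair_sg s (pair_gen (W (t - s'))) a - pair_sg s (pair_gen (W (t - s))) a"
      by (intro pair_sg_diff[of _ "4 * K" _ "4 * K"] pair_gen_bound b1)
    finally have "\<bar>?h\<bar> * \<bar>pair_sg s (pair_gen (W (t - s'))) a - pair_sg s (pair_gen (W (t - s))) a\<bar>
         \<le> \<bar>?h\<bar> * (exp (4 * t) * (4 * (K * \<bar>?h\<bar>)))"
      by (intro mult_left_mono) auto
    then have 2: "\<bar>?h * pair_sg s (pair_gen (W (t - s'))) a - ?h * pair_sg s (pair_gen (W (t - s))) a\<bar>
         \<le> exp (4 * t) * (4 * K) * ?h\<^sup>2"
      unfolding right_diff_distrib[symmetric] abs_mult power2_abs[of ?h, symmetric] power2_eq_square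
      by (simp only: mult_ac)
    have T: "\<bar>W (t - s') c - W (t - s) c - ((t - s') - (t - s)) * W1 (t - s) c\<bar> \<le> K * ((t - s') - (t - s))\<^sup>2" for c
      by (rule taylor_bound_within[where A="{0..t}" and h="\<lambda>s. W2 s c"]) (use W W1 bd ts in auto)
    have T': "\<bar>W (t - s') c - W (t - s) c + ?h * W1 (t - s) c\<bar> \<le> K * ?h\<^sup>2" for c
      using T[of c] by (simp add: algebra_simps power2_eq_square)
    have "\<bar>pair_sg s (\<lambda>c. W (t - s') c - W (t - s) c + ?h * W1 (t - s) c) a\<bar> \<le> exp (4 * \<bar>s\<bar>) * (K * ?h\<^sup>2)"
      by (intro pair_sg_bound T')
    also have "\<dots> \<le> exp (4 * t) * (K * ?h\<^sup>2)" using e1 K by (intro mult_right_mono) auto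
    also have "pair_sg s (\<lambda>c. W (t - s') c - W (t - s) c + ?h * W1 (t - s) c) a =
       pair_sg s (W (t - s')) a - pair_sg s (W (t - s)) a + ?h * pair_sg s (W1 (t - s)) a"
    proof -
      have "\<bar>?h * W1 (t - s) c\<bar> \<le> \<bar>?h\<bar> * K" for c
        unfolding abs_mult by (intro mult_left_mono b1) auto
      moreover have "\<bar>W (t - s') c - W (t - s) c\<bar> \<le> 2 * K" for c using b1(1,2)[of c] by linarith
      ultimately show ?thesis
        by (subst pair_sg_add[of _ "2 * K" _ "\<bar>?h\<bar> * K"], simp, simp, subst pair_sg_diff[of _ K _ K])
           (auto simp: b1 pair_sg_cmult[of _ K])
    qed
    finally have 3: "\<bar>pair_sg s (W (t - s')) a - pair_sg s (W (t - s)) a + ?h * pair_sg s (W1 (t - s)) a\<bar> \<le> exp (4 * t) * K * ?h\<^sup>2"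
      by (simp add: mult.assoc)
    have 4: "pair_sg s (\<lambda>c. pair_gen (W (t - s)) c - W1 (t - s) c) a =
        pair_sg s (pair_gen (W (t - s))) a - pair_sg s (W1 (t - s)) a"
      by (intro pair_sg_diff[of _ "4 * K" _ K] pair_gen_bound b1)
    show ?thesis using 1 2 3 unfolding 4 M_def distrib_right right_diff_distrib by linarith
  qed
  have der: "((\<lambda>s. pair_sg s (W (t - s)) a) has_real_derivative
       pair_sg s (\<lambda>c. pair_gen (W (t - s)) c - W1 (t - s) c) a) (at s within {0..t})" if s: "s \<in> {0..t}" for s
  proof -
    let ?f = "\<lambda>s. pair_sg s (W (t - s)) a" and ?d = "pair_sg s (\<lambda>c. pair_gen (W (t - s)) c - W1 (t - s) c) a"
    have "((\<lambda>y. (?f y - ?f s) / (y - s) - ?d) \<longlongrightarrow> 0) (at s within {0..t})"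
    proof (rule Lim_null_comparison)
      show "\<forall>\<^sub>F y in at s within {0..t}. norm ((?f y - ?f s) / (y - s) - ?d) \<le> M * \<bar>y - s\<bar>"
        unfolding eventually_at_filter
      proof (intro always_eventually allI impI)
        fix y assume y: "y \<noteq> s" "y \<in> {0..t}"
        have "\<bar>(?f y - ?f s) / (y - s) - ?d\<bar> = \<bar>?f y - ?f s - (y - s) * ?d\<bar> / \<bar>y - s\<bar>"
          using y(1) by (simp add: abs_divide[symmetric] diff_divide_distrib)
        also have "\<dots> \<le> M * (y - s)\<^sup>2 / \<bar>y - s\<bar>"
          by (intro divide_right_mono exp s y) auto
        also have "\<dots> = M * \<bar>y - s\<bar>"
          using y(1) by (cases "y < s") (simp_all add: power2_eq_square field_simps)
        finally show "norm ((?f y - ?f s) / (y - s) - ?d) \<le> M * \<bar>y - s\<bar>" by simp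
      qed
      show "((\<lambda>y. M * \<bar>y - s\<bar>) \<longlongrightarrow> 0) (at s within {0..t})"
        by (auto intro!: tendsto_eq_intros)
    qed
    then show ?thesis by (simp add: has_field_derivative_iff Lim_null[symmetric])
  qed
  have "((\<lambda>s. pair_sg s (\<lambda>c. pair_gen (W (t - s)) c - W1 (t - s) c) a) has_integral
       (pair_sg t (W (t - t)) a - pair_sg 0 (W (t - 0)) a)) {0..t}"
    by (intro fundamental_theorem_of_calculus t)
       (use der in \<open>auto simp: has_real_derivative_iff_has_vector_derivative[symmetric]\<close>)
  then show "((\<lambda>s. pair_sg s (\<lambda>c. pair_gen (W (t - s)) c - W1 (t - s) c) a) has_integral
           (pair_sg t (W 0) a - W t a)) {0..t}" by simp
qed

text \<open>Duhamel's formula with zero defect. This is the tool that turns every explicit bounded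
  solution of the backward equation into a formula for the semigroup.\<close>

lemma pair_sg_unique:
  assumes t: "0 \<le> t"
    and W: "\<And>s a. s \<in> {0..t} \<Longrightarrow> ((\<lambda>s. W s a) has_real_derivative pair_gen (W s) a) (at s within {0..t})"
    and bd: "\<And>s a. s \<in> {0..t} \<Longrightarrow> \<bar>W s a\<bar> \<le> K"
  shows "pair_sg t (W 0) a = W t a"
proof -
  have K: "0 \<le> K" using bd[of 0 a] t by auto
  have W1: "((\<lambda>s. pair_gen (W s) a) has_real_derivative pair_gen (pair_gen (W s)) a) (at s within {0..t})"
    if "s \<in> {0..t}" for s a
  proof -
    have "((\<lambda>s. (\<Sum>b\<in>pair_bonds a. W s (pair_swap b a) - W s a) / 2) has_real_derivative
        (\<Sum>b\<in>pair_bonds a. pair_gen (W s) (pair_swap b a) - pair_gen (W s) a) / 2) (at s within {0..t})"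
      by (intro DERIV_cdivide DERIV_sum DERIV_diff W that)
    then show ?thesis by (simp only: pair_gen_def[symmetric])
  qed
  have b1: "\<bar>pair_gen (W s) a\<bar> \<le> 4 * K" if "s \<in> {0..t}" for s a
    by (intro pair_gen_bound bd that)
  have b2: "\<bar>pair_gen (pair_gen (W s)) a\<bar> \<le> 4 * (4 * K)" if "s \<in> {0..t}" for s a
    by (intro pair_gen_bound b1 that)
  have bd16: "\<bar>W s a\<bar> \<le> 16 * K" and b16: "\<bar>pair_gen (W s) a\<bar> \<le> 16 * K" if "s \<in> {0..t}" for s a
    using bd[OF that, of a] b1[OF that, of a] K by linarith+
  have "((\<lambda>s. pair_sg s (\<lambda>c. pair_gen (W (t - s)) c - pair_gen (W (t - s)) c) a) has_integral
           (pair_sg t (W 0) a - W t a)) {0..t}"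
    by (rule pair_sg_duhamel(2)[OF t W W1, where K="16 * K"])
       (use bd16 b16 b2 K in auto)
  moreover have "pair_sg s (\<lambda>c. 0) a = 0" for s
    using pair_sg_bound[of "\<lambda>_. 0" 0 s a] by simp
  ultimately show ?thesis by (simp add: has_integral_0_eq)
qed

section \<open>Finite range and symmetry of the generator\<close>

lemma pair_gen_pow_local:
  assumes "\<And>x y. \<bar>x - x0\<bar> \<le> int k \<Longrightarrow> F (x, y) = 0"
  shows "(pair_gen ^^ k) F (x0, y0) = 0"
  using assms
proof (induction k arbitrary: x0 y0)
  case (Suc k)
  have "(pair_gen ^^ k) F (pair_swap b (x0, y0)) = 0" for b
    unfolding pair_swap_pair
    by (rule Suc.IH, rule Suc.prems) (auto simp: swap_bond_def split: if_splits)
  moreover have "(pair_gen ^^ k) F (x0, y0) = 0"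
    by (rule Suc.IH, rule Suc.prems) auto
  ultimately show ?case by (simp add: pair_gen_def[of "(pair_gen ^^ k) F"])
qed auto

text \<open>Each application of the generator moves a particle by at most one site, so the terms
  with k < m vanish. For k >= m the factor exp (k - m) >= 1 may be inserted, which turns the
  remaining series into exp (4 e s) times exp (- m). This is what makes the sums over starting
  points converge.\<close>

lemma pair_sg_tail:
  assumes F: "\<And>a. \<bar>F a\<bar> \<le> 1" and s: "0 \<le> s"
    and loc: "\<And>x y. \<bar>x - x0\<bar> < int m \<Longrightarrow> F (x, y) = 0"
  shows "\<bar>pair_sg s F (x0, y0)\<bar> \<le> exp (4 * exp 1 * s) * exp (- real m)"
proof -
  have le: "\<bar>s ^ k / fact k * (pair_gen ^^ k) F (x0, y0)\<bar> \<le> (4 * exp 1 * s) ^ k /\<^sub>R fact k * exp (- real m)" for k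
  proof (cases "k < m")
    case True
    have "(pair_gen ^^ k) F (x0, y0) = 0"
      by (rule pair_gen_pow_local, rule loc) (use True in auto)
    then show ?thesis using s by simp
  next
    case False
    have "1 \<le> exp 1 ^ k * exp (- real m)"
      using False by (simp add: exp_of_nat_mult[symmetric] mult_exp_exp)
    then have "s ^ k / fact k * 4 ^ k * 1 \<le> s ^ k / fact k * 4 ^ k * (exp 1 ^ k * exp (- real m))"
      using s by (intro mult_left_mono) auto
    moreover have "\<bar>s ^ k / fact k * (pair_gen ^^ k) F (x0, y0)\<bar> \<le> s ^ k / fact k * (4 ^ k * 1)"
      unfolding abs_mult using s by (intro mult_mono pair_gen_pow_bound F) auto
    ultimately show ?thesis by (simp add: power_mult_distrib divide_simps mult_ac)
  qed
  have "\<bar>pair_sg s F (x0, y0)\<bar> \<le> (\<Sum>k. \<bar>s ^ k / fact k * (pair_gen ^^ k) F (x0, y0)\<bar>)"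
    unfolding pair_sg_def by (rule summable_rabs, rule pair_sg_summable, rule F)
  also have "\<dots> \<le> (\<Sum>n. (4 * exp 1 * s) ^ n /\<^sub>R fact n * exp (- real m))"
    by (intro suminf_le pair_sg_summable[of F 1] F summable_mult2 summable_exp_generic le)
  also have "\<dots> = exp (4 * exp 1 * s) * exp (- real m)"
    using suminf_mult2[OF summable_exp_generic[of "4 * exp 1 * s"], of "exp (- real m)"]
      fun_cong[OF exp_def, of "4 * exp 1 * s"] by simp
  finally show ?thesis .
qed

text \<open>Every \<open>pair_swap b\<close> is an involution, so a jump from \<open>a\<close> into
  \<open>c\<close> is also a jump from \<open>c\<close> into \<open>a\<close>: the generator matrix
  is symmetric.\<close>

lemma pair_gen_indicator:
  "pair_gen (indicator {c}) = (\<lambda>a. (\<Sum>b\<in>pair_bonds c. indicator {pair_swap b c} a - indicator {c} a) / 2)"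
proof
  fix a
  let ?B = "pair_bonds a \<union> pair_bonds c"
  have "pair_gen (indicator {c}) a = (\<Sum>b\<in>?B. indicator {c} (pair_swap b a) - indicator {c} a) / 2"
    by (intro pair_gen_superset) auto
  also have "\<dots> = (\<Sum>b\<in>?B. indicator {pair_swap b c} a - indicator {c} a) / 2"
    by (intro arg_cong[where f="\<lambda>x. x / 2"] sum.cong) (auto simp: indicator_def)
  also have "\<dots> = (\<Sum>b\<in>pair_bonds c. indicator {pair_swap b c} a - indicator {c} a) / 2"
    by (intro arg_cong[where f="\<lambda>x. x / 2"] sum.mono_neutral_right) (auto simp: pair_swap_trivial)
  finally show "pair_gen (indicator {c}) a = (\<Sum>b\<in>pair_bonds c. indicator {pair_swap b c} a - indicator {c} a) / 2" .
qed

lemma pair_gen_pow_sum: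
  "(pair_gen ^^ k) (\<lambda>a. \<Sum>b\<in>B. F b a) = (\<lambda>a. \<Sum>b\<in>B. (pair_gen ^^ k) (F b) a)"
proof (induction B rule: infinite_finite_induct)
  case (insert x B)
  then show ?case by (simp add: pair_gen_pow_add)
next
  case (infinite B)
  then show ?case using pair_gen_pow_cmult[of k 0 "\<lambda>_. 0"] by simp
next
  case empty
  then show ?case using pair_gen_pow_cmult[of k 0 "\<lambda>_. 0"] by simp
qed

lemma pair_gen_pow_symmetric:
  "(pair_gen ^^ k) (indicator {c}) a = (pair_gen ^^ k) (indicator {a}) c"
proof (induction k arbitrary: a c)
  case 0
  then show ?case by (auto simp: indicator_def)
next
  case (Suc k)
  \<comment> \<open>One generator is applied to the indicator first, where it acts on the index
    \<open>c\<close>. After the induction hypothesis the same sum is the generator acting from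
    outside on the point \<open>c\<close>.\<close>
  have "(pair_gen ^^ Suc k) (indicator {c}) a = (pair_gen ^^ k) (\<lambda>a. 1/2 * (\<Sum>b\<in>pair_bonds c. indicator {pair_swap b c} a - indicator {c} a)) a"
    by (simp add: funpow_swap1 pair_gen_indicator)
  also have "\<dots> = (\<Sum>b\<in>pair_bonds c. (pair_gen ^^ k) (indicator {pair_swap b c}) a - (pair_gen ^^ k) (indicator {c}) a) / 2"
    by (simp only: pair_gen_pow_cmult pair_gen_pow_sum pair_gen_pow_diff)
  also have "\<dots> = (pair_gen ^^ Suc k) (indicator {a}) c"
    by (simp add: Suc[of _ a] pair_gen_def[of "(pair_gen ^^ k) (indicator {a})"])
  finally show ?case .
qed

lemma pair_sg_symmetric: "pair_sg s (indicator {c}) a = pair_sg s (indicator {a}) c"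
  unfolding pair_sg_def by (intro suminf_cong) (simp only: pair_gen_pow_symmetric[of _ c a])

section \<open>The heat kernel of the simple random walk on the integers\<close>

text \<open>Fourier inversion for the walk jumping at rate 1/2 to each side; equivalently exp (- s)
  times a modified Bessel function of order k at s. In this form the differential equation, the
  monotonicity on the diagonal and the asymptotics can all be read off the integrand.\<close>

definition heat_kernel :: "real \<Rightarrow> int \<Rightarrow> real" where
  "heat_kernel s k = 1 / pi * integral {0..pi} (\<lambda>\<theta>. exp (- s * (1 - cos \<theta>)) * cos (of_int k * \<theta>))"

lemma heat_kernel_integrable:
  "(\<lambda>\<theta>. exp (- s * (1 - cos \<theta>)) * cos (c * \<theta>)) integrable_on {0..pi}"
  by (intro integrable_continuous_real continuous_intros)

lemma heat_kernel_minus: "heat_kernel s (- k) = heat_kernel s k"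
  by (simp add: heat_kernel_def)

text \<open>Differentiation under the integral brings down cos theta - 1, and the addition formula
  for cos ((k + 1) theta) + cos ((k - 1) theta) turns this factor into a discrete Laplacian in
  k.\<close>

lemma heat_kernel_deriv:
  "((\<lambda>s. heat_kernel s k) has_real_derivative
     (heat_kernel s (k + 1) + heat_kernel s (k - 1) - 2 * heat_kernel s k) / 2) (at s)"
proof -
  have d: "((\<lambda>s. integral (cbox 0 pi) (\<lambda>\<theta>. exp (- s * (1 - cos \<theta>)) * cos (of_int k * \<theta>))) has_real_derivative
      integral (cbox 0 pi) (\<lambda>\<theta>. - (1 - cos \<theta>) * exp (- s * (1 - cos \<theta>)) * cos (of_int k * \<theta>))) (at s within UNIV)"
  proof (rule leibniz_rule_field_derivative)
    show "continuous_on (UNIV \<times> cbox 0 pi)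
      (\<lambda>(s, \<theta>). - (1 - cos \<theta>) * exp (- s * (1 - cos \<theta>)) * cos (of_int k * \<theta>))"
      unfolding case_prod_beta by (intro continuous_intros)
    show "(\<lambda>\<theta>. exp (- s * (1 - cos \<theta>)) * cos (of_int k * \<theta>)) integrable_on cbox 0 pi" for s
      unfolding cbox_interval by (rule heat_kernel_integrable)
  qed (auto intro!: derivative_eq_intros)
  have pt: "- (1 - cos \<theta>) * exp (- s * (1 - cos \<theta>)) * cos (of_int k * \<theta>) =
      (exp (- s * (1 - cos \<theta>)) * cos (of_int (k + 1) * \<theta>) + exp (- s * (1 - cos \<theta>)) * cos (of_int (k - 1) * \<theta>)
       - 2 * (exp (- s * (1 - cos \<theta>)) * cos (of_int k * \<theta>))) / 2" for \<theta>
  proof -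
    have "cos (of_int (k + 1) * \<theta>) + cos (of_int (k - 1) * \<theta>) = 2 * (cos \<theta> * cos (of_int k * \<theta>))"
      by (simp add: distrib_right left_diff_distrib cos_add cos_diff)
    then have "exp (- s * (1 - cos \<theta>)) * (cos (of_int (k + 1) * \<theta>) + cos (of_int (k - 1) * \<theta>))
       = exp (- s * (1 - cos \<theta>)) * (2 * (cos \<theta> * cos (of_int k * \<theta>)))" by simp
    then show ?thesis by (simp add: algebra_simps)
  qed
  have "integral {0..pi} (\<lambda>\<theta>. - (1 - cos \<theta>) * exp (- s * (1 - cos \<theta>)) * cos (of_int k * \<theta>)) =
      pi * ((heat_kernel s (k + 1) + heat_kernel s (k - 1) - 2 * heat_kernel s k) / 2)"
    unfolding pt heat_kernel_def
    by (subst integral_divide, subst integral_diff, (intro integrable_add integrable_on_mult_right heat_kernel_integrable)+,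
        subst integral_add, (intro heat_kernel_integrable)+) (simp add: algebra_simps)
  with d have "((\<lambda>s. integral {0..pi} (\<lambda>\<theta>. exp (- s * (1 - cos \<theta>)) * cos (of_int k * \<theta>))) has_real_derivative
      pi * ((heat_kernel s (k + 1) + heat_kernel s (k - 1) - 2 * heat_kernel s k) / 2)) (at s)"
    by (simp only: cbox_interval)
  from DERIV_cmult[OF this, of "1 / pi"] show ?thesis
    unfolding heat_kernel_def[of _ k, abs_def] by simp
qed

lemma heat_kernel_0: "heat_kernel 0 k = of_bool (k = 0)"
proof (cases "k = 0")
  case False
  have "((\<lambda>\<theta>. cos (of_int k * \<theta>)) has_integral sin (of_int k * pi) / of_int k - sin (of_int k * 0) / of_int k) {0..pi}"
  proof (rule fundamental_theorem_of_calculus)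
    fix x :: real
    have "((\<lambda>\<theta>. sin (of_int k * \<theta>) / of_int k) has_real_derivative cos (of_int k * x)) (at x within {0..pi})"
      using False by (auto intro!: derivative_eq_intros)
    then show "((\<lambda>\<theta>. sin (of_int k * \<theta>) / of_int k) has_vector_derivative cos (of_int k * x)) (at x within {0..pi})"
      by (simp add: has_real_derivative_iff_has_vector_derivative)
  qed simp
  then show ?thesis using False by (simp add: heat_kernel_def sin_npi_int mult.commute[of _ pi] integral_unique)
qed (simp add: heat_kernel_def)

lemma heat_kernel_bound:
  assumes "0 \<le> s"
  shows "\<bar>heat_kernel s k\<bar> \<le> 1"
proof -
  have "norm (integral {0..pi} (\<lambda>\<theta>. exp (- s * (1 - cos \<theta>)) * cos (of_int k * \<theta>))) \<le> integral {0..pi} (\<lambda>\<theta>. 1)"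
  proof (rule integral_norm_bound_integral[OF heat_kernel_integrable])
    fix \<theta> :: real
    have "exp (- s * (1 - cos \<theta>)) \<le> 1" using assms by simp
    then have "\<bar>exp (- s * (1 - cos \<theta>))\<bar> * \<bar>cos (of_int k * \<theta>)\<bar> \<le> 1 * 1" by (intro mult_mono) auto
    then show "norm (exp (- s * (1 - cos \<theta>)) * cos (of_int k * \<theta>)) \<le> 1" by (simp add: abs_mult)
  qed (rule integrable_const_ivl)
  then show ?thesis by (simp add: heat_kernel_def abs_mult divide_simps)
qed

lemma heat_kernel_diag_nonneg: "0 \<le> heat_kernel s 0"
  unfolding heat_kernel_def
  by (intro mult_nonneg_nonneg integral_nonneg heat_kernel_integrable) auto

text \<open>At k = 0 the cosine factor is 1, so the integrand itself decreases in time.\<close>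

lemma heat_kernel_diag_antimono:
  assumes "s \<le> s'"
  shows "heat_kernel s' 0 \<le> heat_kernel s 0"
  unfolding heat_kernel_def
proof (intro mult_left_mono integral_le heat_kernel_integrable)
  fix \<theta> :: real
  have "- s' * (1 - cos \<theta>) \<le> - s * (1 - cos \<theta>)" using assms by (intro mult_right_mono) auto
  then show "exp (- s' * (1 - cos \<theta>)) * cos (of_int 0 * \<theta>) \<le> exp (- s * (1 - cos \<theta>)) * cos (of_int 0 * \<theta>)" by simp
qed simp

section \<open>Long-time asymptotics of the return probability and of the limiting integral\<close>

lemma sin_ge_chord:
  assumes "0 \<le> x" "x \<le> pi / 2"
  shows "2 * x / pi \<le> sin x"
proof -
  have "convex_on {0..pi/2} (\<lambda>x. - sin x)"
  proof (rule f''_ge0_imp_convex)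
    fix x assume x: "x \<in> {0..pi/2}"
    show "((\<lambda>x. - sin x) has_real_derivative - cos x) (at x)" by (auto intro!: derivative_eq_intros)
    show "((\<lambda>x. - cos x) has_real_derivative sin x) (at x)" by (auto intro!: derivative_eq_intros)
    show "0 \<le> sin x" using x by (intro sin_ge_zero) auto
  qed simp
  from convex_onD[OF this, of "2 * x / pi" 0 "pi / 2"] assms show ?thesis by (simp add: divide_simps)
qed

text \<open>The half-angle formula and Jordan's inequality; this supplies the Gaussian majorant on
  the whole range {0..pi}.\<close>

lemma one_minus_cos_ge:
  assumes "0 \<le> x" "x \<le> pi"
  shows "2 * x\<^sup>2 / pi\<^sup>2 \<le> 1 - cos x"
proof -
  have "2 * (x / 2) / pi \<le> sin (x / 2)" using assms by (intro sin_ge_chord) auto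
  then have "(x / pi)\<^sup>2 \<le> (sin (x / 2))\<^sup>2" using assms by (intro power_mono) auto
  moreover have "1 - cos x = 2 * (sin (x / 2))\<^sup>2"
    using cos_double_sin[of "x / 2"] by simp
  ultimately show ?thesis by (simp add: power_divide)
qed

lemma heat_kernel_diag_lborel:
  "heat_kernel s 0 = 1 / pi * (\<integral>\<theta>. indicator {0..pi} \<theta> * exp (- s * (1 - cos \<theta>)) \<partial>lborel)"
proof -
  have "set_integrable lborel {0..pi} (\<lambda>\<theta>. exp (- s * (1 - cos \<theta>)))"
    by (intro borel_integrable_atLeastAtMost' continuous_intros)
  from set_borel_integral_eq_integral(2)[OF this] show ?thesis
    by (simp add: heat_kernel_def set_lebesgue_integral_def)
qed

text \<open>Laplace's method: after theta = y / sqrt u the exponent - 2 u (1 - cos (y / sqrt u))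
  tends to - y^2, and the half-line Gaussian integral is sqrt pi / 2.\<close>

lemma heat_kernel_diag_asymp: "((\<lambda>u. sqrt u * heat_kernel (2 * u) 0) \<longlongrightarrow> 1 / (2 * sqrt pi)) at_top"
proof -
  define f where "f u y = indicator {0..pi} (y / sqrt u) * exp (- (2 * u) * (1 - cos (y / sqrt u)))" for u y :: real
  have eq: "\<forall>\<^sub>F u in at_top. 1 / pi * integral\<^sup>L lborel (f u) = sqrt u * heat_kernel (2 * u) 0"
    using eventually_gt_at_top[of 0]
  proof eventually_elim
    case (elim u)
    have "(\<integral>\<theta>. indicator {0..pi} \<theta> * exp (- (2 * u) * (1 - cos \<theta>)) \<partial>lborel) =
       \<bar>1 / sqrt u\<bar> *\<^sub>R (\<integral>y. indicator {0..pi} (0 + 1 / sqrt u * y) * exp (- (2 * u) * (1 - cos (0 + 1 / sqrt u * y))) \<partial>lborel)"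
      using elim by (intro lborel_integral_real_affine) auto
    then show ?case using elim by (simp add: heat_kernel_diag_lborel f_def[abs_def])
  qed
  have "((\<lambda>u. integral\<^sup>L lborel (f u)) \<longlongrightarrow> (\<integral>y. indicator {0..} y *\<^sub>R exp (- y\<^sup>2) \<partial>lborel)) at_top"
  proof (rule integral_dominated_convergence_at_top)
    show "f u \<in> borel_measurable lborel" for u unfolding f_def by measurable
    show "(\<lambda>y. indicator {0..} y *\<^sub>R exp (- y\<^sup>2 :: real)) \<in> borel_measurable lborel" by measurable
    \<comment> \<open>The quadratic lower bound for 1 - cos gives 2 u * 2 (y / sqrt u)^2 / pi^2 = (2
      y / pi)^2, independent of u.\<close>
    define w where "w y = indicator {0..} (2 * y / pi) * exp (- (2 * y / pi)\<^sup>2)" for y :: real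
    have "integrable lborel (\<lambda>x::real. indicator {0..} x * exp (- x\<^sup>2))"
      using gaussian_moment_0 by (auto simp: has_bochner_integral_iff)
    from lborel_integrable_real_affine[OF this, of "2 / pi" 0]
    show "integrable lborel w" by (simp add: w_def[abs_def])
    show "\<forall>\<^sub>F u in at_top. AE y in lborel. norm (f u y) \<le> w y"
      using eventually_gt_at_top[of 0]
    proof eventually_elim
      case (elim u)
      show ?case
      proof (rule AE_I2)
        fix y
        show "norm (f u y) \<le> w y"
        proof (cases "y / sqrt u \<in> {0..pi}")
          case True
          have "2 * (y / sqrt u)\<^sup>2 / pi\<^sup>2 \<le> 1 - cos (y / sqrt u)"
            using True by (intro one_minus_cos_ge) auto
          then have "2 * u * (2 * (y / sqrt u)\<^sup>2 / pi\<^sup>2) \<le> 2 * u * (1 - cos (y / sqrt u))"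
            using elim by (intro mult_left_mono) auto
          moreover have "2 * u * (2 * (y / sqrt u)\<^sup>2 / pi\<^sup>2) = (2 * y / pi)\<^sup>2"
            using elim by (simp add: power_divide power_mult_distrib)
          moreover have "0 \<le> y" using True elim by (simp add: zero_le_divide_iff)
          ultimately show ?thesis using True by (simp add: f_def w_def indicator_def)
        qed (simp add: f_def w_def)
      qed
    qed
    show "AE y in lborel. ((\<lambda>u. f u y) \<longlongrightarrow> indicator {0..} y *\<^sub>R exp (- y\<^sup>2)) at_top"
    proof (rule AE_I2)
      fix y :: real
      consider "y < 0" | "y = 0" | "y > 0" by linarith
      then show "((\<lambda>u. f u y) \<longlongrightarrow> indicator {0..} y *\<^sub>R exp (- y\<^sup>2)) at_top"
      proof cases
        case 1
        have "\<forall>\<^sub>F u in at_top. 0 = f u y"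
          using eventually_gt_at_top[of 0] by eventually_elim (use 1 in \<open>simp add: f_def zero_le_divide_iff indicator_def\<close>)
        then show ?thesis using 1 by (auto intro: Lim_transform_eventually)
      next
        case 2
        then show ?thesis by (simp add: f_def)
      next
        case 3
        have "\<forall>\<^sub>F u in at_top. y / sqrt u < pi" using 3 by real_asymp
        then have "\<forall>\<^sub>F u in at_top. exp (- (2 * u) * (1 - cos (y / sqrt u))) = f u y"
          using eventually_gt_at_top[of 0] by eventually_elim (use 3 in \<open>simp add: f_def\<close>)
        moreover have "((\<lambda>u. exp (- (2 * u) * (1 - cos (y / sqrt u)))) \<longlongrightarrow> exp (- y\<^sup>2)) at_top"
          using 3 unfolding power2_eq_square by real_asymp
        ultimately show ?thesis using 3 by (auto intro: Lim_transform_eventually)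
      qed
    qed
  qed
  then have "((\<lambda>u. integral\<^sup>L lborel (f u)) \<longlongrightarrow> sqrt pi / 2) at_top"
    by (simp only: has_bochner_integral_integral_eq[OF gaussian_moment_0])
  from tendsto_mult_left[OF this, of "1 / pi"]
  have "((\<lambda>u. 1 / pi * integral\<^sup>L lborel (f u)) \<longlongrightarrow> 1 / pi * (sqrt pi / 2)) at_top" .
  moreover have "1 / pi * (sqrt pi / 2) = 1 / (2 * sqrt pi)"
    using real_sqrt_mult_self[of pi] by (simp add: divide_simps)
  ultimately show ?thesis using Lim_transform_eventually[OF _ eq] by simp
qed

lemma heat_kernel_continuous: "continuous_on A (\<lambda>s. heat_kernel s k)"
  using heat_kernel_deriv by (intro continuous_at_imp_continuous_on ballI DERIV_isCont)

lemma heat_kernel_diag_tendsto_0: "((\<lambda>u. heat_kernel u 0) \<longlongrightarrow> 0) at_top"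
proof -
  have "((\<lambda>u. inverse (sqrt u) * (sqrt u * heat_kernel (2 * u) 0)) \<longlongrightarrow> 0 * (1 / (2 * sqrt pi))) at_top"
    by (intro tendsto_mult heat_kernel_diag_asymp tendsto_inverse_0_at_top sqrt_at_top)
  moreover have "\<forall>\<^sub>F u in at_top. inverse (sqrt u) * (sqrt u * heat_kernel (2 * u) 0) = heat_kernel (2 * u) 0"
    using eventually_gt_at_top[of 0] by eventually_elim simp
  ultimately have "((\<lambda>u. heat_kernel (2 * u) 0) \<longlongrightarrow> 0) at_top"
    using Lim_transform_eventually by fastforce
  moreover have "filterlim (\<lambda>u::real. u / 2) at_top at_top" by real_asymp
  ultimately have "((\<lambda>u. heat_kernel (2 * (u / 2)) 0) \<longlongrightarrow> 0) at_top"
    by (rule filterlim_compose)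
  then show ?thesis by simp
qed

text \<open>The closed form of the variance. Of the prefactor, one 1/2 is the clock rate and the
  other comes from the mixed second difference in \<open>pair_sg_both_even\<close>.\<close>

definition flux_variance :: "real \<Rightarrow> real" where
  "flux_variance t = 1 / 4 * integral {0..t} (\<lambda>s. heat_kernel (2 * (t - s)) 0 * (1 + heat_kernel (2 * s) 0))"

lemma flux_variance_asymp: "((\<lambda>t. flux_variance t / sqrt t) \<longlongrightarrow> 1 / (4 * sqrt pi)) at_top"
proof -
  define r where "r u = heat_kernel (2 * u) 0" for u
  define R where "R t = integral {0..t} r" for t
  have cont: "continuous_on A r" for A
    unfolding r_def by (rule continuous_on_compose2[OF heat_kernel_continuous[of UNIV 0]]) (auto intro!: continuous_intros)
  have int[intro]: "r integrable_on {a..b}" for a b by (intro integrable_continuous_real cont)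
  have cont': "continuous_on A (\<lambda>s. r (t - s))" for A t
    by (rule continuous_on_compose2[OF cont[of UNIV]]) (auto intro!: continuous_intros)
  have refl: "integral {0..t} (\<lambda>s. r (t - s)) = R t" if "0 \<le> t" for t
  proof -
    have "((\<lambda>s. r s) has_integral R t) {0..t}" unfolding R_def by (intro integrable_integral int)
    from has_integral_affinity[OF this[folded cbox_interval], of "-1" t]
    have "((\<lambda>x. r (t - x)) has_integral R t) ((\<lambda>x. t - x) ` {0..t})"
      by simp
    moreover have "(\<lambda>x. t - x) ` {0..t} = {0..t}" by (auto simp: image_iff intro!: exI[of _ "t - _"] bexI[of _ "t - _"])
    ultimately show ?thesis by (simp add: integral_unique)
  qed
  \<comment> \<open>By l'Hospital the ratio behaves like 2 sqrt t * r t, whose limit is twice 1 / (2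
    sqrt pi).\<close>
  have Rlim: "((\<lambda>t. R t / sqrt t) \<longlongrightarrow> 1 / sqrt pi) at_top"
  proof (rule lhospital_at_top_at_top)
    show "filterlim sqrt at_top at_top" by (rule sqrt_at_top)
    show "\<forall>\<^sub>F t in at_top. inverse (sqrt t) / 2 \<noteq> 0"
      using eventually_gt_at_top[of 0] by eventually_elim simp
    show "\<forall>\<^sub>F t in at_top. (R has_real_derivative r t) (at t)"
      using eventually_gt_at_top[of 0]
    proof eventually_elim
      case (elim t)
      have "((\<lambda>u. integral {0..u} r) has_vector_derivative r t) (at t within {0..t+1})"
        by (rule integral_has_vector_derivative[OF cont]) (use elim in auto)
      then show ?case using elim at_within_Icc_at[of 0 t "t + 1"]
        by (simp add: R_def[abs_def] has_real_derivative_iff_has_vector_derivative)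
    qed
    show "\<forall>\<^sub>F t in at_top. (sqrt has_real_derivative inverse (sqrt t) / 2) (at t)"
      using eventually_gt_at_top[of 0] by eventually_elim (rule DERIV_real_sqrt)
    have "((\<lambda>t. 2 * (sqrt t * r t)) \<longlongrightarrow> 2 * (1 / (2 * sqrt pi))) at_top"
      unfolding r_def by (intro tendsto_mult_left heat_kernel_diag_asymp)
    then show "((\<lambda>t. r t / (inverse (sqrt t) / 2)) \<longlongrightarrow> 1 / sqrt pi) at_top"
      by (simp add: field_simps)
  qed
  have r0: "0 \<le> r s" for s by (simp add: r_def heat_kernel_diag_nonneg)
  define E where "E t = integral {0..t} (\<lambda>s. r (t - s) * r s)" for t
  have E0: "0 \<le> E t" for t
    unfolding E_def by (intro integral_nonneg integrable_continuous_real continuous_on_mult cont cont' mult_nonneg_nonneg r0)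
  \<comment> \<open>One of the times s and t - s is at least t / 2, so one factor of the convolution
    is at most \<open>r (t / 2)\<close>, which tends to 0.\<close>
  have E1: "E t \<le> r (t / 2) * (2 * R t)" if t: "0 \<le> t" for t
  proof -
    have "E t \<le> integral {0..t} (\<lambda>s. r (t / 2) * (r s + r (t - s)))"
      unfolding E_def
    proof (intro integral_le integrable_continuous_real continuous_on_mult continuous_on_add continuous_on_const cont cont')
      fix s
      have mono: "r u \<le> r v" if "v \<le> u" for u v
        using that by (simp add: r_def heat_kernel_diag_antimono)
      show "r (t - s) * r s \<le> r (t / 2) * (r s + r (t - s))"
      proof (cases "s \<le> t / 2")
        case True
        then have "r (t - s) * r s \<le> r (t / 2) * r s" by (intro mult_right_mono mono r0) auto
        then show ?thesis using mult_nonneg_nonneg[OF r0[of "t/2"] r0[of "t - s"]] by (simp add: algebra_simps)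
      next
        case False
        then have "r s * r (t - s) \<le> r (t / 2) * r (t - s)" by (intro mult_right_mono mono r0) auto
        then show ?thesis using mult_nonneg_nonneg[OF r0[of "t/2"] r0[of "s"]] by (simp add: algebra_simps)
      qed
    qed
    also have "\<dots> = r (t / 2) * (R t + R t)"
      by (subst integral_mult_right, subst integral_add)
         (auto simp: refl[OF t] R_def[symmetric] intro!: integrable_continuous_real cont cont')
    finally show ?thesis by simp
  qed
  have rl: "((\<lambda>t. r (t / 2)) \<longlongrightarrow> 0) at_top"
    unfolding r_def using heat_kernel_diag_tendsto_0 by simp
  have "((\<lambda>t. r (t / 2) * (2 * (R t / sqrt t))) \<longlongrightarrow> 0 * (2 * (1 / sqrt pi))) at_top"
    by (intro tendsto_mult rl tendsto_const Rlim)
  then have up: "((\<lambda>t. r (t / 2) * (2 * (R t / sqrt t))) \<longlongrightarrow> 0) at_top" by simp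
  have Elim: "((\<lambda>t. E t / sqrt t) \<longlongrightarrow> 0) at_top"
  proof (rule tendsto_sandwich[OF _ _ tendsto_const up])
    show "\<forall>\<^sub>F t in at_top. 0 \<le> E t / sqrt t"
      using eventually_gt_at_top[of 0] by eventually_elim (simp add: E0)
    show "\<forall>\<^sub>F t in at_top. E t / sqrt t \<le> r (t / 2) * (2 * (R t / sqrt t))"
      using eventually_gt_at_top[of 0]
      by eventually_elim (use E1 in \<open>auto simp: divide_simps\<close>)
  qed
  have "((\<lambda>t. 1 / 4 * (R t / sqrt t + E t / sqrt t)) \<longlongrightarrow> 1 / 4 * (1 / sqrt pi + 0)) at_top"
    by (intro tendsto_mult tendsto_add Rlim Elim tendsto_const)
  moreover have "\<forall>\<^sub>F t in at_top. 1 / 4 * (R t / sqrt t + E t / sqrt t) =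
      1 / 4 * integral {0..t} (\<lambda>s. r (t - s) * (1 + r s)) / sqrt t"
    using eventually_gt_at_top[of 0]
  proof eventually_elim
    case (elim t)
    have "integral {0..t} (\<lambda>s. r (t - s) * (1 + r s)) = R t + E t"
      unfolding distrib_left mult_1_right
      by (subst integral_add) (use elim in \<open>auto simp: refl E_def intro!: integrable_continuous_real continuous_on_mult cont cont'\<close>)
    then show ?case by (simp add: add_divide_distrib)
  qed
  ultimately show ?thesis unfolding flux_variance_def r_def[symmetric] using Lim_transform_eventually by fastforce
qed

text \<open>
  The distance of two stirring particles is a walk on \<open>{1, 2, ...}\<close> reflected at \<open>1\<close>. For the initial
  condition \<open>(-1)^k\<close> the sum of two neighbouring values of the solution is a solution on the whole
  line, namely a multiple of the heat kernel; the value at \<open>0\<close> encodes the reflection.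
\<close>

primrec alt_heat :: "real \<Rightarrow> nat \<Rightarrow> real" where
  "alt_heat s 0 = - heat_kernel (2 * s) 0"
| "alt_heat s (Suc k) = - alt_heat s k - 2 * heat_kernel (2 * s) (int k)"

lemma heat_kernel_deriv2:
  "((\<lambda>s. heat_kernel (2 * s) k) has_real_derivative
     (heat_kernel (2 * s) (k + 1) + heat_kernel (2 * s) (k - 1) - 2 * heat_kernel (2 * s) k)) (at s)"
proof -
  have "((\<lambda>s. 2 * s) has_real_derivative 2) (at s)" by (auto intro!: derivative_eq_intros)
  note * = DERIV_chain2[OF heat_kernel_deriv[of k "2 * s"] this]
  have "x / 2 * 2 = x" for x :: real by simp
  from *[unfolded this] show ?thesis .
qed

text \<open>The induction transports the equation along the recursion, since the heat kernel term
  solves the same equation. In the base case the values at 0 and 1 are both minus the return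
  probability, so the right-hand side is the reflected one,
  \<open>alt_heat s 2 - alt_heat s 1\<close>.\<close>

lemma alt_heat_deriv:
  "((\<lambda>s. alt_heat s (Suc k)) has_real_derivative alt_heat s (Suc (Suc k)) + alt_heat s k - 2 * alt_heat s (Suc k)) (at s)"
proof (induction k)
  case 0
  show ?case
    by (auto intro!: derivative_eq_intros heat_kernel_deriv2 simp: heat_kernel_minus[of _ 1, simplified])
next
  case (Suc k)
  have "((\<lambda>s. - alt_heat s (Suc k) - 2 * heat_kernel (2 * s) (int (Suc k))) has_real_derivative
      - (alt_heat s (Suc (Suc k)) + alt_heat s k - 2 * alt_heat s (Suc k))
      - 2 * (heat_kernel (2 * s) (int (Suc k) + 1) + heat_kernel (2 * s) (int (Suc k) - 1) - 2 * heat_kernel (2 * s) (int (Suc k)))) (at s)"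
    by (intro DERIV_diff DERIV_minus DERIV_cmult Suc heat_kernel_deriv2)
  then show ?case by (simp add: algebra_simps)
qed

text \<open>Index 0 is excluded: the auxiliary boundary value there is -1 at time 0, not 1.\<close>

lemma alt_heat_0: "alt_heat 0 (Suc k) = (- 1) ^ Suc k"
  by (induction k) (auto simp: heat_kernel_0)

text \<open>Unrolling the recursion; with \<open>sum_abs_heat_kernel\<close> the bound becomes
  uniform in k, as \<open>pair_sg_unique\<close> requires.\<close>

lemma alt_heat_bound:
  "\<bar>alt_heat s k\<bar> \<le> \<bar>heat_kernel (2 * s) 0\<bar> + 2 * (\<Sum>j<k. \<bar>heat_kernel (2 * s) (int j)\<bar>)"
  by (induction k) auto

section \<open>Time discretisation\<close>

text \<open>In use, \<open>e b\<close> records only whether bond b rang during a time slot. If both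
  adjacent bonds rang, the right one is preferred arbitrarily; such slots have probability of order
  h^2 and disappear from a fixed path on fine grids.\<close>

definition jump :: "(int \<Rightarrow> bool) \<Rightarrow> int \<Rightarrow> int" where
  "jump e p = (if e p then p + 1 else if e (p - 1) then p - 1 else p)"

primrec jump_chain :: "(int \<times> nat \<Rightarrow> bool) \<Rightarrow> int \<Rightarrow> nat \<Rightarrow> int" where
  "jump_chain e x 0 = x"
| "jump_chain e x (Suc k) = jump (\<lambda>b. e (b, k)) (jump_chain e x k)"

lemma jump_chain_range: "jump_chain e x k \<in> {x - int k..x + int k}"
  by (induction k) (auto simp: jump_def)

text \<open>The position before slot k reads earlier slots only, which makes it independent of slot
  k.\<close>

lemma jump_chain_cong:
  assumes "\<And>b j. j < k \<Longrightarrow> e (b, j) = e' (b, j)"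
  shows "jump_chain e x k = jump_chain e' x k"
  using assms by (induction k) (auto simp: jump_def)

lemma measurable_jump_chain:
  assumes "\<And>b j. j < k \<Longrightarrow> E (b, j) \<in> M \<rightarrow>\<^sub>M counting"
  shows "(\<lambda>\<omega>. jump_chain (\<lambda>i. E i \<omega>) x k) \<in> M \<rightarrow>\<^sub>M counting"
  using assms
proof (induction k)
  case (Suc k)
  note Suc.prems[of k, simplified, measurable]
  have "(\<lambda>\<omega>. jump (\<lambda>b. E (b, k) \<omega>) p) \<in> M \<rightarrow>\<^sub>M counting" for p
    unfolding jump_def by measurable
  from measurable_compose_countable[OF this Suc.IH] Suc.prems show ?case by simp
qed simp

lemma jump_pair_trivial:
  assumes "\<forall>b\<in>pair_bonds (p, q). \<not> e b"
  shows "(jump e p, jump e q) = (p, q)"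
  using assms by (auto simp: jump_def pair_bonds_def)

lemma jump_single:
  assumes c: "e c" and p: "e p \<Longrightarrow> p = c" "e (p - 1) \<Longrightarrow> p - 1 = c"
  shows "jump e p = swap_bond c p"
proof -
  consider "p = c" | "p = c + 1" | "p \<noteq> c" "p \<noteq> c + 1" by blast
  then show ?thesis
  proof cases
    case 1
    then show ?thesis using c by (simp add: jump_def swap_bond_def)
  next
    case 2
    then have "\<not> e p" using p(1) by auto
    then show ?thesis using c 2 by (simp add: jump_def swap_bond_def)
  next
    case 3
    then have "\<not> e p" "\<not> e (p - 1)" using p by auto
    then show ?thesis using 3 by (simp add: jump_def swap_bond_def)
  qed
qed

lemma jump_pair_single:
  assumes "e c" "\<forall>b\<in>pair_bonds (p, q). e b \<longrightarrow> b = c"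
  shows "(jump e p, jump e q) = pair_swap c (p, q)"
  unfolding pair_swap_pair
  by (intro arg_cong2[where f=Pair] jump_single assms) (use assms in \<open>simp_all add: pair_bonds_def\<close>)

text \<open>First-order expansion in the ringing bonds. It is exact if at most one relevant bond
  rings. Otherwise the double sum is at least 1 and the left side at most 10 K: 2 K from the two
  values of \<open>F\<close> and 4 * 2 K from the sum over bonds.\<close>

lemma jump_pair_expansion:
  fixes F :: "int \<times> int \<Rightarrow> real"
  assumes F: "\<And>a. \<bar>F a\<bar> \<le> K"
  shows "\<bar>F (jump e p, jump e q) - F (p, q)
      - (\<Sum>b\<in>pair_bonds (p, q). (F (pair_swap b (p, q)) - F (p, q)) * of_bool (e b))\<bar>
     \<le> 10 * K * (\<Sum>b\<in>pair_bonds (p, q). \<Sum>c\<in>pair_bonds (p, q) - {b}. of_bool (e b) * of_bool (e c))"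
    (is "\<bar>?D\<bar> \<le> 10 * K * ?Z")
proof -
  let ?T = "pair_bonds (p, q)"
  have K: "0 \<le> K" by (rule order_trans[OF abs_ge_zero F[of "(0, 0)"]])
  have Z0: "0 \<le> ?Z" by (intro sum_nonneg) auto
  show ?thesis
  proof (cases "\<exists>b\<in>?T. \<exists>c\<in>?T. b \<noteq> c \<and> e b \<and> e c")
    case True
    then obtain b c where bc: "b \<in> ?T" "c \<in> ?T - {b}" "e b" "e c" by blast
    have "1 = of_bool (e b) * (of_bool (e c) :: real)" using bc by simp
    also have "\<dots> \<le> (\<Sum>c\<in>?T - {b}. of_bool (e b) * of_bool (e c))"
      using bc(2) by (intro member_le_sum[where f="\<lambda>c. of_bool (e b) * of_bool (e c)"]) auto
    also have "\<dots> \<le> ?Z"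
      by (rule member_le_sum[where f="\<lambda>b. \<Sum>c\<in>?T - {b}. of_bool (e b) * of_bool (e c)"])
         (use bc(1) in \<open>auto intro!: sum_nonneg\<close>)
    finally have Z: "1 \<le> ?Z" .
    have "\<bar>(F (pair_swap b (p, q)) - F (p, q)) * of_bool (e b)\<bar> \<le> 2 * K" for b
      using F[of "pair_swap b (p, q)"] F[of "(p, q)"] K by (cases "e b") auto
    then have "\<bar>\<Sum>b\<in>?T. (F (pair_swap b (p, q)) - F (p, q)) * of_bool (e b)\<bar> \<le> (\<Sum>b\<in>?T. 2 * K)"
      by (intro order_trans[OF sum_abs] sum_mono)
    also have "\<dots> \<le> 4 * (2 * K)"
      using mult_right_mono[of "real (card ?T)" 4 "2 * K"] card_pair_bonds[of "(p, q)"] K by simp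
    finally have "\<bar>?D\<bar> \<le> 10 * K"
      using F[of "(jump e p, jump e q)"] F[of "(p, q)"] by linarith
    also have "\<dots> \<le> 10 * K * ?Z" using mult_left_mono[OF Z, of "10 * K"] K by simp
    finally show ?thesis .
  next
    case False
    have "?D = 0"
    proof (cases "\<exists>c\<in>?T. e c")
      case True
      then obtain c where c: "c \<in> ?T" "e c" by blast
      have uniq: "\<forall>b\<in>?T. e b \<longrightarrow> b = c" using False c by blast
      have "(\<Sum>b\<in>?T. (F (pair_swap b (p, q)) - F (p, q)) * of_bool (e b)) =
          (\<Sum>b\<in>{c}. (F (pair_swap b (p, q)) - F (p, q)) * of_bool (e b))"
      proof (rule sum.mono_neutral_right)
        show "\<forall>b\<in>?T - {c}. (F (pair_swap b (p, q)) - F (p, q)) * of_bool (e b) = 0"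
          using uniq by (metis DiffE insertI1 mult_zero_right of_bool_eq(1))
      qed (use c(1) in auto)
      then show ?thesis using jump_pair_single[of e c p q, OF c(2) uniq] c(2) by simp
    next
      case nex: False
      then have "\<forall>b\<in>?T. \<not> e b" by blast
      moreover from this have "(\<Sum>b\<in>?T. (F (pair_swap b (p, q)) - F (p, q)) * of_bool (e b)) = 0"
        by (intro sum.neutral) simp
      ultimately show ?thesis by (simp only: jump_pair_trivial)
    qed
    then show ?thesis using K Z0 by simp
  qed
qed

lemma measurable_Pair_count:
  fixes X :: "'a \<Rightarrow> 'b :: countable" and Y :: "'a \<Rightarrow> 'c :: countable"
  assumes "X \<in> M \<rightarrow>\<^sub>M counting" "Y \<in> M \<rightarrow>\<^sub>M counting"
  shows "(\<lambda>\<omega>. (X \<omega>, Y \<omega>)) \<in> M \<rightarrow>\<^sub>M counting"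
  using measurable_Pair[OF assms] by (simp add: pair_measure_countable)

lemma one_minus_exp_bounds:
  fixes x :: real
  assumes "0 \<le> x"
  shows "0 \<le> 1 - exp (- x)" "1 - exp (- x) \<le> x" "\<bar>1 - exp (- x) - x\<bar> \<le> x\<^sup>2 / 2"
proof -
  show "0 \<le> 1 - exp (- x)" using assms by simp
  show le: "1 - exp (- x) \<le> x" using exp_ge_add_one_self[of "- x"] by linarith
  have "x - x\<^sup>2 / 2 - (1 - exp (- x)) \<le> 0 - 0\<^sup>2 / 2 - (1 - exp (- 0))"
  proof (rule DERIV_nonpos_imp_nonincreasing[OF assms])
    fix u assume u: "0 \<le> u" "u \<le> x"
    show "\<exists>y. ((\<lambda>x. x - x\<^sup>2 / 2 - (1 - exp (- x))) has_real_derivative y) (at u) \<and> y \<le> 0"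
      using exp_ge_add_one_self[of "- u"]
      by (intro exI[of _ "1 - u - exp (- u)"]) (auto intro!: derivative_eq_intros)
  qed
  with le show "\<bar>1 - exp (- x) - x\<bar> \<le> x\<^sup>2 / 2" by auto
qed

section \<open>The grid chain in expectation, and independence of its time slots\<close>

context prob_space
begin

lemma expectation_of_bool: "expectation (\<lambda>\<omega>. of_bool (P \<omega>)) = prob {\<omega>\<in>space M. P \<omega>}"
proof -
  have "expectation (\<lambda>\<omega>. of_bool (P \<omega>)) = (\<integral>\<omega>. indicator {\<omega>\<in>space M. P \<omega>} \<omega> \<partial>M)"
    by (intro Bochner_Integration.integral_cong) (auto simp: indicator_def)
  also have "\<dots> = prob ({\<omega>\<in>space M. P \<omega>} \<inter> space M)" by (rule Bochner_Integration.integral_indicator)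
  finally show ?thesis by (simp add: Int_absorb2)
qed

text \<open>Of the constant 41, the part 40 = 10 * 16 / 4 comes from two bonds ringing in one slot
  (at most 16 ordered pairs, each of probability at most (h / 2)^2). The remaining 1 comes from
  replacing 1 - exp (- h / 2) by h / 2.\<close>

lemma expectation_jump_pair:
  assumes rv[measurable]: "\<And>b. I b \<in> M \<rightarrow>\<^sub>M counting"
    and I: "\<And>b. prob {\<omega>\<in>space M. I b \<omega>} = 1 - exp (- h / 2)"
    and II: "\<And>b c. b \<noteq> c \<Longrightarrow> prob {\<omega>\<in>space M. I b \<omega> \<and> I c \<omega>} = (1 - exp (- h / 2)) * (1 - exp (- h / 2))"
    and h: "0 \<le> h" and F: "\<And>a. \<bar>F a\<bar> \<le> K"
  shows "\<bar>expectation (\<lambda>\<omega>. F (jump (\<lambda>b. I b \<omega>) p, jump (\<lambda>b. I b \<omega>) q)) - F (p, q) - h * pair_gen F (p, q)\<bar>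
      \<le> 41 * K * h\<^sup>2"
proof -
  let ?T = "pair_bonds (p, q)"
  let ?\<pi> = "1 - exp (- h / 2)"
  have K: "0 \<le> K" by (rule order_trans[OF abs_ge_zero F[of "(0, 0)"]])
  have [measurable]: "(\<lambda>\<omega>. jump (\<lambda>b. I b \<omega>) p) \<in> M \<rightarrow>\<^sub>M counting" for p
    unfolding jump_def by measurable
  have EI: "expectation (\<lambda>\<omega>. of_bool (I b \<omega>)) = ?\<pi>" for b
  by (simp only: expectation_of_bool I)
  have intI[simp]: "integrable M (\<lambda>\<omega>. of_bool (I b \<omega>) :: real)" for b
    by (rule integrable_const_bound[where B=1]) auto
  have intII[simp]: "integrable M (\<lambda>\<omega>. of_bool (I b \<omega>) * of_bool (I c \<omega>) :: real)" for b c
    by (rule integrable_const_bound[where B=1]) auto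
  have EII: "expectation (\<lambda>\<omega>. of_bool (I b \<omega>) * of_bool (I c \<omega>)) = ?\<pi> * ?\<pi>" if "b \<noteq> c" for b c
    unfolding of_bool_conj[symmetric] expectation_of_bool by (rule II[OF that])
  have intF: "integrable M (\<lambda>\<omega>. F (jump (\<lambda>b. I b \<omega>) p, jump (\<lambda>b. I b \<omega>) q))"
  proof (rule integrable_const_bound[where B=K])
    show "(\<lambda>\<omega>. F (jump (\<lambda>b. I b \<omega>) p, jump (\<lambda>b. I b \<omega>) q)) \<in> borel_measurable M"
      by (rule measurable_compose[where N="counting" and g=F])
         (auto intro!: measurable_Pair_count)
  qed (use F in auto)
  let ?D = "\<lambda>\<omega>. F (jump (\<lambda>b. I b \<omega>) p, jump (\<lambda>b. I b \<omega>) q) - F (p, q)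
      - (\<Sum>b\<in>?T. (F (pair_swap b (p, q)) - F (p, q)) * of_bool (I b \<omega>))"
  let ?Z = "\<lambda>\<omega>. \<Sum>b\<in>?T. \<Sum>c\<in>?T - {b}. of_bool (I b \<omega>) * of_bool (I c \<omega>) :: real"
  have intD: "integrable M ?D"
    by (intro Bochner_Integration.integrable_diff Bochner_Integration.integrable_sum integrable_mult_right intF intI integrable_const)
  have intZ: "integrable M ?Z"
    by (intro Bochner_Integration.integrable_sum intII)
  have "\<bar>expectation ?D\<bar> \<le> expectation (\<lambda>\<omega>. \<bar>?D \<omega>\<bar>)"
    by (rule integral_abs_bound)
  also have "\<dots> \<le> expectation (\<lambda>\<omega>. 10 * K * ?Z \<omega>)"
    by (intro integral_mono integrable_abs intD integrable_mult_right intZ jump_pair_expansion F)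
  also have "\<dots> = 10 * K * expectation ?Z"
    by (rule Bochner_Integration.integral_mult_right_zero)
  also have "expectation ?Z = (\<Sum>b\<in>?T. \<Sum>c\<in>?T - {b}. ?\<pi> * ?\<pi>)"
  proof (subst Bochner_Integration.integral_sum)
    show "(\<Sum>b\<in>?T. expectation (\<lambda>\<omega>. \<Sum>c\<in>?T - {b}. of_bool (I b \<omega>) * of_bool (I c \<omega>))) = (\<Sum>b\<in>?T. \<Sum>c\<in>?T - {b}. ?\<pi> * ?\<pi>)"
      by (intro sum.cong refl, subst Bochner_Integration.integral_sum, rule intII) (intro sum.cong refl EII, auto)
  qed (intro Bochner_Integration.integrable_sum intII)
  also have "(\<Sum>b\<in>?T. \<Sum>c\<in>?T - {b}. ?\<pi> * ?\<pi>) \<le> 16 * (?\<pi> * ?\<pi>)"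
  proof -
    have "(\<Sum>b\<in>?T. \<Sum>c\<in>?T - {b}. ?\<pi> * ?\<pi>) \<le> (\<Sum>b\<in>?T. \<Sum>c\<in>?T. ?\<pi> * ?\<pi>)"
      by (intro sum_mono sum_mono2) auto
    also have "\<dots> = real (card ?T * card ?T) * (?\<pi> * ?\<pi>)" by simp
    also have "\<dots> \<le> 16 * (?\<pi> * ?\<pi>)"
      using mult_mono[OF card_pair_bonds[of "(p, q)"] card_pair_bonds[of "(p, q)"]]
      by (intro mult_right_mono) (simp_all flip: of_nat_mult)
    finally show ?thesis .
  qed
  also have "?\<pi> * ?\<pi> \<le> h / 2 * (h / 2)"
    using one_minus_exp_bounds(1,2)[of "h / 2"] h by (intro mult_mono) auto
  finally have 1: "\<bar>expectation ?D\<bar> \<le> 40 * K * h\<^sup>2"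
    using K by (simp add: power2_eq_square mult_left_mono)
  have ED: "expectation ?D = expectation (\<lambda>\<omega>. F (jump (\<lambda>b. I b \<omega>) p, jump (\<lambda>b. I b \<omega>) q)) - F (p, q)
      - 2 * ?\<pi> * pair_gen F (p, q)"
  proof -
    have "(\<Sum>b\<in>?T. (F (pair_swap b (p, q)) - F (p, q)) * ?\<pi>) = 2 * ?\<pi> * pair_gen F (p, q)"
      unfolding pair_gen_def sum_distrib_right[symmetric] by simp
    moreover have "expectation (\<lambda>\<omega>. \<Sum>b\<in>?T. (F (pair_swap b (p, q)) - F (p, q)) * of_bool (I b \<omega>)) =
        (\<Sum>b\<in>?T. (F (pair_swap b (p, q)) - F (p, q)) * ?\<pi>)"
      by (subst Bochner_Integration.integral_sum)
         (intro integrable_mult_right intI, intro sum.cong refl, simp only: Bochner_Integration.integral_mult_right_zero EI)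
    ultimately show ?thesis
      by (subst Bochner_Integration.integral_diff,
          intro Bochner_Integration.integrable_diff intF integrable_const,
          intro Bochner_Integration.integrable_sum integrable_mult_right intI,
          subst Bochner_Integration.integral_diff, intro intF, intro integrable_const)
         (simp add: prob_space)
  qed
  have "2 * ?\<pi> * pair_gen F (p, q) - h * pair_gen F (p, q) = 2 * ((1 - exp (- (h / 2)) - h / 2) * pair_gen F (p, q))"
    by (simp add: algebra_simps)
  then have "\<bar>2 * ?\<pi> * pair_gen F (p, q) - h * pair_gen F (p, q)\<bar> = 2 * \<bar>1 - exp (- (h / 2)) - h / 2\<bar> * \<bar>pair_gen F (p, q)\<bar>"
    by (simp add: abs_mult del: minus_divide_left)
  also have "\<dots> \<le> 2 * ((h / 2)\<^sup>2 / 2) * (4 * K)"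
    using one_minus_exp_bounds(3)[of "h / 2"] h by (intro mult_mono pair_gen_bound F) auto
  finally have 2: "\<bar>2 * ?\<pi> * pair_gen F (p, q) - h * pair_gen F (p, q)\<bar> \<le> K * h\<^sup>2"
    by (simp add: power2_eq_square mult_ac)
  show ?thesis using 1 2 unfolding ED by (simp add: algebra_simps)
qed

text \<open>After k slots the chain lies in the finite box \<open>R\<close>. Splitting over its
  value there and using that slot k is independent of the earlier ones reduces the claim to
  \<open>expectation_jump_pair\<close> from a fixed position, without conditional
  expectations.\<close>

lemma jump_chain_step:
  fixes E :: "int \<times> nat \<Rightarrow> 'a \<Rightarrow> bool" and x y :: int
  assumes ind: "indep_vars (\<lambda>_. counting) E UNIV"
    and E: "\<And>i. prob {\<omega>\<in>space M. E i \<omega>} = 1 - exp (- h / 2)"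
    and h: "0 \<le> h" and F: "\<And>a. \<bar>F a\<bar> \<le> K"
  defines "Y \<equiv> \<lambda>k \<omega>. (jump_chain (\<lambda>i. E i \<omega>) x k, jump_chain (\<lambda>i. E i \<omega>) y k)"
  shows "\<bar>expectation (\<lambda>\<omega>. F (Y (Suc k) \<omega>)) - expectation (\<lambda>\<omega>. F (Y k \<omega>) + h * pair_gen F (Y k \<omega>))\<bar> \<le> 41 * K * h\<^sup>2"
proof -
  have [measurable]: "E i \<in> M \<rightarrow>\<^sub>M counting" for i
    using ind unfolding indep_vars_def by blast
  have K: "0 \<le> K" by (rule order_trans[OF abs_ge_zero F[of "(0, 0)"]])
  define R where "R = {x - int k..x + int k} \<times> {y - int k..y + int k}"
  have R: "finite R" "Y k \<omega> \<in> R" for \<omega>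
    using jump_chain_range[of _ x k] jump_chain_range[of _ y k] by (auto simp: R_def Y_def)
  define J where "J c \<omega> = (jump (\<lambda>b. E (b, k) \<omega>) (fst c), jump (\<lambda>b. E (b, k) \<omega>) (snd c))" for c \<omega>
  have YSuc: "Y (Suc k) \<omega> = J (Y k \<omega>) \<omega>" for \<omega> by (simp add: Y_def J_def)
  have [measurable]: "(\<lambda>\<omega>. jump (\<lambda>b. E (b, k) \<omega>) p) \<in> M \<rightarrow>\<^sub>M counting" for p
    unfolding jump_def by measurable
  have Jm[measurable]: "J c \<in> M \<rightarrow>\<^sub>M counting" for c
    unfolding J_def[abs_def] by (auto intro!: measurable_Pair_count)
  let ?A = "UNIV \<times> {..<k} :: (int \<times> nat) set" and ?B = "UNIV \<times> {k} :: (int \<times> nat) set"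
  have indAB: "indep_var (PiM ?A (\<lambda>_. counting)) (\<lambda>\<omega>. restrict (\<lambda>i. E i \<omega>) ?A)
       (PiM ?B (\<lambda>_. counting)) (\<lambda>\<omega>. restrict (\<lambda>i. E i \<omega>) ?B)"
    by (rule indep_var_restrict[OF ind]) auto
  have Yr: "Y k \<omega> = (jump_chain (restrict (\<lambda>i. E i \<omega>) ?A) x k, jump_chain (restrict (\<lambda>i. E i \<omega>) ?A) y k)" for \<omega>
    unfolding Y_def by (intro arg_cong2[where f=Pair] jump_chain_cong) auto
  have Ym[measurable]: "Y k \<in> M \<rightarrow>\<^sub>M counting"
    unfolding Y_def by (intro measurable_Pair_count measurable_jump_chain) measurable
  have Jr: "J c \<omega> = (jump (\<lambda>b. restrict (\<lambda>i. E i \<omega>) ?B (b, k)) (fst c), jump (\<lambda>b. restrict (\<lambda>i. E i \<omega>) ?B (b, k)) (snd c))" for c \<omega>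
    by (simp add: J_def)
  have intb: "integrable M (\<lambda>\<omega>. G (Z \<omega>))" if "Z \<in> M \<rightarrow>\<^sub>M counting" "\<And>a. \<bar>G a\<bar> \<le> C" for G :: "int \<times> int \<Rightarrow> real" and Z C
    by (rule integrable_const_bound[where B=C]) (use that in auto)
  have indc: "expectation (\<lambda>\<omega>. of_bool (Y k \<omega> = c) * F (J c \<omega>)) = prob {\<omega>\<in>space M. Y k \<omega> = c} * expectation (\<lambda>\<omega>. F (J c \<omega>))" for c
  proof -
    let ?f = "\<lambda>e. of_bool ((jump_chain e x k, jump_chain e y k) = c) :: real"
    let ?g = "\<lambda>e. F (jump (\<lambda>b. e (b, k)) (fst c), jump (\<lambda>b. e (b, k)) (snd c))"
    have mf: "?f \<in> PiM ?A (\<lambda>_. counting) \<rightarrow>\<^sub>M borel"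
    proof (rule measurable_compose[where N="counting" and g="\<lambda>d. of_bool (d = c)"])
      show "(\<lambda>e. (jump_chain e x k, jump_chain e y k)) \<in> PiM ?A (\<lambda>_. counting) \<rightarrow>\<^sub>M counting"
        by (intro measurable_Pair_count measurable_jump_chain measurable_component_singleton) auto
    qed simp
    have comp[measurable]: "(\<lambda>e. e (b, k)) \<in> PiM ?B (\<lambda>_. count_space (UNIV :: bool set)) \<rightarrow>\<^sub>M counting" for b
      by (intro measurable_component_singleton) auto
    have mg: "?g \<in> PiM ?B (\<lambda>_. counting) \<rightarrow>\<^sub>M borel"
    proof (rule measurable_compose[where N="counting" and g=F])
      show "(\<lambda>e. (jump (\<lambda>b. e (b, k)) (fst c), jump (\<lambda>b. e (b, k)) (snd c))) \<in> PiM ?B (\<lambda>_. counting) \<rightarrow>\<^sub>M counting"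
        unfolding jump_def by (intro measurable_Pair_count) measurable
    qed simp
    have "indep_var borel (\<lambda>\<omega>. of_bool (Y k \<omega> = c) :: real) borel (\<lambda>\<omega>. F (J c \<omega>))"
      using indep_var_compose[OF indAB mf mg] unfolding o_def Yr Jr by simp
    from indep_var_lebesgue_integral[OF this]
    have "expectation (\<lambda>\<omega>. of_bool (Y k \<omega> = c) * F (J c \<omega>)) = expectation (\<lambda>\<omega>. of_bool (Y k \<omega> = c)) * expectation (\<lambda>\<omega>. F (J c \<omega>))"
      using intb[OF Ym, of "\<lambda>d. of_bool (d = c)" 1] intb[OF Jm, of F K] F by auto
    then show ?thesis by (simp only: expectation_of_bool)
  qed
  have split: "G (Y k \<omega>) \<omega> = (\<Sum>c\<in>R. of_bool (Y k \<omega> = c) * G c \<omega>)" for G :: "int \<times> int \<Rightarrow> 'a \<Rightarrow> real" and \<omega>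
  proof -
    have "(\<Sum>c\<in>R. of_bool (Y k \<omega> = c) * G c \<omega>) = (\<Sum>c\<in>{Y k \<omega>}. of_bool (Y k \<omega> = c) * G c \<omega>)"
      by (intro sum.mono_neutral_right) (use R in auto)
    then show ?thesis by simp
  qed
  have intbF: "integrable M (\<lambda>\<omega>. of_bool (Y k \<omega> = c) * F (J c \<omega>))" for c
  proof (rule integrable_const_bound[where B=K])
    show "(\<lambda>\<omega>. of_bool (Y k \<omega> = c) * F (J c \<omega>)) \<in> borel_measurable M"
      using intb[OF Ym, of "\<lambda>d. of_bool (d = c)" 1] intb[OF Jm, of F K] F by auto
  qed (use F K in auto)
  have "expectation (\<lambda>\<omega>. F (Y (Suc k) \<omega>)) = (\<Sum>c\<in>R. prob {\<omega>\<in>space M. Y k \<omega> = c} * expectation (\<lambda>\<omega>. F (J c \<omega>)))"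
    unfolding YSuc split[of "\<lambda>c \<omega>. F (J c \<omega>)"] by (simp add: Bochner_Integration.integral_sum intbF indc)
  moreover have "expectation (\<lambda>\<omega>. F (Y k \<omega>) + h * pair_gen F (Y k \<omega>)) = (\<Sum>c\<in>R. prob {\<omega>\<in>space M. Y k \<omega> = c} * (F c + h * pair_gen F c))"
  proof -
    have P1: "expectation (\<lambda>\<omega>. of_bool (Y k \<omega> = c) * (F c + h * pair_gen F c)) = prob {\<omega>\<in>space M. Y k \<omega> = c} * (F c + h * pair_gen F c)" for c
      using expectation_of_bool[of "\<lambda>\<omega>. Y k \<omega> = c"] by simp
    have P2: "integrable M (\<lambda>\<omega>. of_bool (Y k \<omega> = c) * (F c + h * pair_gen F c))" for c
      using intb[OF Ym, of "\<lambda>d. of_bool (d = c)" 1] by auto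
    show ?thesis
      unfolding split[of "\<lambda>c \<omega>. F c + h * pair_gen F c"]
      by (subst Bochner_Integration.integral_sum, rule P2) (intro sum.cong refl P1)
  qed
  ultimately have "\<bar>expectation (\<lambda>\<omega>. F (Y (Suc k) \<omega>)) - expectation (\<lambda>\<omega>. F (Y k \<omega>) + h * pair_gen F (Y k \<omega>))\<bar>
      = \<bar>\<Sum>c\<in>R. prob {\<omega>\<in>space M. Y k \<omega> = c} * (expectation (\<lambda>\<omega>. F (J c \<omega>)) - F c - h * pair_gen F c)\<bar>"
    by (simp add: sum_subtractf[symmetric] algebra_simps)
  also have "\<dots> \<le> (\<Sum>c\<in>R. prob {\<omega>\<in>space M. Y k \<omega> = c} * (41 * K * h\<^sup>2))"
  proof (intro order_trans[OF sum_abs] sum_mono)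
    fix c
    have E2: "prob {\<omega>\<in>space M. E (b, k) \<omega> \<and> E (b', k) \<omega>} = (1 - exp (- h / 2)) * (1 - exp (- h / 2))" if "b \<noteq> b'" for b b'
    proof -
      have "prob (\<Inter>i\<in>{(b, k), (b', k)}. E i -` {True} \<inter> space M) = (\<Prod>i\<in>{(b, k), (b', k)}. prob (E i -` {True} \<inter> space M))"
        by (rule indep_varsD[OF ind]) auto
      moreover have "E i -` {True} \<inter> space M = {\<omega>\<in>space M. E i \<omega>}" for i by auto
      moreover have "{\<omega>\<in>space M. E (b, k) \<omega>} \<inter> {\<omega>\<in>space M. E (b', k) \<omega>} = {\<omega>\<in>space M. E (b, k) \<omega> \<and> E (b', k) \<omega>}" by auto
      ultimately show ?thesis using that E by simp
    qed
    from expectation_jump_pair[where I="\<lambda>b. E (b, k)" and F=F and p="fst c" and q="snd c", OF _ E E2 h F]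
    have "\<bar>expectation (\<lambda>\<omega>. F (J c \<omega>)) - F c - h * pair_gen F c\<bar> \<le> 41 * K * h\<^sup>2"
      by (simp add: J_def)
    then show "\<bar>prob {\<omega>\<in>space M. Y k \<omega> = c} * (expectation (\<lambda>\<omega>. F (J c \<omega>)) - F c - h * pair_gen F c)\<bar>
        \<le> prob {\<omega>\<in>space M. Y k \<omega> = c} * (41 * K * h\<^sup>2)"
      unfolding abs_mult by (intro mult_mono) auto
  qed
  also have "\<dots> = 41 * K * h\<^sup>2"
  proof -
    have "1 = expectation (\<lambda>\<omega>. 1 :: real)" by (simp add: prob_space)
    also have "\<dots> = expectation (\<lambda>\<omega>. \<Sum>c\<in>R. of_bool (Y k \<omega> = c))"
      using split[of "\<lambda>_ _. 1"] by simp
    also have "\<dots> = (\<Sum>c\<in>R. expectation (\<lambda>\<omega>. of_bool (Y k \<omega> = c)))"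
      using intb[OF Ym, of "\<lambda>d. of_bool (d = _)" 1] by (intro Bochner_Integration.integral_sum) auto
    also have "\<dots> = (\<Sum>c\<in>R. prob {\<omega>\<in>space M. Y k \<omega> = c})"
      by (simp only: expectation_of_bool)
    finally show ?thesis by (simp add: sum_distrib_right[symmetric])
  qed
  finally show ?thesis .
qed

text \<open>Telescoping along \<open>u k\<close>, in which k steps are made by the chain and the
  remaining time by the semigroup. Replacing one semigroup step by a chain step costs 57 = 41 + 16,
  from \<open>jump_chain_step\<close> and \<open>pair_sg_taylor\<close>.\<close>

lemma jump_chain_approx:
  fixes E :: "int \<times> nat \<Rightarrow> 'a \<Rightarrow> bool"
  assumes ind: "indep_vars (\<lambda>_. counting) E UNIV"
    and E: "\<And>i. prob {\<omega>\<in>space M. E i \<omega>} = 1 - exp (- h / 2)"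
    and h: "0 \<le> h" and F: "\<And>a. \<bar>F a\<bar> \<le> K"
  shows "\<bar>expectation (\<lambda>\<omega>. F (jump_chain (\<lambda>i. E i \<omega>) x n, jump_chain (\<lambda>i. E i \<omega>) y n)) - pair_sg (n * h) F (x, y)\<bar>
     \<le> 57 * exp (4 * (n * h)) * K * h\<^sup>2 * n"
proof -
  define Y where "Y = (\<lambda>k \<omega>. (jump_chain (\<lambda>i. E i \<omega>) x k, jump_chain (\<lambda>i. E i \<omega>) y k))"
  define T where "T = n * h"
  have K: "0 \<le> K" by (rule order_trans[OF abs_ge_zero F[of "(0, 0)"]])
  have [measurable]: "E i \<in> M \<rightarrow>\<^sub>M counting" for i
    using ind unfolding indep_vars_def by blast
  have Ym: "Y k \<in> M \<rightarrow>\<^sub>M counting" for k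
    unfolding Y_def by (intro measurable_Pair_count measurable_jump_chain) measurable
  have intb: "integrable M (\<lambda>\<omega>. G (Y k \<omega>))" if "\<And>a. \<bar>G a\<bar> \<le> C" for G :: "int \<times> int \<Rightarrow> real" and k C
    by (rule integrable_const_bound[where B=C]) (use that Ym in auto)
  define u where "u k = expectation (\<lambda>\<omega>. pair_sg (real (n - k) * h) F (Y k \<omega>))" for k
  have step: "\<bar>u (Suc k) - u k\<bar> \<le> 57 * exp (4 * T) * K * h\<^sup>2" if k: "k < n" for k
  proof -
    define s where "s = real (n - Suc k) * h"
    have s: "0 \<le> s" "s \<le> T" "s + h \<le> T" "real (n - k) * h = s + h"
    proof -
      show "0 \<le> s" using h by (simp add: s_def)
      show eq: "real (n - k) * h = s + h" using k by (simp add: s_def of_nat_diff algebra_simps)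
      show "s + h \<le> T" unfolding eq[symmetric] T_def using h by (intro mult_right_mono) auto
      then show "s \<le> T" using h by simp
    qed
    have bd: "\<bar>pair_sg r F a\<bar> \<le> exp (4 * T) * K" if "0 \<le> r" "r \<le> T" for a r
    proof -
      have "\<bar>pair_sg r F a\<bar> \<le> exp (4 * \<bar>r\<bar>) * K" by (rule pair_sg_bound, rule F)
      also have "\<dots> \<le> exp (4 * T) * K" using that K by (intro mult_right_mono) auto
      finally show ?thesis .
    qed
    have 1: "\<bar>u (Suc k) - expectation (\<lambda>\<omega>. pair_sg s F (Y k \<omega>) + h * pair_gen (pair_sg s F) (Y k \<omega>))\<bar> \<le> 41 * (exp (4 * T) * K) * h\<^sup>2"
      unfolding u_def s_def[symmetric] Y_def using s by (intro jump_chain_step ind E h bd) auto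
    have tay: "\<bar>pair_sg s F a + h * pair_gen (pair_sg s F) a - pair_sg (s + h) F a\<bar> \<le> 16 * K * exp (4 * T) * h\<^sup>2" for a
      using pair_sg_taylor[where F=F and K=K and s=s and T=T and s'="s + h" and a=a, OF F] s h
        pair_sg_gen[where F=F and K=K and s=s and a=a, OF F]
      by (simp add: abs_minus_commute algebra_simps)
    have bg: "\<bar>pair_gen (pair_sg s F) a\<bar> \<le> 4 * (exp (4 * T) * K)" for a
      by (intro pair_gen_bound bd s)
    have i1: "integrable M (\<lambda>\<omega>. pair_sg s F (Y k \<omega>) + h * pair_gen (pair_sg s F) (Y k \<omega>))"
      by (intro Bochner_Integration.integrable_add integrable_mult_right; rule intb) (rule bd[OF s(1,2)], rule bg)
    have i2: "integrable M (\<lambda>\<omega>. pair_sg (s + h) F (Y k \<omega>))"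
      by (rule intb, rule bd) (use s h in auto)
    have "\<bar>expectation (\<lambda>\<omega>. pair_sg s F (Y k \<omega>) + h * pair_gen (pair_sg s F) (Y k \<omega>)) - u k\<bar> =
       \<bar>expectation (\<lambda>\<omega>. pair_sg s F (Y k \<omega>) + h * pair_gen (pair_sg s F) (Y k \<omega>) - pair_sg (s + h) F (Y k \<omega>))\<bar>"
      unfolding u_def s(4) by (subst Bochner_Integration.integral_diff[OF i1 i2]) simp
    also have "\<dots> \<le> expectation (\<lambda>\<omega>. 16 * K * exp (4 * T) * h\<^sup>2)"
      by (intro integral_abs_bound[THEN order_trans] integral_mono integrable_abs Bochner_Integration.integrable_diff i1 i2 tay) auto
    finally show ?thesis using 1 by (simp add: prob_space algebra_simps)
  qed
  have "\<bar>u k - u 0\<bar> \<le> 57 * exp (4 * T) * K * h\<^sup>2 * k" if "k \<le> n" for k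
    using that
  proof (induction k)
    case (Suc k)
    then show ?case using step[of k] by (simp add: algebra_simps)
  qed simp
  from this[of n] show ?thesis
    by (simp add: u_def Y_def T_def prob_space)
qed

text \<open>Independence across sources and independence within each source combine to joint
  independence. It is needed because clocks are independent across bonds as whole paths, whereas
  increments are independent in time only within one clock.\<close>

lemma indep_vars_nested:
  assumes Z: "indep_vars M' Z UNIV"
    and g: "\<And>i k. g i k \<in> M' i \<rightarrow>\<^sub>M N"
    and gk: "\<And>i. indep_vars (\<lambda>_. N) (\<lambda>k \<omega>. g i k (Z i \<omega>)) UNIV"
  shows "indep_vars (\<lambda>_. N) (\<lambda>(i, k) \<omega>. g i k (Z i \<omega>)) UNIV"
  unfolding indep_vars_def2
proof (intro conjI ballI indep_setsI)
  have Zm: "Z i \<in> M \<rightarrow>\<^sub>M M' i" for i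
    using Z unfolding indep_vars_def by blast
  have rv: "(\<lambda>\<omega>. g i k (Z i \<omega>)) \<in> M \<rightarrow>\<^sub>M N" for i k
    by (rule measurable_compose[OF Zm g])
  show "(case i of (i, k) \<Rightarrow> \<lambda>\<omega>. g i k (Z i \<omega>)) \<in> M \<rightarrow>\<^sub>M N" for i
    by (cases i) (simp add: rv)
  show "{(case i of (i, k) \<Rightarrow> \<lambda>\<omega>. g i k (Z i \<omega>)) -` A \<inter> space M |A. A \<in> sets N} \<subseteq> events" for i
    using measurable_sets[OF rv] by (cases i) auto
  fix A and J
  assume J: "J \<noteq> {}" "finite J" and A: "\<forall>j\<in>J. A j \<in> {(case j of (i, k) \<Rightarrow> \<lambda>\<omega>. g i k (Z i \<omega>)) -` A \<inter> space M |A. A \<in> sets N}"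
  have "\<forall>j\<in>J. \<exists>B. A j = (case j of (i, k) \<Rightarrow> \<lambda>\<omega>. g i k (Z i \<omega>)) -` B \<inter> space M \<and> B \<in> sets N"
    using A by blast
  from bchoice[OF this] obtain B where
    B: "\<And>j. j \<in> J \<Longrightarrow> A j = (case j of (i, k) \<Rightarrow> \<lambda>\<omega>. g i k (Z i \<omega>)) -` B j \<inter> space M" "\<And>j. j \<in> J \<Longrightarrow> B j \<in> sets N"
    by blast
  define K where "K i = {k. (i, k) \<in> J}" for i
  have JS: "J = Sigma (fst ` J) K"
  proof (intro set_eqI iffI)
    fix j assume "j \<in> J"
    then show "j \<in> Sigma (fst ` J) K" by (cases j) (auto simp: K_def intro: image_eqI[of _ fst "(_, _)"])
  qed (auto simp: K_def)
  have Kf: "finite (K i)" for i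
  proof (rule finite_subset)
    show "K i \<subseteq> snd ` J"
    proof
      fix k assume "k \<in> K i"
      then have "snd (i, k) \<in> snd ` J" unfolding K_def by (intro imageI) simp
      then show "k \<in> snd ` J" by simp
    qed
  qed (use J in simp)
  have Kn: "K i \<noteq> {}" if i: "i \<in> fst ` J" for i
  proof -
    obtain j where "j \<in> J" "i = fst j" using i by blast
    then have "snd j \<in> K i" by (simp add: K_def)
    then show ?thesis by blast
  qed
  \<comment> \<open>All finitely many events read from source i are merged into one event of its
    value space, so independence across sources applies once per source; it is then split again
    inside each source.\<close>
  define C where "C i = (\<Inter>k\<in>K i. g i k -` B (i, k) \<inter> space (M' i))" for i
  have C: "C i \<in> sets (M' i)" if "i \<in> fst ` J" for i
    unfolding C_def using Kf Kn[OF that] by (intro sets.finite_INT measurable_sets[OF g] B) (auto simp: K_def)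
  have ZC: "Z i -` C i \<inter> space M = (\<Inter>k\<in>K i. (\<lambda>\<omega>. g i k (Z i \<omega>)) -` B (i, k) \<inter> space M)" if "i \<in> fst ` J" for i
    using Kn[OF that] measurable_space[OF Zm] by (auto simp: C_def)
  have "(\<Inter>j\<in>J. A j) = (\<Inter>i\<in>fst ` J. Z i -` C i \<inter> space M)"
  proof -
    have "(\<Inter>i\<in>fst ` J. Z i -` C i \<inter> space M) = (\<Inter>i\<in>fst ` J. \<Inter>k\<in>K i. (\<lambda>\<omega>. g i k (Z i \<omega>)) -` B (i, k) \<inter> space M)"
      by (intro INF_cong refl ZC)
    also have "\<dots> = (\<Inter>i\<in>fst ` J. \<Inter>k\<in>K i. A (i, k))"
      by (intro INF_cong refl) (auto simp: K_def B)
    also have "\<dots> = (\<Inter>j\<in>Sigma (fst ` J) K. A j)" by auto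
    also have "\<dots> = (\<Inter>j\<in>J. A j)" by (simp only: JS[symmetric])
    finally show ?thesis ..
  qed
  then have "prob (\<Inter>j\<in>J. A j) = prob (\<Inter>i\<in>fst ` J. Z i -` C i \<inter> space M)" by simp
  also have "\<dots> = (\<Prod>i\<in>fst ` J. prob (Z i -` C i \<inter> space M))"
    by (rule indep_varsD[OF Z]) (use J C in auto)
  also have "\<dots> = (\<Prod>i\<in>fst ` J. \<Prod>k\<in>K i. prob (A (i, k)))"
  proof (intro prod.cong refl)
    fix i assume i: "i \<in> fst ` J"
    have "prob (Z i -` C i \<inter> space M) = (\<Prod>k\<in>K i. prob ((\<lambda>\<omega>. g i k (Z i \<omega>)) -` B (i, k) \<inter> space M))"
      unfolding ZC[OF i] by (rule indep_varsD[OF gk]) (use Kf Kn[OF i] B(2) in \<open>auto simp: K_def\<close>)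
    also have "\<dots> = (\<Prod>k\<in>K i. prob (A (i, k)))"
      by (intro prod.cong refl) (auto simp: K_def B)
    finally show "prob (Z i -` C i \<inter> space M) = (\<Prod>k\<in>K i. prob (A (i, k)))" .
  qed
  also have "\<dots> = (\<Prod>j\<in>J. prob (A j))"
    using J Kf by (subst prod.Sigma) (simp_all add: case_prod_beta JS[symmetric])
  finally show "prob (\<Inter>j\<in>J. A j) = (\<Prod>j\<in>J. prob (A j))" .
qed

end

section \<open>Stirring paths\<close>

text \<open>Before time s the path is bounded by \<open>n s\<close>, hence takes finitely many
  values; once the largest is attained the path stays constant up to s.\<close>

lemma mono_nat_left_constant:
  fixes n :: "real \<Rightarrow> nat"
  assumes n: "mono_on {0..} n" and s: "0 < s"
  obtains v where "v \<le> n s" "\<forall>\<^sub>F u in at_left s. n u = v"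
proof -
  have fin: "finite (n ` {0..<s})"
    by (rule finite_subset[of _ "{..n s}"]) (auto intro!: mono_onD[OF n])
  have ne: "n ` {0..<s} \<noteq> {}" using s by auto
  define v where "v = Max (n ` {0..<s})"
  have "v \<in> n ` {0..<s}" unfolding v_def using fin ne by (rule Max_in)
  then obtain u0 where u0: "0 \<le> u0" "u0 < s" "v = n u0" by auto
  have "n u = v" if "u0 < u" "u < s" for u
  proof (rule antisym)
    show "n u \<le> v" unfolding v_def using that u0 by (intro Max_ge fin) auto
    show "v \<le> n u" unfolding u0(3) using that u0 by (intro mono_onD[OF n]) auto
  qed
  then have "\<forall>\<^sub>F u in at_left s. n u = v" unfolding eventually_at_left[OF u0(2)] using u0(2) by blast
  moreover have "v \<le> n s" unfolding u0(3) using u0 by (intro mono_onD[OF n]) auto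
  ultimately show ?thesis using that by blast
qed

text \<open>A compactness argument: around every time there is a window in which any single grid
  step is correct, and a Lebesgue number of this cover bounds the mesh below which all steps are
  correct at once.\<close>

lemma jump_chain_eq_stirring_path:
  fixes n :: "int \<Rightarrow> real \<Rightarrow> nat"
  assumes xi: "stirring_path n x \<xi>"
    and mono: "\<And>b. mono_on {0..} (n b)"
    and rc: "\<And>b t. 0 \<le> t \<Longrightarrow> \<forall>\<^sub>F s in at_right t. n b s = n b t"
    and t: "0 < t"
  shows "\<forall>\<^sub>F m in sequentially.
    jump_chain (\<lambda>(b, k). n b (t / real m * real (Suc k)) - n b (t / real m * real k) \<noteq> 0) x m = \<xi> t"
proof -
  have xi0: "\<xi> 0 = x" and xir: "\<And>t. 0 \<le> t \<Longrightarrow> \<forall>\<^sub>F s in at_right t. \<xi> s = \<xi> t"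
    and xil: "\<And>t. 0 < t \<Longrightarrow> \<exists>p. (\<forall>\<^sub>F s in at_left t. \<xi> s = p) \<and>
        (event_at (n p) t \<longrightarrow> \<xi> t = p + 1) \<and> (event_at (n (p - 1)) t \<longrightarrow> \<xi> t = p - 1) \<and>
        (\<not> event_at (n p) t \<and> \<not> event_at (n (p - 1)) t \<longrightarrow> \<xi> t = p)"
    using xi by (auto simp: stirring_path_def)
  \<comment> \<open>Finitely many visited sites, by one-sided constancy at every time and
    compactness. The intersection with {0..} is there because the intervals of the bisection
    argument may reach negative times, where the path is unconstrained.\<close>
  have fin: "finite (\<xi> ` ({0..t} \<inter> {0..}))"
  proof (rule Bolzano[of 0 t "\<lambda>a b. finite (\<xi> ` ({a..b} \<inter> {0..}))"])
    fix a b c :: real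
    assume "finite (\<xi> ` ({a..b} \<inter> {0..}))" "finite (\<xi> ` ({b..c} \<inter> {0..}))" and abc: "a \<le> b" "b \<le> c"
    moreover have "{a..c} \<inter> {0..} = ({a..b} \<inter> {0..}) \<union> ({b..c} \<inter> {0..})" using abc by auto
    ultimately show "finite (\<xi> ` ({a..c} \<inter> {0..}))" by (simp add: image_Un)
  next
    fix s :: real assume s: "0 \<le> s" "s \<le> t"
    obtain d1 where d1: "d1 > s" "\<And>u. s < u \<Longrightarrow> u < d1 \<Longrightarrow> \<xi> u = \<xi> s"
      using xir[OF s(1)] by (auto simp: eventually_at_right_field)
    obtain p d2 where d2: "d2 < s" "\<And>u. 0 \<le> u \<Longrightarrow> d2 < u \<Longrightarrow> u < s \<Longrightarrow> \<xi> u = p"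
    proof (cases "s = 0")
      case True
      show ?thesis by (rule that[of "-1" 0]) (use True in auto)
    next
      case False
      then obtain p where "\<forall>\<^sub>F u in at_left s. \<xi> u = p" using xil[of s] s by auto
      then show ?thesis using that by (auto simp: eventually_at_left_field)
    qed
    show "\<exists>d>0. \<forall>a b. a \<le> s \<and> s \<le> b \<and> b - a < d \<longrightarrow> finite (\<xi> ` ({a..b} \<inter> {0..}))"
    proof (intro exI[of _ "min (d1 - s) (s - d2)"] conjI allI impI)
      fix a b assume ab: "a \<le> s \<and> s \<le> b \<and> b - a < min (d1 - s) (s - d2)"
      have "\<xi> u \<in> {p, \<xi> s}" if "u \<in> {a..b} \<inter> {0..}" for u
        using ab that d1(2)[of u] d2(2)[of u] by (cases u s rule: linorder_cases) auto
      then show "finite (\<xi> ` ({a..b} \<inter> {0..}))" 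
        using finite_subset[OF image_subsetI, of "{a..b} \<inter> {0..}" \<xi> "{p, \<xi> s}"] by simp
    qed (use d1 d2 in auto)
  qed (use t in auto)
  \<comment> \<open>The only bonds a step of this path can look at. Their finiteness allows one
    window to serve all clocks.\<close>
  define B where "B = \<xi> ` {0..t} \<union> (\<lambda>p. p - 1) ` \<xi> ` {0..t}"
  have B: "finite B" "\<And>u. 0 \<le> u \<Longrightarrow> u \<le> t \<Longrightarrow> \<xi> u \<in> B \<and> \<xi> u - 1 \<in> B"
    using fin by (auto simp: B_def Int_absorb2)
  define G where "G a b \<longleftrightarrow> \<xi> b = jump (\<lambda>c. n c b - n c a \<noteq> 0) (\<xi> a)" for a b
  have G_const: "G a b" if "\<xi> b = \<xi> a" "\<And>c. c \<in> B \<Longrightarrow> n c b = n c a" "0 \<le> a" "a \<le> t" for a b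
    using that B(2)[of a] by (auto simp: G_def jump_def)
  \<comment> \<open>On each side of s both the path and the clocks in \<open>B\<close> are constant
    near s, so a step that does not straddle s is trivial; one that does sees exactly what happens
    at time s.\<close>
  have loc: "\<exists>d>0. \<forall>a b. 0 \<le> a \<and> a \<le> b \<and> b \<le> t \<and> s - d < a \<and> b < s + d \<longrightarrow> G a b" if s: "s \<in> {0..t}" for s
  proof -
    have "\<forall>\<^sub>F u in at_right s. \<xi> u = \<xi> s \<and> (\<forall>c\<in>B. n c u = n c s)"
      using s B(1) by (intro eventually_conj eventually_ball_finite ballI xir rc) auto
    then obtain d1 where d1: "d1 > s" "\<And>u. s < u \<Longrightarrow> u < d1 \<Longrightarrow> \<xi> u = \<xi> s \<and> (\<forall>c\<in>B. n c u = n c s)"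
      by (auto simp: eventually_at_right_field)
    have right: "\<xi> u = \<xi> s \<and> (\<forall>c\<in>B. n c u = n c s)" if "s \<le> u" "u < d1" for u
      using d1(2)[of u] that by (cases "u = s") auto
    show ?thesis
    proof (cases "s = 0")
      case True
      show ?thesis
      proof (intro exI[of _ "d1 - s"] conjI allI impI)
        fix a b assume ab: "0 \<le> a \<and> a \<le> b \<and> b \<le> t \<and> s - (d1 - s) < a \<and> b < s + (d1 - s)"
        show "G a b" by (rule G_const) (use right[of a] right[of b] ab True in auto)
      qed (use d1 in simp)
    next
      case False
      then have s0: "0 < s" using s by simp
      obtain p where p: "\<forall>\<^sub>F u in at_left s. \<xi> u = p"
        "event_at (n p) s \<Longrightarrow> \<xi> s = p + 1" "event_at (n (p - 1)) s \<Longrightarrow> \<xi> s = p - 1"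
        "\<not> event_at (n p) s \<Longrightarrow> \<not> event_at (n (p - 1)) s \<Longrightarrow> \<xi> s = p"
        using xil[OF s0] by auto
      have "\<exists>v. v \<le> n c s \<and> (\<forall>\<^sub>F u in at_left s. n c u = v)" for c
        using mono_nat_left_constant[OF mono s0] by metis
      then obtain v where v: "\<And>c. v c \<le> n c s" "\<And>c. \<forall>\<^sub>F u in at_left s. n c u = v c" by metis
      \<comment> \<open>Since \<open>v c\<close> is the left limit and at most \<open>n c s\<close>,
        the truncated difference is the true jump of the clock.\<close>
      have ev: "event_at (n c) s \<longleftrightarrow> n c s - v c \<noteq> 0" for c
      proof
        assume "event_at (n c) s"
        then show "n c s - v c \<noteq> 0" using v[of c] s0 by (auto simp: event_at_def)
      next
        assume ne: "n c s - v c \<noteq> 0"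
        have "\<not> (\<forall>\<^sub>F u in at_left s. n c u = n c s)"
        proof
          assume "\<forall>\<^sub>F u in at_left s. n c u = n c s"
          with v(2)[of c] have "\<forall>\<^sub>F u in at_left s. v c = n c s" by eventually_elim simp
          then show False using ne by (simp add: eventually_const_iff)
        qed
        then show "event_at (n c) s" using s0 by (simp add: event_at_def)
      qed
      have "\<forall>\<^sub>F u in at_left s. \<xi> u = p \<and> (\<forall>c\<in>B. n c u = v c)"
        using B(1) by (intro eventually_conj eventually_ball_finite ballI p v)
      then obtain d2 where d2: "d2 < s" "\<And>u. d2 < u \<Longrightarrow> u < s \<Longrightarrow> \<xi> u = p \<and> (\<forall>c\<in>B. n c u = v c)"
        by (auto simp: eventually_at_left_field)
      show ?thesis
      proof (intro exI[of _ "min (d1 - s) (s - d2)"] conjI allI impI)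
        fix a b assume ab: "0 \<le> a \<and> a \<le> b \<and> b \<le> t \<and> s - min (d1 - s) (s - d2) < a \<and> b < s + min (d1 - s) (s - d2)"
        consider "s \<le> a" | "b < s" | "a < s" "s \<le> b" by linarith
        then show "G a b"
        proof cases
          case 1
          show ?thesis by (rule G_const) (use right[of a] right[of b] ab 1 in auto)
        next
          case 2
          show ?thesis by (rule G_const) (use d2(2)[of a] d2(2)[of b] ab 2 in auto)
        next
          case 3
          \<comment> \<open>The step straddles s: its clock increments are the jumps at s. Two
            adjacent events at once would force contradictory values of the path, so the preference
            built into \<open>jump\<close> never matters.\<close>
          have a: "\<xi> a = p" "\<And>c. c \<in> B \<Longrightarrow> n c a = v c" using d2(2)[of a] ab 3 by auto
          have b: "\<xi> b = \<xi> s" "\<And>c. c \<in> B \<Longrightarrow> n c b = n c s" using right[of b] ab 3 by auto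
          have pB: "p \<in> B" "p - 1 \<in> B" using B(2)[of a] ab a(1) by auto
          show ?thesis
            using p(2-4) unfolding G_def a(1) b(1) jump_def ev a(2)[OF pB(1)] a(2)[OF pB(2)] b(2)[OF pB(1)] b(2)[OF pB(2)]
            by auto
        qed
      qed (use d1 d2 in auto)
    qed
  qed
  then obtain d where d: "\<And>s. s \<in> {0..t} \<Longrightarrow> 0 < d s"
    "\<And>s a b. s \<in> {0..t} \<Longrightarrow> 0 \<le> a \<Longrightarrow> a \<le> b \<Longrightarrow> b \<le> t \<Longrightarrow> s - d s < a \<Longrightarrow> b < s + d s \<Longrightarrow> G a b"
    by metis
  \<comment> \<open>\<open>e\<close> is the Lebesgue number of the cover by windows.\<close>
  obtain e where e: "0 < e" "\<And>a. a \<in> {0..t} \<Longrightarrow> \<exists>U\<in>(\<lambda>s. ball s (d s)) ` {0..t}. ball a e \<subseteq> U"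
  proof (rule Heine_Borel_lemma[of "{0..t}" "(\<lambda>s. ball s (d s)) ` {0..t}"])
    show "{0..t} \<subseteq> \<Union> ((\<lambda>s. ball s (d s)) ` {0..t})"
    proof
      fix s assume s: "s \<in> {0..t}"
      then have "s \<in> ball s (d s)" using d(1) by simp
      then show "s \<in> \<Union> ((\<lambda>s. ball s (d s)) ` {0..t})" using s by blast
    qed
  qed auto
  have Gall: "G a b" if ab: "0 \<le> a" "a \<le> b" "b \<le> t" "b - a < e" for a b
  proof -
    obtain s where s: "s \<in> {0..t}" "ball a e \<subseteq> ball s (d s)" using e(2)[of a] ab by fastforce
    have "a \<in> ball a e" "b \<in> ball a e" using ab e(1) by (auto simp: dist_real_def)
    then have "a \<in> ball s (d s)" "b \<in> ball s (d s)" using s(2) by blast+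
    then show ?thesis by (intro d(2)[OF s(1)] ab) (auto simp: dist_real_def)
  qed
  have "(\<lambda>m. t / real m) \<longlonglongrightarrow> 0" by (rule lim_const_over_n)
  then have "\<forall>\<^sub>F m in sequentially. t / real m < e" using e(1) by (rule order_tendstoD)
  then show ?thesis using eventually_gt_at_top[of 0]
  proof eventually_elim
    case (elim m)
    have "jump_chain (\<lambda>(b, k). n b (t / real m * real (Suc k)) - n b (t / real m * real k) \<noteq> 0) x k = \<xi> (t / real m * real k)" if "k \<le> m" for k
      using that
    proof (induction k)
      case (Suc k)
      have "t / real m * real (Suc k) \<le> t / real m * real m" using Suc.prems t by (intro mult_left_mono) auto
      also have "\<dots> = t" using elim by simp
      finally have "G (t / real m * real k) (t / real m * real (Suc k))"
      proof (intro Gall)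
        have "t / real m * real (Suc k) = t / real m * real k + t / real m"
          by (simp add: distrib_left)
        moreover have "0 \<le> t / real m" using t by simp
        ultimately show "t / real m * real k \<le> t / real m * real (Suc k)"
          "t / real m * real (Suc k) - t / real m * real k < e"
          using elim by simp_all
      qed (use t in auto)
      then show ?case using Suc by (simp add: G_def)
    qed (simp add: xi0)
    from this[of m] show ?case using elim by simp
  qed
qed

section \<open>Explicit solutions of the backward equation\<close>

lemma pair_gen_fst:
  "pair_gen (\<lambda>a. f (fst a)) (x, y) = (f (x + 1) + f (x - 1) - 2 * f x) / 2"
proof -
  have "(\<Sum>b\<in>pair_bonds (x, y). f (fst (pair_swap b (x, y))) - f (fst (x, y))) =
      (\<Sum>b\<in>{x - 1, x}. f (swap_bond b x) - f x)"
    unfolding pair_swap_pair fst_conv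
    by (rule sum.mono_neutral_right) (auto simp: pair_bonds_def swap_bond_def)
  also have "\<dots> = f (x + 1) + f (x - 1) - 2 * f x" by (simp add: swap_bond_def)
  finally show ?thesis unfolding pair_gen_def by simp
qed

lemma pair_gen_flip: "pair_gen F (y, x) = pair_gen (\<lambda>(x, y). F (y, x)) (x, y)"
proof -
  have "pair_bonds (y, x) = pair_bonds (x, y)" by (auto simp: pair_bonds_def)
  then show ?thesis by (simp add: pair_gen_def pair_swap_pair)
qed

definition bond_sign :: "int \<Rightarrow> int \<Rightarrow> real" where
  "bond_sign b x = of_bool (x = b) - of_bool (x = b + 1)"

text \<open>The tensor square of the difference of point masses at b and b + 1; summing a function
  against it gives a mixed second difference across the bond.\<close>

definition bond_form :: "int \<Rightarrow> int \<times> int \<Rightarrow> real" where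
  "bond_form b a = bond_sign b (fst a) * bond_sign b (snd a)"

lemma swap_bond_diff: "f (swap_bond b x) - f x = (f (b + 1) - f b) * bond_sign b x"
  for f :: "int \<Rightarrow> real"
  by (auto simp: swap_bond_def bond_sign_def)

text \<open>
  The stirring generator agrees with that of two independent walks up to the last term, which is
  supported on the diagonal and on pairs of neighbours.
\<close>

lemma pair_gen_product:
  "pair_gen (\<lambda>a. f (fst a) * f (snd a)) (x, y) =
     (f (x + 1) + f (x - 1) - 2 * f x) / 2 * f y + f x * ((f (y + 1) + f (y - 1) - 2 * f y) / 2)
     + (\<Sum>b\<in>pair_bonds (x, y). (f (b + 1) - f b)\<^sup>2 * bond_form b (x, y)) / 2"
proof -
  let ?T = "pair_bonds (x, y)"
  have fin: "finite ?T" by simp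
  \<comment> \<open>The discrete product rule: the cross term, a product of two increments, is
    nonzero only when bond b moves both particles.\<close>
  have "f (fst (pair_swap b (x, y))) * f (snd (pair_swap b (x, y))) - f x * f y =
     (f (fst (pair_swap b (x, y))) - f x) * f y + f x * (f (fst (pair_swap b (y, x))) - f y)
       + (f (b + 1) - f b)\<^sup>2 * bond_form b (x, y)" for b
  proof -
    have "(f (b + 1) - f b)\<^sup>2 * bond_form b (x, y) = (f (swap_bond b x) - f x) * (f (swap_bond b y) - f y)"
      unfolding swap_bond_diff by (simp add: bond_form_def power2_eq_square)
    then show ?thesis by (simp add: pair_swap_pair algebra_simps)
  qed
  then have "pair_gen (\<lambda>a. f (fst a) * f (snd a)) (x, y) =
     ((\<Sum>b\<in>?T. f (fst (pair_swap b (x, y))) - f x) * f y + f x * (\<Sum>b\<in>?T. f (fst (pair_swap b (y, x))) - f y)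
      + (\<Sum>b\<in>?T. (f (b + 1) - f b)\<^sup>2 * bond_form b (x, y))) / 2"
    unfolding pair_gen_def by (simp add: sum.distrib sum_distrib_left sum_distrib_right)
  also have "(\<Sum>b\<in>?T. f (fst (pair_swap b (x, y))) - f x) = 2 * pair_gen (\<lambda>a. f (fst a)) (x, y)"
    by (simp add: pair_gen_def)
  also have "(\<Sum>b\<in>?T. f (fst (pair_swap b (y, x))) - f y) = 2 * pair_gen (\<lambda>a. f (fst a)) (y, x)"
  proof -
    have "pair_bonds (y, x) = ?T" by (auto simp: pair_bonds_def)
    then show ?thesis by (simp add: pair_gen_def)
  qed
  finally show ?thesis unfolding pair_gen_fst by (simp add: field_simps)
qed

lemma pair_sg_fst_heat_kernel:
  assumes "0 \<le> t"
  shows "pair_sg t (\<lambda>a. of_bool (fst a = z)) (x, y) = heat_kernel t (x - z)"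
proof -
  have "pair_sg t ((\<lambda>s a. heat_kernel s (fst a - z)) 0) (x, y) = (\<lambda>s a. heat_kernel s (fst a - z)) t (x, y)"
  proof (rule pair_sg_unique[OF assms, where K=1])
    fix s :: real and a :: "int \<times> int" assume s: "s \<in> {0..t}"
    obtain x y where a: "a = (x, y)" by force
    show "((\<lambda>s. heat_kernel s (fst a - z)) has_real_derivative pair_gen (\<lambda>a. heat_kernel s (fst a - z)) a) (at s within {0..t})"
      using heat_kernel_deriv[of "x - z" s] unfolding a pair_gen_fst[of "\<lambda>x. heat_kernel s (x - z)"]
      by (simp add: algebra_simps has_field_derivative_at_within)
    show "\<bar>heat_kernel s (fst a - z)\<bar> \<le> 1" using s by (intro heat_kernel_bound) auto
  qed
  then show ?thesis by (simp add: heat_kernel_0)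
qed

text \<open>Duality: the semigroup is tested against the signs of the kernel, a function bounded by
  1, and evaluated at the origin, whence the reflection to \<open>- j\<close>. The growth bound is
  enough here, and no sign of the off-diagonal kernel is needed.\<close>

lemma sum_abs_heat_kernel:
  assumes "0 \<le> s" "finite B"
  shows "(\<Sum>j\<in>B. \<bar>heat_kernel s j\<bar>) \<le> exp (4 * s)"
proof -
  define F where "F a = (\<Sum>j\<in>B. sgn (heat_kernel s j) * of_bool (fst a = - j))" for a :: "int \<times> int"
  have F: "\<bar>F a\<bar> \<le> 1" for a
  proof -
    have "F a = (\<Sum>j\<in>B. if - fst a = j then sgn (heat_kernel s j) else 0)"
      unfolding F_def by (intro sum.cong) auto
    also have "\<dots> = (if - fst a \<in> B then sgn (heat_kernel s (- fst a)) else 0)"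
      using assms by (simp add: sum.delta)
    also have "\<bar>\<dots>\<bar> \<le> 1" by (simp add: sgn_if)
    finally show ?thesis .
  qed
  have "pair_sg s F (0, 0) = (\<Sum>j\<in>B. sgn (heat_kernel s j) * heat_kernel s j)"
    unfolding F_def using assms(2)
  proof (induction B rule: finite_induct)
    case empty
    then show ?case using pair_sg_bound[of "\<lambda>_. 0" 0 s "(0, 0)"] by simp
  next
    case (insert i B)
    have b: "\<bar>\<Sum>j\<in>B. sgn (heat_kernel s j) * of_bool (fst a = - j)\<bar> \<le> real (card B)" for a :: "int \<times> int"
    proof -
      have "\<bar>\<Sum>j\<in>B. sgn (heat_kernel s j) * of_bool (fst a = - j)\<bar> \<le> (\<Sum>j\<in>B. 1)"
        by (intro order_trans[OF sum_abs] sum_mono) (simp add: abs_mult sgn_if)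
      then show ?thesis by simp
    qed
    have c: "\<bar>sgn (heat_kernel s i) * of_bool (fst a = - i)\<bar> \<le> 1" for a :: "int \<times> int"
      by (simp add: abs_mult sgn_if)
    have d: "\<bar>of_bool (fst a = - i) :: real\<bar> \<le> 1" for a :: "int \<times> int"
      by simp
    show ?case
      unfolding sum.insert[OF insert.hyps] pair_sg_add[OF c b] pair_sg_cmult[OF d] insert.IH
        pair_sg_fst_heat_kernel[OF assms(1)] by simp
  qed
  also have "\<dots> = (\<Sum>j\<in>B. \<bar>heat_kernel s j\<bar>)" by (intro sum.cong refl) (simp add: sgn_if)
  finally show ?thesis using pair_sg_bound[where F=F and K=1 and s=s and a="(0, 0)", OF F] assms(1) by simp
qed

text \<open>Chapman-Kolmogorov obtained from uniqueness, without a convolution sum: a time shift of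
  the kernel still solves the backward equation.\<close>

lemma heat_kernel_semigroup:
  assumes "0 \<le> s" "0 \<le> u"
  shows "pair_sg s (\<lambda>a. heat_kernel u (fst a)) (x, y) = heat_kernel (u + s) x"
proof -
  have "pair_sg s ((\<lambda>r a. heat_kernel (u + r) (fst a)) 0) (x, y) = (\<lambda>r a. heat_kernel (u + r) (fst a)) s (x, y)"
  proof (rule pair_sg_unique[OF assms(1), where K=1])
    fix r :: real and a :: "int \<times> int" assume r: "r \<in> {0..s}"
    obtain x y where a: "a = (x, y)" by force
    have "((\<lambda>r. u + r) has_real_derivative 1) (at r within {0..s})"
      by (auto intro!: derivative_eq_intros)
    from DERIV_chain2[OF heat_kernel_deriv[of x "u + r"] this]
    show "((\<lambda>r. heat_kernel (u + r) (fst a)) has_real_derivative pair_gen (\<lambda>a. heat_kernel (u + r) (fst a)) a) (at r within {0..s})"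
      unfolding a pair_gen_fst by simp
    show "\<bar>heat_kernel (u + r) (fst a)\<bar> \<le> 1" using r assms by (intro heat_kernel_bound) auto
  qed
  then show ?thesis by simp
qed

text \<open>For neighbours the middle bond exchanges the particles and keeps the distance, so only
  the two outer bonds act and the distance is reflected at 1. Otherwise four bonds act and the
  distance performs a walk of rate 2, hence the times 2 s.\<close>

lemma pair_gen_distance:
  assumes even: "\<And>k. \<phi> (- k) = \<phi> k" and xy: "x < y"
  shows "pair_gen (\<lambda>a. \<phi> (fst a - snd a)) (x, y) =
    (if y = x + 1 then \<phi> 2 - \<phi> 1 else \<phi> (y - x + 1) + \<phi> (y - x - 1) - 2 * \<phi> (y - x))"
proof (cases "y = x + 1")
  case True
  have "pair_bonds (x, y) = {x - 1, x, x + 1}" using True by (auto simp: pair_bonds_def)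
  then show ?thesis using True even[of 1] even[of 2]
    by (simp add: pair_gen_def pair_swap_pair swap_bond_def)
next
  case False
  then obtain k where k: "y = x + k" "2 \<le> k" using xy by (metis add.commute diff_add_cancel zle_add1_eq_le zless_add1_eq less_add_same_cancel1 one_add_one add_le_cancel_left zless_imp_add1_zle add.assoc le_less)
  have "pair_bonds (x, y) = {x - 1, x, x + k - 1, x + k}" using k by (auto simp: pair_bonds_def)
  moreover have "\<phi> (x - (x + k)) = \<phi> k" "\<phi> (x - 1 - (x + k)) = \<phi> (k + 1)" "\<phi> (x + 1 - (x + k)) = \<phi> (k - 1)"
    "\<phi> (x - (x + k - 1)) = \<phi> (k - 1)" "\<phi> (x - (x + k + 1)) = \<phi> (k + 1)"
    using even[of k] even[of "k + 1"] even[of "k - 1"] by (simp_all add: algebra_simps)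
  ultimately show ?thesis using k
    by (simp add: pair_gen_def pair_swap_pair swap_bond_def)
qed

text \<open>The solution is 1 on the diagonal, which is invariant because equal positions move
  together, and \<open>alt_heat\<close> of the distance elsewhere. At distance 1 the reflected
  generator matches the equation because \<open>alt_heat\<close> has equal values at 0 and 1. Pairs
  in the opposite order follow by exchanging the coordinates.\<close>

lemma pair_sg_alternating:
  assumes t: "0 \<le> t"
  shows "pair_sg t (\<lambda>a. (- 1) ^ nat \<bar>fst a - snd a\<bar>) (x, y) =
    (if x = y then 1 else alt_heat t (nat \<bar>x - y\<bar>))"
proof -
  define \<phi> where "\<phi> s k = (if k = 0 then 1 else alt_heat s (nat \<bar>k\<bar>))" for s and k :: int
  have even: "\<phi> s (- k) = \<phi> s k" for s k by (simp add: \<phi>_def)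
  have "pair_sg t ((\<lambda>s a. \<phi> s (fst a - snd a)) 0) a = (\<lambda>s a. \<phi> s (fst a - snd a)) t a" for a
  proof (rule pair_sg_unique[OF t, where K="1 + 2 * exp (8 * t)"])
    fix s :: real and a :: "int \<times> int" assume s: "s \<in> {0..t}"
    obtain x y where a: "a = (x, y)" by force
    have pos: "((\<lambda>s. \<phi> s (x - y)) has_real_derivative pair_gen (\<lambda>a. \<phi> s (fst a - snd a)) (x, y)) (at s within {0..t})"
      if xy: "x < y" for x y
    proof -
      define k where "k = nat (y - x - 1)"
      have y: "y = x + int k + 1" using xy by (simp add: k_def)
      have "\<phi> s (x - y) = alt_heat s (Suc k)" for s
      proof -
        have "nat \<bar>x - y\<bar> = Suc k" "x \<noteq> y" using y by auto
        then show ?thesis by (simp add: \<phi>_def)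
      qed
      moreover have "pair_gen (\<lambda>a. \<phi> s (fst a - snd a)) (x, y) = alt_heat s (Suc (Suc k)) + alt_heat s k - 2 * alt_heat s (Suc k)"
      proof (cases k)
        case 0
        have "\<phi> s 2 = alt_heat s (Suc (Suc 0))" "\<phi> s 1 = alt_heat s (Suc 0)" by (simp_all add: \<phi>_def numeral_2_eq_2)
        then show ?thesis unfolding pair_gen_distance[of "\<phi> s", OF even xy] using y 0 by simp
      next
        case (Suc j)
        have nat: "\<phi> s (int (Suc i)) = alt_heat s (Suc i)" for i
        proof -
          have "nat \<bar>int (Suc i)\<bar> = Suc i" by simp
          then show ?thesis by (simp add: \<phi>_def del: alt_heat.simps)
        qed
        have "y - x + 1 = int (Suc (Suc k))" "y - x - 1 = int (Suc j)" "y - x = int (Suc k)"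
          using y Suc by auto
        then have "\<phi> s (y - x + 1) = alt_heat s (Suc (Suc k))" "\<phi> s (y - x - 1) = alt_heat s k" "\<phi> s (y - x) = alt_heat s (Suc k)"
          by (simp_all only: nat Suc)
        then show ?thesis unfolding pair_gen_distance[of "\<phi> s", OF even xy] using y Suc by (simp del: alt_heat.simps)
      qed
      ultimately show ?thesis using alt_heat_deriv[of k s] by (simp add: has_field_derivative_at_within)
    qed
    show "((\<lambda>s. \<phi> s (fst a - snd a)) has_real_derivative pair_gen (\<lambda>a. \<phi> s (fst a - snd a)) a) (at s within {0..t})"
    proof (cases x y rule: linorder_cases)
      case less
      then show ?thesis using pos[of x y] by (simp add: a)
    next
      case equal
      have "pair_gen (\<lambda>a. \<phi> s (fst a - snd a)) (x, x) = 0"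
        by (simp add: pair_gen_def pair_swap_pair)
      then show ?thesis using equal by (simp add: a \<phi>_def)
    next
      case greater
      have "pair_gen (\<lambda>a. \<phi> s (fst a - snd a)) (x, y) = pair_gen (\<lambda>a. \<phi> s (fst a - snd a)) (y, x)"
        unfolding pair_gen_flip[of _ x y] using even[of s "_ - _"] by (simp add: case_prod_beta')
      then show ?thesis using pos[of y x] greater even[of _ "x - y"] by (simp add: a)
    qed
    have "\<bar>alt_heat s k\<bar> \<le> 1 + 2 * exp (8 * t)" for k
    proof -
      have "(\<Sum>j<k. \<bar>heat_kernel (2 * s) (int j)\<bar>) = (\<Sum>j\<in>int ` {..<k}. \<bar>heat_kernel (2 * s) j\<bar>)"
        by (subst sum.reindex) auto
      also have "\<dots> \<le> exp (4 * (2 * s))" using s by (intro sum_abs_heat_kernel) auto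
      also have "\<dots> \<le> exp (8 * t)" using s by simp
      finally show ?thesis using alt_heat_bound[of s k] heat_kernel_bound[of "2 * s" 0] s by auto
    qed
    then show "\<bar>\<phi> s (fst a - snd a)\<bar> \<le> 1 + 2 * exp (8 * t)"
      using exp_ge_zero[of "8 * t"] by (simp add: \<phi>_def)
  qed
  moreover have "\<phi> 0 k = (- 1) ^ nat \<bar>k\<bar>" for k
  proof (cases "k = 0")
    case False
    then obtain j where "nat \<bar>k\<bar> = Suc j" by (metis gr0_implies_Suc nat_0_iff not_gr_zero abs_le_zero_iff)
    then show ?thesis using alt_heat_0[of j] False by (simp add: \<phi>_def)
  qed (simp add: \<phi>_def)
  ultimately have "pair_sg t (\<lambda>a. (- 1) ^ nat \<bar>fst a - snd a\<bar>) (x, y) = \<phi> t (x - y)" by simp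
  then show ?thesis by (simp add: \<phi>_def)
qed

section \<open>The law of two stirring particles\<close>

lemma integrable_count_space_finite_support:
  fixes f :: "'b \<Rightarrow> real"
  assumes "finite {a. f a \<noteq> 0}"
  shows "integrable (counting) f"
proof -
  have "integrable (counting) (\<lambda>a. \<Sum>b\<in>{a. f a \<noteq> 0}. indicator {b} a * f b)"
    by (intro Bochner_Integration.integrable_sum integrable_mult_left integrable_real_indicator) auto
  moreover have "(\<Sum>b\<in>{a. f a \<noteq> 0}. indicator {b} a * f b) = f a" for a
  proof -
    have "(\<Sum>b\<in>{a. f a \<noteq> 0}. indicator {b} a * f b) = (\<Sum>b\<in>{a. f a \<noteq> 0}. if a = b then f b else 0)"
      by (intro sum.cong) (auto simp: indicator_def)
    then show ?thesis using assms by (simp add: sum.delta)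
  qed
  ultimately show ?thesis by simp
qed

lemma borel_measurable_pair_count:
  fixes f :: "'a \<times> 'c :: countable \<Rightarrow> real"
  assumes "\<And>c. (\<lambda>\<omega>. f (\<omega>, c)) \<in> borel_measurable M"
  shows "f \<in> borel_measurable (M \<Otimes>\<^sub>M counting)"
proof -
  have "(\<lambda>p. f (fst p, snd p)) \<in> borel_measurable (M \<Otimes>\<^sub>M counting)"
    by (rule measurable_compose_countable[where f="\<lambda>c p. f (fst p, c)" and g=snd])
       (rule measurable_compose[OF measurable_fst assms], rule measurable_snd)
  then show ?thesis by simp
qed

lemma (in prob_space) expectation_discrete:
  fixes Z :: "'a \<Rightarrow> 'b :: countable" and F :: "'b \<Rightarrow> real"
  assumes Z[measurable]: "Z \<in> M \<rightarrow>\<^sub>M counting" and F: "\<And>a. \<bar>F a\<bar> \<le> K"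
  shows "integrable (counting) (\<lambda>c. prob {\<omega>\<in>space M. Z \<omega> = c} * F c)"
    and "expectation (\<lambda>\<omega>. F (Z \<omega>)) = (\<integral>c. prob {\<omega>\<in>space M. Z \<omega> = c} * F c \<partial>counting)"
proof -
  interpret C: sigma_finite_measure "count_space (UNIV :: 'b set)"
    by (rule sigma_finite_measure_count_space_countable) simp
  interpret P: pair_sigma_finite M "count_space (UNIV :: 'b set)" ..
  define f where "f = (\<lambda>(\<omega>, c). of_bool (Z \<omega> = c) * F c)"
  have single: "has_bochner_integral (counting) (\<lambda>c. of_bool (Z \<omega> = c) * G c) (G (Z \<omega>))" for G :: "'b \<Rightarrow> real" and \<omega>
  proof -
    have fin: "finite {a. of_bool (Z \<omega> = a) * G a \<noteq> 0}"
      by (rule finite_subset[of _ "{Z \<omega>}"]) auto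
    have "integrable (counting) (\<lambda>c. of_bool (Z \<omega> = c) * G c)"
      by (rule integrable_count_space_finite_support[OF fin])
    moreover have "(\<integral>c. of_bool (Z \<omega> = c) * G c \<partial>counting) = G (Z \<omega>)"
    proof -
      have "(\<integral>c. of_bool (Z \<omega> = c) * G c \<partial>counting) = (\<Sum>a | a \<in> UNIV \<and> of_bool (Z \<omega> = a) * G a \<noteq> 0. of_bool (Z \<omega> = a) * G a)"
        using fin by (intro lebesgue_integral_count_space_finite_support) simp
      also have "\<dots> = (\<Sum>a\<in>{Z \<omega>}. of_bool (Z \<omega> = a) * G a)"
        by (rule sum.mono_neutral_left) auto
      finally show ?thesis by simp
    qed
    ultimately show ?thesis by (simp add: has_bochner_integral_iff)
  qed
  have m: "f \<in> borel_measurable (M \<Otimes>\<^sub>M counting)"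
    by (rule borel_measurable_pair_count) (simp add: f_def)
  have intF: "integrable M (\<lambda>\<omega>. \<bar>F (Z \<omega>)\<bar>)"
    by (rule integrable_const_bound[where B=K]) (use F in auto)
  have int: "integrable (M \<Otimes>\<^sub>M counting) f"
  proof (rule P.Fubini_integrable[OF m])
    have "(\<integral>c. norm (f (\<omega>, c)) \<partial>counting) = \<bar>F (Z \<omega>)\<bar>" for \<omega>
      using has_bochner_integral_integral_eq[OF single[of \<omega> "\<lambda>c. \<bar>F c\<bar>"]] by (simp add: f_def abs_mult)
    then show "integrable M (\<lambda>\<omega>. \<integral>c. norm (f (\<omega>, c)) \<partial>counting)" using intF by simp
    show "AE \<omega> in M. integrable (counting) (\<lambda>c. f (\<omega>, c))"
      using single[of _ F] by (auto simp: f_def has_bochner_integral_iff)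
  qed
  have inner: "(\<integral>\<omega>. f (\<omega>, c) \<partial>M) = prob {\<omega>\<in>space M. Z \<omega> = c} * F c" for c
    by (simp add: f_def expectation_of_bool)
  have int': "integrable (M \<Otimes>\<^sub>M counting) (case_prod (\<lambda>x y. f (x, y)))" using int by simp
  show "integrable (counting) (\<lambda>c. prob {\<omega>\<in>space M. Z \<omega> = c} * F c)"
    using P.integrable_snd[OF int'] by (simp add: inner)
  have "expectation (\<lambda>\<omega>. F (Z \<omega>)) = (\<integral>\<omega>. (\<integral>c. f (\<omega>, c) \<partial>counting) \<partial>M)"
    using has_bochner_integral_integral_eq[OF single[of _ F]] by (simp add: f_def)
  also have "\<dots> = (\<integral>c. (\<integral>\<omega>. f (\<omega>, c) \<partial>M) \<partial>counting)"
    using P.Fubini_integral[OF int'] by simp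
  finally show "expectation (\<lambda>\<omega>. F (Z \<omega>)) = (\<integral>c. prob {\<omega>\<in>space M. Z \<omega> = c} * F c \<partial>counting)"
    by (simp add: inner)
qed

context ssep
begin

text \<open>A slot is silent exactly when a Poisson variable of parameter h / 2 is zero. The test is
  phrased as a function on path space so that path-level independence of the clocks can enter
  through \<open>indep_vars_nested\<close>.\<close>

lemma clock_events:
  assumes h: "0 < h"
  defines "E \<equiv> \<lambda>(b, k) \<omega>. N b (h * real (Suc k)) \<omega> - N b (h * real k) \<omega> \<noteq> 0"
  shows "indep_vars (\<lambda>_. counting) E UNIV"
    and "prob {\<omega>\<in>space M. E i \<omega>} = 1 - exp (- h / 2)"
proof -
  define g where "g b k f = (f (h * real (Suc k)) - f (h * real k) \<noteq> (0 :: nat))" for b :: int and k and f :: "real \<Rightarrow> nat"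
  define Z where "Z b \<omega> = (\<lambda>t\<in>{0..}. N b t \<omega>)" for b \<omega>
  have hk: "h * real k \<in> {0..}" for k using h by simp
  have gZ: "g b k (Z b \<omega>) \<longleftrightarrow> N b (h * real (Suc k)) \<omega> - N b (h * real k) \<omega> \<noteq> 0" for b k \<omega>
    unfolding g_def Z_def restrict_apply'[OF hk] ..
  have rv: "N b t \<in> M \<rightarrow>\<^sub>M counting" if "0 \<le> t" for b t
    using clocks_poisson[of b] that unfolding poisson_process_def by blast
  have "indep_vars (\<lambda>_. counting) (\<lambda>(b, k) \<omega>. g b k (Z b \<omega>)) UNIV"
  proof (rule indep_vars_nested[where M'="\<lambda>_. PiM {0..} (\<lambda>_. counting)" and Z=Z and g=g and N="counting"])
    show "indep_vars (\<lambda>_. PiM {0..} (\<lambda>_. counting)) Z UNIV"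
      using clocks_indep by (simp add: indep_processes_def Z_def[abs_def])
    have comp: "(\<lambda>f. f (h * real k)) \<in> PiM {0..} (\<lambda>_. count_space (UNIV :: nat set)) \<rightarrow>\<^sub>M counting" for k
      by (rule measurable_component_singleton[OF hk])
    show "g b k \<in> PiM {0..} (\<lambda>_. counting) \<rightarrow>\<^sub>M counting" for b k
    proof -
      from measurable_compose[OF measurable_Pair_count[OF comp[of "Suc k"] comp[of k]], of "\<lambda>(u, v). u - v \<noteq> 0" "counting"]
      show ?thesis by (simp add: g_def[abs_def])
    qed
    show "indep_vars (\<lambda>_. counting) (\<lambda>k \<omega>. g b k (Z b \<omega>)) UNIV" for b
    proof -
      have "incseq (\<lambda>k. h * real k)" using h by (intro incseq_SucI) (simp add: distrib_left)
      moreover have "\<forall>u :: nat \<Rightarrow> real. 0 \<le> u 0 \<and> incseq u \<longrightarrow>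
          indep_vars (\<lambda>_. counting) (\<lambda>i \<omega>. N b (u (Suc i)) \<omega> - N b (u i) \<omega>) UNIV"
        using clocks_poisson[of b] unfolding poisson_process_def by blast
      ultimately have "indep_vars (\<lambda>_. counting) (\<lambda>k \<omega>. N b (h * real (Suc k)) \<omega> - N b (h * real k) \<omega>) UNIV"
        by (auto dest: spec[of _ "\<lambda>k. h * real k"])
      from indep_vars_compose2[OF this, of "\<lambda>_ d. d \<noteq> 0" "\<lambda>_. counting"]
      show ?thesis unfolding gZ by simp
    qed
  qed
  then show "indep_vars (\<lambda>_. counting) E UNIV" by (simp add: gZ E_def)
  obtain b k where i: "i = (b, k)" by force
  have lt: "h * real k < h * real (Suc k)" using h by simp
  let ?D = "\<lambda>\<omega>. N b (h * real (Suc k)) \<omega> - N b (h * real k) \<omega>"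
  have Dm: "?D \<in> M \<rightarrow>\<^sub>M counting"
    using measurable_compose[OF measurable_Pair_count[OF rv[of "h * real (Suc k)" b] rv[of "h * real k" b]],
        of "\<lambda>(u, v). u - v" "counting"] hk[of k] hk[of "Suc k"] by simp
  have "distr M (counting) ?D = measure_pmf (poisson_pmf (1 / 2 * (h * real (Suc k) - h * real k)))"
    using clocks_poisson[of b] lt hk[of k] unfolding poisson_process_def atLeast_iff by blast
  then have "measure (distr M (counting) ?D) {0} = measure (measure_pmf (poisson_pmf (1 / 2 * (h * real (Suc k) - h * real k)))) {0}"
    by simp
  moreover have "measure (distr M (counting) ?D) {0} = prob {\<omega>\<in>space M. ?D \<omega> = 0}"
    by (subst measure_distr[OF Dm]) (auto intro!: arg_cong[where f=prob])
  moreover have "1 / 2 * (h * real (Suc k) - h * real k) = h / 2" by (simp add: algebra_simps)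
  moreover have "measure (measure_pmf (poisson_pmf (h / 2))) {0} = exp (- h / 2)"
    using h by (simp add: measure_pmf_single)
  ultimately have "prob {\<omega>\<in>space M. ?D \<omega> = 0} = exp (- h / 2)" by (simp only:)
  moreover have "prob (space M - {\<omega>\<in>space M. ?D \<omega> = 0}) = 1 - prob {\<omega>\<in>space M. ?D \<omega> = 0}"
    by (rule prob_compl) (use Dm in measurable)
  moreover have "space M - {\<omega>\<in>space M. ?D \<omega> = 0} = {\<omega>\<in>space M. E i \<omega>}"
    by (auto simp: E_def i)
  ultimately show "prob {\<omega>\<in>space M. E i \<omega>} = 1 - exp (- h / 2)" by simp
qed

lemma X_pair_measurable:
  "0 \<le> t \<Longrightarrow> (\<lambda>\<omega>. (X x t \<omega>, X y t \<omega>)) \<in> M \<rightarrow>\<^sub>M counting"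
  by (intro measurable_Pair_count X_measurable)

lemma X_0: "AE \<omega> in M. X x 0 \<omega> = x"
  using X_stirring by eventually_elim (simp add: stirring_path_def)

text \<open>Two limits of the same sequence on refining grids: by pathwise agreement and dominated
  convergence it tends to the expectation for the particles, and by \<open>jump_chain_approx\<close>
  its distance from the semigroup is of order t^2 / m.\<close>

lemma expectation_stirring_pair_pos:
  assumes t: "0 < t" and F: "\<And>a. \<bar>F a\<bar> \<le> K"
  shows "expectation (\<lambda>\<omega>. F (X x t \<omega>, X y t \<omega>)) = pair_sg t F (x, y)"
proof -
  have K: "0 \<le> K" by (rule order_trans[OF abs_ge_zero F[of "(0, 0)"]])
  define E where "E m = (\<lambda>(b, k) \<omega>. N b (t / real m * real (Suc k)) \<omega> - N b (t / real m * real k) \<omega> \<noteq> 0)" for m :: nat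
  define Y where "Y m \<omega> = (jump_chain (\<lambda>i. E m i \<omega>) x m, jump_chain (\<lambda>i. E m i \<omega>) y m)" for m \<omega>
  \<comment> \<open>Grids with \<open>Suc m\<close> cells avoid the degenerate mesh t / 0.\<close>
  have tm: "0 < t / real (Suc m)" for m using t by simp
  have Em: "E (Suc m) i \<in> M \<rightarrow>\<^sub>M counting" for m i
    using clock_events(1)[OF tm[of m]] unfolding E_def[symmetric] indep_vars_def by blast
  have Ym: "Y (Suc m) \<in> M \<rightarrow>\<^sub>M counting" for m
    unfolding Y_def by (intro measurable_Pair_count measurable_jump_chain Em)
  have "AE \<omega> in M. (\<lambda>m. F (Y (Suc m) \<omega>)) \<longlonglongrightarrow> F (X x t \<omega>, X y t \<omega>)"
  proof -
    have "AE \<omega> in M. \<forall>b. mono_on {0..} (\<lambda>t. N b t \<omega>) \<and> (\<forall>t\<ge>0. \<forall>\<^sub>F s in at_right t. N b s \<omega> = N b t \<omega>)"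
      using clocks_poisson by (simp add: AE_all_countable poisson_process_def)
    with X_stirring show ?thesis
    proof eventually_elim
      case (elim \<omega>)
      have "\<forall>\<^sub>F m in sequentially. jump_chain (\<lambda>i. E m i \<omega>) z m = X z t \<omega>" for z
        using jump_chain_eq_stirring_path[of "\<lambda>b t. N b t \<omega>" z "\<lambda>t. X z t \<omega>" t] elim t
        by (simp add: E_def case_prod_beta')
      from eventually_conj[OF this[of x] this[of y]] have "\<forall>\<^sub>F m in sequentially. F (Y m \<omega>) = F (X x t \<omega>, X y t \<omega>)"
        unfolding Y_def by (rule eventually_mono) simp
      then have "(\<lambda>m. F (Y m \<omega>)) \<longlonglongrightarrow> F (X x t \<omega>, X y t \<omega>)" by (rule tendsto_eventually)
      then show ?case by (rule LIMSEQ_Suc)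
    qed
  qed
  then have lim1: "(\<lambda>m. expectation (\<lambda>\<omega>. F (Y (Suc m) \<omega>))) \<longlonglongrightarrow> expectation (\<lambda>\<omega>. F (X x t \<omega>, X y t \<omega>))"
  proof (rule integral_dominated_convergence[where w="\<lambda>_. K", rotated 3])
    show "(\<lambda>\<omega>. F (X x t \<omega>, X y t \<omega>)) \<in> borel_measurable M"
      using measurable_compose[OF X_pair_measurable[of t x y], of F borel] t by simp
    show "(\<lambda>\<omega>. F (Y (Suc m) \<omega>)) \<in> borel_measurable M" for m
      using measurable_compose[OF Ym[of m], of F borel] by simp
  qed (use F in auto)
  have bound: "\<bar>expectation (\<lambda>\<omega>. F (Y (Suc m) \<omega>)) - pair_sg t F (x, y)\<bar> \<le> 57 * exp (4 * t) * K * t\<^sup>2 / real (Suc m)" for m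
  proof -
    let ?h = "t / real (Suc m)"
    have eq: "real (Suc m) * ?h = t" by simp
    have "\<bar>expectation (\<lambda>\<omega>. F (Y (Suc m) \<omega>)) - pair_sg (real (Suc m) * ?h) F (x, y)\<bar> \<le> 57 * exp (4 * (real (Suc m) * ?h)) * K * ?h\<^sup>2 * real (Suc m)"
      unfolding Y_def using clock_events[OF tm[of m]] t F unfolding E_def[symmetric] by (intro jump_chain_approx) auto
    moreover have "?h\<^sup>2 * real (Suc m) = t\<^sup>2 / real (Suc m)" by (simp add: power2_eq_square)
    ultimately show ?thesis unfolding eq by (simp add: mult.assoc)
  qed
  have "(\<lambda>m. 57 * exp (4 * t) * K * t\<^sup>2 / real (Suc m)) \<longlonglongrightarrow> 0"
    by (rule LIMSEQ_Suc[OF lim_const_over_n])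
  then have "(\<lambda>m. expectation (\<lambda>\<omega>. F (Y (Suc m) \<omega>)) - pair_sg t F (x, y)) \<longlonglongrightarrow> 0"
    by (rule Lim_null_comparison[rotated]) (use bound in auto)
  then have "(\<lambda>m. expectation (\<lambda>\<omega>. F (Y (Suc m) \<omega>))) \<longlonglongrightarrow> pair_sg t F (x, y)"
    by (simp add: Lim_null[symmetric])
  from LIMSEQ_unique[OF lim1 this] show ?thesis .
qed

lemma expectation_stirring_pair:
  assumes t: "0 \<le> t" and F: "\<And>a. \<bar>F a\<bar> \<le> K"
  shows "expectation (\<lambda>\<omega>. F (X x t \<omega>, X y t \<omega>)) = pair_sg t F (x, y)"
proof (cases "t = 0")
  case True
  have "expectation (\<lambda>\<omega>. F (X x t \<omega>, X y t \<omega>)) = expectation (\<lambda>\<omega>. F (x, y))"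
  proof (rule integral_cong_AE)
    show "(\<lambda>\<omega>. F (X x t \<omega>, X y t \<omega>)) \<in> borel_measurable M"
      using measurable_compose[OF X_pair_measurable[OF t, of x y], of F borel] by simp
    show "AE \<omega> in M. F (X x t \<omega>, X y t \<omega>) = F (x, y)"
      using X_0[of x] X_0[of y] by eventually_elim (simp add: True)
  qed simp
  then show ?thesis using True by (simp add: prob_space)
next
  case False
  then have "0 < t" using t by simp
  then show ?thesis by (rule expectation_stirring_pair_pos) (rule F)
qed

text \<open>The probabilistic representation replaces the growth factor exp (4 t) by 1.\<close>

lemma pair_sg_contraction:
  assumes "0 \<le> t" "\<And>a. \<bar>F a\<bar> \<le> K"
  shows "\<bar>pair_sg t F a\<bar> \<le> K"
proof -
  obtain x y where a: "a = (x, y)" by force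
  have "\<bar>expectation (\<lambda>\<omega>. F (X x t \<omega>, X y t \<omega>))\<bar> \<le> expectation (\<lambda>\<omega>. K)"
  proof (intro order_trans[OF integral_abs_bound] integral_mono)
    show "integrable M (\<lambda>\<omega>. \<bar>F (X x t \<omega>, X y t \<omega>)\<bar>)"
    proof (rule integrable_const_bound[where B=K])
      show "(\<lambda>\<omega>. \<bar>F (X x t \<omega>, X y t \<omega>)\<bar>) \<in> borel_measurable M"
        using measurable_compose[OF X_pair_measurable[OF assms(1), of x y], of "\<lambda>a. \<bar>F a\<bar>" borel] by simp
    qed (use assms in auto)
  qed (use assms in auto)
  then show ?thesis unfolding a expectation_stirring_pair[where F=F and K=K, OF assms] by (simp add: prob_space)
qed

definition pair_kernel :: "real \<Rightarrow> int \<times> int \<Rightarrow> int \<times> int \<Rightarrow> real" where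
  "pair_kernel t a c = pair_sg t (indicator {c}) a"

lemma pair_kernel_prob:
  "0 \<le> t \<Longrightarrow> pair_kernel t (x, y) c = prob {\<omega>\<in>space M. (X x t \<omega>, X y t \<omega>) = c}"
proof -
  assume t: "0 \<le> t"
  have "pair_kernel t (x, y) c = expectation (\<lambda>\<omega>. indicator {c} (X x t \<omega>, X y t \<omega>))"
    unfolding pair_kernel_def by (rule expectation_stirring_pair[OF t, symmetric, of _ 1]) (simp add: indicator_def)
  also have "\<dots> = expectation (\<lambda>\<omega>. of_bool ((X x t \<omega>, X y t \<omega>) = c))"
    by (intro Bochner_Integration.integral_cong) (auto simp: indicator_def)
  finally show ?thesis by (simp only: expectation_of_bool)
qed

lemma pair_kernel_nonneg: "0 \<le> t \<Longrightarrow> 0 \<le> pair_kernel t a c"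
  by (cases a) (simp add: pair_kernel_prob)

lemma pair_kernel_sym: "pair_kernel t a c = pair_kernel t c a"
  unfolding pair_kernel_def by (rule pair_sg_symmetric)

lemma pair_sg_integral:
  assumes "0 \<le> t" "\<And>a. \<bar>F a\<bar> \<le> K"
  shows "integrable (counting) (\<lambda>c. pair_kernel t a c * F c)"
    and "pair_sg t F a = (\<integral>c. pair_kernel t a c * F c \<partial>counting)"
proof -
  obtain x y where a: "a = (x, y)" by force
  note * = expectation_discrete[OF X_pair_measurable[OF assms(1), of x y], of F K, OF assms(2)]
  show "integrable (counting) (\<lambda>c. pair_kernel t a c * F c)"
    using *(1) by (simp add: a pair_kernel_prob[OF assms(1)])
  show "pair_sg t F a = (\<integral>c. pair_kernel t a c * F c \<partial>counting)"
    using *(2) expectation_stirring_pair[where F=F and K=K and x=x and y=y, OF assms] by (simp add: a pair_kernel_prob[OF assms(1)])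
qed

lemma prob_X: "0 \<le> t \<Longrightarrow> prob {\<omega>\<in>space M. X x t \<omega> = z} = heat_kernel t (x - z)"
  using expectation_stirring_pair[of t "\<lambda>a. of_bool (fst a = z)" 1 x x] pair_sg_fst_heat_kernel[of t z x x]
    expectation_of_bool[of "\<lambda>\<omega>. X x t \<omega> = z"] by simp

text \<open>By symmetry the kernel is also the law of a particle started at 0, so the sum of squares
  is the mean of the kernel along the particle, which the semigroup property evaluates.\<close>

lemma heat_kernel_square:
  assumes "0 \<le> t"
  shows "integrable (counting) (\<lambda>z. (heat_kernel t z)\<^sup>2)"
    and "(\<integral>z. (heat_kernel t z)\<^sup>2 \<partial>counting) = heat_kernel (2 * t) 0"
proof -
  have p: "prob {\<omega>\<in>space M. X 0 t \<omega> = z} * heat_kernel t z = (heat_kernel t z)\<^sup>2" for z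
    using prob_X[OF assms, of 0 z] heat_kernel_minus[of t z] by (simp add: power2_eq_square)
  note * = expectation_discrete[OF X_measurable[OF assms, of 0], of "heat_kernel t" 1, OF heat_kernel_bound[OF assms]]
  show "integrable (counting) (\<lambda>z. (heat_kernel t z)\<^sup>2)" using *(1) by (simp add: p)
  show "(\<integral>z. (heat_kernel t z)\<^sup>2 \<partial>counting) = heat_kernel (2 * t) 0"
    using *(2) expectation_stirring_pair[where F="\<lambda>a. heat_kernel t (fst a)" and K=1 and x=0 and y=0, OF assms]
      heat_kernel_semigroup[OF assms assms, of 0 0] heat_kernel_bound[OF assms] by (simp add: p)
qed

end

section \<open>Summing the covariances\<close>

text \<open>The defect in the backward equation of a product of two crossing probabilities at time
  u: the last term of \<open>pair_gen_product\<close>, with the gradient rewritten as a heat kernel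
  by \<open>crossing_prob_diff\<close>.\<close>

definition product_gradient :: "real \<Rightarrow> int \<times> int \<Rightarrow> real" where
  "product_gradient u a = (\<Sum>b\<in>pair_bonds a. (heat_kernel u (b + 1))\<^sup>2 * bond_form b a) / 2"

definition both_nonneg :: "int \<times> int \<Rightarrow> real" where
  "both_nonneg a = of_bool (0 \<le> fst a \<and> 0 \<le> snd a)"

definition both_even :: "int \<times> int \<Rightarrow> real" where
  "both_even a = of_bool (even (fst a) \<and> even (snd a))"

lemma abs_bond_form_le: "\<bar>bond_form b a\<bar> \<le> 1"
  by (simp add: bond_form_def bond_sign_def)

lemma bond_form_eq_0: "b \<notin> pair_bonds a \<Longrightarrow> bond_form b a = 0"
  by (cases a) (auto simp: bond_form_def bond_sign_def pair_bonds_def)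

lemma bond_form_integral:
  fixes G :: "int \<times> int \<Rightarrow> real"
  shows "integrable (counting) (\<lambda>c. bond_form b c * G c)"
    and "(\<integral>c. bond_form b c * G c \<partial>counting) = G (b, b) + G (b + 1, b + 1) - G (b, b + 1) - G (b + 1, b)"
    and "(\<integral>c. \<bar>bond_form b c * G c\<bar> \<partial>counting) = \<bar>G (b, b)\<bar> + \<bar>G (b + 1, b + 1)\<bar> + \<bar>G (b, b + 1)\<bar> + \<bar>G (b + 1, b)\<bar>"
proof -
  define Q where "Q = {(b, b), (b + 1, b + 1), (b, b + 1), (b + 1, b)}"
  have Q: "bond_form b c = 0" if "c \<notin> Q" for c
    using that by (cases c) (auto simp: Q_def bond_form_def bond_sign_def)
  have int: "(\<integral>c. h c \<partial>counting) = sum h Q" "integrable (counting) h"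
    if h: "\<And>c. c \<notin> Q \<Longrightarrow> h c = 0" for h :: "int \<times> int \<Rightarrow> real"
  proof -
    have sub: "{c. h c \<noteq> 0} \<subseteq> Q" using h by blast
    then have fin: "finite {c. h c \<noteq> 0}" by (rule finite_subset) (simp add: Q_def)
    then show "integrable (counting) h" by (rule integrable_count_space_finite_support)
    have "(\<integral>c. h c \<partial>counting) = (\<Sum>c | c \<in> UNIV \<and> h c \<noteq> 0. h c)"
      by (rule lebesgue_integral_count_space_finite_support) (use fin in simp)
    also have "\<dots> = sum h Q"
      by (rule sum.mono_neutral_left) (use sub in \<open>auto simp: Q_def\<close>)
    finally show "(\<integral>c. h c \<partial>counting) = sum h Q" .
  qed
  show "integrable (counting) (\<lambda>c. bond_form b c * G c)"
    by (rule int(2)) (simp add: Q)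
  show "(\<integral>c. bond_form b c * G c \<partial>counting) = G (b, b) + G (b + 1, b + 1) - G (b, b + 1) - G (b + 1, b)"
    by (subst int(1)) (simp_all add: Q, simp add: Q_def bond_form_def bond_sign_def)
  show "(\<integral>c. \<bar>bond_form b c * G c\<bar> \<partial>counting) = \<bar>G (b, b)\<bar> + \<bar>G (b + 1, b + 1)\<bar> + \<bar>G (b, b + 1)\<bar> + \<bar>G (b + 1, b)\<bar>"
    by (subst int(1)) (simp_all add: Q, simp add: Q_def bond_form_def bond_sign_def)
qed

lemma pair_sigma_finite_count_space:
  "pair_sigma_finite (count_space (UNIV :: 'b :: countable set)) (count_space (UNIV :: 'c :: countable set))"
  by (intro pair_sigma_finite.intro sigma_finite_measure_count_space_countable) simp_all

lemma product_gradient_bound: "0 \<le> u \<Longrightarrow> \<bar>product_gradient u a\<bar> \<le> 2"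
proof -
  assume u: "0 \<le> u"
  have "\<bar>(heat_kernel u (b + 1))\<^sup>2 * bond_form b a\<bar> \<le> 1" for b
  proof -
    have "(heat_kernel u (b + 1))\<^sup>2 \<le> 1" using heat_kernel_bound[OF u] by (simp add: abs_square_le_1)
    then show ?thesis using mult_mono[OF _ abs_bond_form_le[of b a], of "(heat_kernel u (b + 1))\<^sup>2" 1] by (simp add: abs_mult)
  qed
  then have "\<bar>\<Sum>b\<in>pair_bonds a. (heat_kernel u (b + 1))\<^sup>2 * bond_form b a\<bar> \<le> (\<Sum>b\<in>pair_bonds a. 1)"
    by (intro order_trans[OF sum_abs] sum_mono)
  also have "\<dots> \<le> 4" using card_pair_bonds[of a] by simp
  finally show ?thesis by (simp add: product_gradient_def)
qed

text \<open>The product of (1 + (-1)^x) / 2 and (1 + (-1)^y) / 2, expanded. The evolutions of the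
  first three terms involve at most one particle, and the last depends only on the distance.\<close>

lemma both_even_decomp:
  "both_even a = 1 / 4 * (1 + (- 1) ^ nat \<bar>fst a\<bar> + (- 1) ^ nat \<bar>snd a\<bar> + (- 1) ^ nat \<bar>fst a - snd a\<bar>)"
proof -
  have "(- 1 :: real) ^ nat \<bar>k\<bar> = (if even k then 1 else - 1)" for k :: int
    by (simp add: minus_one_power_iff even_nat_iff)
  then show ?thesis by (auto simp: both_even_def)
qed

context ssep
begin

lemma pair_sg_marginal_fst:
  assumes "0 \<le> s" "\<And>x. \<bar>f x\<bar> \<le> K"
  shows "pair_sg s (\<lambda>a. f (fst a)) (x, y) = pair_sg s (\<lambda>a. f (fst a)) (x, x)"
  using expectation_stirring_pair[where F="\<lambda>a. f (fst a)" and K=K and x=x and y=y, OF assms(1)]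
    expectation_stirring_pair[where F="\<lambda>a. f (fst a)" and K=K and x=x and y=x, OF assms(1)] assms(2)
  by simp

lemma pair_sg_marginal_snd:
  assumes "0 \<le> s" "\<And>x. \<bar>f x\<bar> \<le> K"
  shows "pair_sg s (\<lambda>a. f (snd a)) (x, y) = pair_sg s (\<lambda>a. f (fst a)) (y, y)"
  using expectation_stirring_pair[where F="\<lambda>a. f (snd a)" and K=K and x=x and y=y, OF assms(1)]
    expectation_stirring_pair[where F="\<lambda>a. f (fst a)" and K=K and x=y and y=y, OF assms(1)] assms(2)
  by simp

section \<open>Crossing probabilities, their covariance, and its sum over even starting
  pairs\<close>

definition crossing_prob :: "real \<Rightarrow> int \<Rightarrow> real" where
  "crossing_prob s x = pair_sg s (\<lambda>a. of_bool (0 \<le> fst a)) (x, x)"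

lemma crossing_prob_eq:
  "0 \<le> s \<Longrightarrow> pair_sg s (\<lambda>a. of_bool (0 \<le> fst a)) a = crossing_prob s (fst a)"
  unfolding crossing_prob_def
  using pair_sg_marginal_fst[of s "\<lambda>x. of_bool (0 \<le> x)" 1 "fst a" "snd a"] by simp

lemma crossing_prob_bound: "0 \<le> s \<Longrightarrow> \<bar>crossing_prob s x\<bar> \<le> 1"
  unfolding crossing_prob_def by (rule pair_sg_contraction) auto

lemma crossing_prob_0: "crossing_prob 0 x = of_bool (0 \<le> x)"
  by (simp add: crossing_prob_def)

definition crossing_drift :: "real \<Rightarrow> int \<Rightarrow> real" where
  "crossing_drift s x = (crossing_prob s (x + 1) + crossing_prob s (x - 1) - 2 * crossing_prob s x) / 2"

lemma crossing_prob_deriv: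
  assumes s: "0 \<le> s"
  shows "((\<lambda>s. crossing_prob s x) has_real_derivative crossing_drift s x) (at s within A)"
proof -
  have "((\<lambda>s. crossing_prob s x) has_real_derivative pair_sg s (pair_gen (\<lambda>a. of_bool (0 \<le> fst a))) (x, x)) (at s within A)"
    unfolding crossing_prob_def by (rule pair_sg_deriv[where K=1]) simp
  also have "pair_sg s (pair_gen (\<lambda>a. of_bool (0 \<le> fst a))) (x, x) = pair_gen (pair_sg s (\<lambda>a. of_bool (0 \<le> fst a))) (x, x)"
    by (rule pair_sg_gen[where K=1, symmetric]) simp
  also have "pair_sg s (\<lambda>a. of_bool (0 \<le> fst a)) = (\<lambda>a. crossing_prob s (fst a))"
    by (rule ext) (rule crossing_prob_eq[OF s])
  finally show ?thesis by (simp add: pair_gen_fst crossing_drift_def)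
qed

text \<open>The gradient solves the same translation-invariant backward equation, started from the
  jump of the step function, a point mass at 0.\<close>

lemma crossing_prob_diff:
  assumes t: "0 \<le> t"
  shows "crossing_prob t (x + 1) - crossing_prob t x = heat_kernel t (x + 1)"
proof -
  have "pair_sg t ((\<lambda>s a. crossing_prob s (fst a) - crossing_prob s (fst a - 1)) 0) (x + 1, x + 1)
     = (\<lambda>s a. crossing_prob s (fst a) - crossing_prob s (fst a - 1)) t (x + 1, x + 1)"
  proof (rule pair_sg_unique[OF t, where K=2])
    fix s :: real and a :: "int \<times> int" assume s: "s \<in> {0..t}"
    obtain x y where a: "a = (x, y)" by force
    have "((\<lambda>s. crossing_prob s x - crossing_prob s (x - 1)) has_real_derivative crossing_drift s x - crossing_drift s (x - 1)) (at s within {0..t})"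
      using s by (intro DERIV_diff crossing_prob_deriv) auto
    moreover have "crossing_drift s x - crossing_drift s (x - 1) = pair_gen (\<lambda>a. crossing_prob s (fst a) - crossing_prob s (fst a - 1)) (x, y)"
      unfolding pair_gen_fst[of "\<lambda>x. crossing_prob s x - crossing_prob s (x - 1)"] crossing_drift_def
      by (simp add: field_simps)
    ultimately show "((\<lambda>s. crossing_prob s (fst a) - crossing_prob s (fst a - 1)) has_real_derivative
        pair_gen (\<lambda>a. crossing_prob s (fst a) - crossing_prob s (fst a - 1)) a) (at s within {0..t})"
      by (simp add: a)
    show "\<bar>crossing_prob s (fst a) - crossing_prob s (fst a - 1)\<bar> \<le> 2"
      using crossing_prob_bound[of s "fst a"] crossing_prob_bound[of s "fst a - 1"] s by auto
  qed
  moreover have "(\<lambda>a :: int \<times> int. crossing_prob 0 (fst a) - crossing_prob 0 (fst a - 1)) = (\<lambda>a. of_bool (fst a = 0))"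
    by (auto simp: crossing_prob_0)
  ultimately show ?thesis using pair_sg_fst_heat_kernel[OF t, of 0 "x + 1" "x + 1"] by simp
qed

text \<open>Duhamel's formula for \<open>W\<close>, the crossing probabilities of two independent
  walks: the stirring semigroup starts from the same function at time 0, and the defect is
  \<open>product_gradient\<close>.\<close>

lemma crossing_covariance:
  assumes t: "0 \<le> t"
  shows "continuous_on {0..t} (\<lambda>s. pair_sg s (product_gradient (t - s)) a)"
    and "((\<lambda>s. pair_sg s (product_gradient (t - s)) a) has_integral
       (pair_sg t both_nonneg a - crossing_prob t (fst a) * crossing_prob t (snd a))) {0..t}"
proof -
  define W where "W s a = crossing_prob s (fst a) * crossing_prob s (snd a)" for s and a :: "int \<times> int"
  define W1 where "W1 s a = crossing_drift s (fst a) * crossing_prob s (snd a) + crossing_prob s (fst a) * crossing_drift s (snd a)" for s and a :: "int \<times> int"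
  define d2 where "d2 s x = (crossing_drift s (x + 1) + crossing_drift s (x - 1) - 2 * crossing_drift s x) / 2" for s x
  define W2 where "W2 s a = d2 s (fst a) * crossing_prob s (snd a) + 2 * (crossing_drift s (fst a) * crossing_drift s (snd a)) + crossing_prob s (fst a) * d2 s (snd a)" for s and a :: "int \<times> int"
  have b0: "\<bar>crossing_prob s x\<bar> \<le> 1" if "s \<in> {0..t}" for s x
    using that by (intro crossing_prob_bound) auto
  have b1: "\<bar>crossing_drift s x\<bar> \<le> 2" if "s \<in> {0..t}" for s x
    using b0[OF that, of x] b0[OF that, of "x + 1"] b0[OF that, of "x - 1"] unfolding crossing_drift_def by auto
  have b2: "\<bar>d2 s x\<bar> \<le> 4" if "s \<in> {0..t}" for s x
    using b1[OF that, of x] b1[OF that, of "x + 1"] b1[OF that, of "x - 1"] unfolding d2_def by auto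
  have D0: "((\<lambda>s. crossing_prob s x) has_real_derivative crossing_drift s x) (at s within {0..t})" if "s \<in> {0..t}" for s x
    using that by (intro crossing_prob_deriv) auto
  have D1: "((\<lambda>s. crossing_drift s x) has_real_derivative d2 s x) (at s within {0..t})" if "s \<in> {0..t}" for s x
  proof -
    have "((\<lambda>s. (crossing_prob s (x + 1) + crossing_prob s (x - 1) - 2 * crossing_prob s x) / 2) has_real_derivative
        (crossing_drift s (x + 1) + crossing_drift s (x - 1) - 2 * crossing_drift s x) / 2) (at s within {0..t})"
      by (intro DERIV_cdivide DERIV_diff DERIV_add DERIV_cmult D0 that)
    then show ?thesis by (simp only: crossing_drift_def[symmetric] d2_def[symmetric])
  qed
  have dW: "((\<lambda>s. W s a) has_real_derivative W1 s a) (at s within {0..t})" if "s \<in> {0..t}" for s a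
    unfolding W_def W1_def using DERIV_mult[OF D0[OF that, of "fst a"] D0[OF that, of "snd a"]] by (simp add: algebra_simps)
  have dW1: "((\<lambda>s. W1 s a) has_real_derivative W2 s a) (at s within {0..t})" if "s \<in> {0..t}" for s a
    unfolding W1_def W2_def
    using DERIV_add[OF DERIV_mult[OF D1[OF that, of "fst a"] D0[OF that, of "snd a"]]
        DERIV_mult[OF D0[OF that, of "fst a"] D1[OF that, of "snd a"]]]
    by (simp add: algebra_simps)
  have mult_bd: "\<bar>p * q\<bar> \<le> A * B" if "\<bar>p\<bar> \<le> A" "\<bar>q\<bar> \<le> B" for p q A B :: real
    unfolding abs_mult using that by (intro mult_mono) auto
  \<comment> \<open>With bounds 1, 2 and 4 for the crossing probability and its two time
    derivatives, the largest of the three is 4 + 2 * 4 + 4 = 16.\<close>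
  have bW: "\<bar>W s a\<bar> \<le> 16" "\<bar>W1 s a\<bar> \<le> 16" "\<bar>W2 s a\<bar> \<le> 16" if s: "s \<in> {0..t}" for s a
  proof -
    note m = mult_bd[OF b0[OF s, of "fst a"] b0[OF s, of "snd a"]] mult_bd[OF b1[OF s, of "fst a"] b0[OF s, of "snd a"]]
      mult_bd[OF b0[OF s, of "fst a"] b1[OF s, of "snd a"]] mult_bd[OF b2[OF s, of "fst a"] b0[OF s, of "snd a"]]
      mult_bd[OF b0[OF s, of "fst a"] b2[OF s, of "snd a"]] mult_bd[OF b1[OF s, of "fst a"] b1[OF s, of "snd a"]]
    show "\<bar>W s a\<bar> \<le> 16" "\<bar>W1 s a\<bar> \<le> 16" "\<bar>W2 s a\<bar> \<le> 16"
      using m unfolding W_def W1_def W2_def by linarith+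
  qed
  have eq: "(\<lambda>c. pair_gen (W (t - s)) c - W1 (t - s) c) = product_gradient (t - s)" if s: "s \<in> {0..t}" for s
  proof
    fix c :: "int \<times> int"
    obtain x y where c: "c = (x, y)" by force
    have "pair_gen (W (t - s)) (x, y) = W1 (t - s) (x, y)
       + (\<Sum>b\<in>pair_bonds (x, y). (crossing_prob (t - s) (b + 1) - crossing_prob (t - s) b)\<^sup>2 * bond_form b (x, y)) / 2"
      unfolding W_def[abs_def] pair_gen_product by (simp add: W1_def crossing_drift_def)
    also have "\<dots> = W1 (t - s) (x, y) + product_gradient (t - s) (x, y)"
      using s by (simp add: crossing_prob_diff product_gradient_def)
    finally show "pair_gen (W (t - s)) c - W1 (t - s) c = product_gradient (t - s) c" by (simp add: c)
  qed
  have D1: "continuous_on {0..t} (\<lambda>s. pair_sg s (\<lambda>c. pair_gen (W (t - s)) c - W1 (t - s) c) a)"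
    by (rule pair_sg_duhamel(1)[OF t, where W=W and ?W1.0=W1 and ?W2.0=W2 and K=16]) (rule dW dW1 bW, assumption)+
  have D2: "((\<lambda>s. pair_sg s (\<lambda>c. pair_gen (W (t - s)) c - W1 (t - s) c) a) has_integral (pair_sg t (W 0) a - W t a)) {0..t}"
    by (rule pair_sg_duhamel(2)[OF t, where W=W and ?W1.0=W1 and ?W2.0=W2 and K=16]) (rule dW dW1 bW, assumption)+
  show "continuous_on {0..t} (\<lambda>s. pair_sg s (product_gradient (t - s)) a)"
    using D1 by (rule continuous_on_cong[THEN iffD1, rotated 2]) (rule refl, simp only: eq)
  have W0: "W 0 = both_nonneg"
    by (auto simp: W_def crossing_prob_0 both_nonneg_def)
  show "((\<lambda>s. pair_sg s (product_gradient (t - s)) a) has_integral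
       (pair_sg t both_nonneg a - crossing_prob t (fst a) * crossing_prob t (snd a))) {0..t}"
    using D2 unfolding W0 W_def[of t] by (rule has_integral_eq[rotated]) (simp add: eq)
qed

lemma heat_kernel_square_shift:
  assumes "0 \<le> u"
  shows "integrable (counting) (\<lambda>b. (heat_kernel u (b + 1))\<^sup>2)"
    and "(\<integral>b. (heat_kernel u (b + 1))\<^sup>2 \<partial>counting) = heat_kernel (2 * u) 0"
proof -
  have b: "bij_betw (\<lambda>b :: int. b + 1) UNIV UNIV"
    by (rule bij_betw_byWitness[where f'="\<lambda>b. b - 1"]) auto
  show "integrable (counting) (\<lambda>b. (heat_kernel u (b + 1))\<^sup>2)"
    using integrable_bij_count_space[OF b, of "\<lambda>z. (heat_kernel u z)\<^sup>2"] heat_kernel_square(1)[OF assms] by simp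
  show "(\<integral>b. (heat_kernel u (b + 1))\<^sup>2 \<partial>counting) = heat_kernel (2 * u) 0"
    using integral_bij_count_space[OF b, of "\<lambda>z. (heat_kernel u z)\<^sup>2"] heat_kernel_square(2)[OF assms] by simp
qed

text \<open>Fubini between bonds and pairs. For a fixed bond only four pairs matter and give the
  mixed second difference of \<open>G\<close>; for a fixed pair only finitely many bonds matter.
  Summability of the squared kernel gives absolute convergence.\<close>

lemma product_gradient_integral:
  assumes u: "0 \<le> u" and G: "\<And>c. \<bar>G c\<bar> \<le> K"
  shows "integrable (counting) (\<lambda>c. product_gradient u c * G c)"
    and "(\<integral>c. product_gradient u c * G c \<partial>counting) =
      (\<integral>b. (heat_kernel u (b + 1))\<^sup>2 * (G (b, b) + G (b + 1, b + 1) - G (b, b + 1) - G (b + 1, b)) \<partial>counting) / 2"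
proof -
  interpret P: pair_sigma_finite "count_space (UNIV :: int set)" "count_space (UNIV :: (int \<times> int) set)"
    by (rule pair_sigma_finite_count_space)
  let ?q = "\<lambda>b. (heat_kernel u (b + 1))\<^sup>2"
  define f where "f = (\<lambda>(b, c). ?q b * (bond_form b c * G c))"
  have K: "0 \<le> K" by (rule order_trans[OF abs_ge_zero G[of "(0, 0)"]])
  have fi: "integrable (counting \<Otimes>\<^sub>M counting) f"
  proof (rule P.Fubini_integrable)
    show "f \<in> borel_measurable (counting \<Otimes>\<^sub>M counting)"
      by (rule borel_measurable_pair_count) simp
    have "(\<integral>c. norm (f (b, c)) \<partial>counting) = ?q b * (\<bar>G (b, b)\<bar> + \<bar>G (b + 1, b + 1)\<bar> + \<bar>G (b, b + 1)\<bar> + \<bar>G (b + 1, b)\<bar>)" for b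
      using bond_form_integral(3)[of b G] by (simp add: f_def abs_mult)
    moreover have "integrable (counting) (\<lambda>b. ?q b * (\<bar>G (b, b)\<bar> + \<bar>G (b + 1, b + 1)\<bar> + \<bar>G (b, b + 1)\<bar> + \<bar>G (b + 1, b)\<bar>))"
    proof (rule Bochner_Integration.integrable_bound)
      show "integrable (counting) (\<lambda>b. ?q b * (4 * K))"
        by (intro integrable_mult_left heat_kernel_square_shift u)
      have "\<bar>G (b, b)\<bar> + \<bar>G (b + 1, b + 1)\<bar> + \<bar>G (b, b + 1)\<bar> + \<bar>G (b + 1, b)\<bar> \<le> 4 * K" for b
        using G[of "(b, b)"] G[of "(b + 1, b + 1)"] G[of "(b, b + 1)"] G[of "(b + 1, b)"] by linarith
      then have "?q b * (\<bar>G (b, b)\<bar> + \<bar>G (b + 1, b + 1)\<bar> + \<bar>G (b, b + 1)\<bar> + \<bar>G (b + 1, b)\<bar>) \<le> ?q b * (4 * K)" for b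
        by (rule mult_left_mono) simp
      then show "AE b in counting. norm (?q b * (\<bar>G (b, b)\<bar> + \<bar>G (b + 1, b + 1)\<bar> + \<bar>G (b, b + 1)\<bar> + \<bar>G (b + 1, b)\<bar>)) \<le> norm (?q b * (4 * K))"
        using K by (intro AE_I2) (simp add: abs_mult)
    qed simp
    ultimately show "integrable (counting) (\<lambda>b. \<integral>c. norm (f (b, c)) \<partial>counting)" by simp
    show "AE b in counting. integrable (counting) (\<lambda>c. f (b, c))"
      unfolding f_def case_prod_conv by (intro AE_I2 integrable_mult_right bond_form_integral)
  qed
  have inner: "(\<integral>b. f (b, c) \<partial>counting) = 2 * (product_gradient u c * G c)" for c
  proof -
    have "(\<integral>b. f (b, c) \<partial>counting) = (\<Sum>b | b \<in> UNIV \<and> f (b, c) \<noteq> 0. f (b, c))"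
      by (rule lebesgue_integral_count_space_finite_support, rule finite_subset[of _ "pair_bonds c"])
         (auto simp: f_def bond_form_eq_0 intro: ccontr)
    also have "\<dots> = (\<Sum>b\<in>pair_bonds c. f (b, c))"
      by (rule sum.mono_neutral_left) (auto simp: f_def bond_form_eq_0 intro: ccontr)
    also have "\<dots> = 2 * (product_gradient u c * G c)"
      by (simp add: f_def product_gradient_def sum_distrib_right mult.assoc)
    finally show ?thesis .
  qed
  have fi': "integrable (counting \<Otimes>\<^sub>M counting) (case_prod (\<lambda>x y. f (x, y)))" using fi by simp
  have "integrable (counting) (\<lambda>c. 2 * (product_gradient u c * G c))"
    using P.integrable_snd[OF fi'] by (simp add: inner)
  from integrable_mult_right[OF this, of "1/2"]
  show "integrable (counting) (\<lambda>c. product_gradient u c * G c)" by simp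
  have "(\<integral>c. 2 * (product_gradient u c * G c) \<partial>counting) = (\<integral>b. (\<integral>c. f (b, c) \<partial>counting) \<partial>counting)"
    using P.Fubini_integral[OF fi'] by (simp only: inner)
  also have "\<dots> = (\<integral>b. ?q b * (G (b, b) + G (b + 1, b + 1) - G (b, b + 1) - G (b + 1, b)) \<partial>counting)"
    using bond_form_integral(2)[of _ G] by (simp add: f_def)
  finally show "(\<integral>c. product_gradient u c * G c \<partial>counting) =
      (\<integral>b. ?q b * (G (b, b) + G (b + 1, b + 1) - G (b, b + 1) - G (b + 1, b)) \<partial>counting) / 2" by simp
qed

text \<open>Testing against the sign: the mixed second difference is then at most 4, the squared
  kernels sum to at most 1, and the factor 1/2 of the definition leaves 2.\<close>

lemma product_gradient_abs:
  assumes u: "0 \<le> u"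
  shows "integrable (counting) (\<lambda>c. \<bar>product_gradient u c\<bar>)"
    and "(\<integral>c. \<bar>product_gradient u c\<bar> \<partial>counting) \<le> 2"
proof -
  define G where "G c = sgn (product_gradient u c)" for c
  have G: "\<bar>G c\<bar> \<le> 1" for c by (simp add: G_def sgn_if)
  have eq: "product_gradient u c * G c = \<bar>product_gradient u c\<bar>" for c by (simp add: G_def sgn_if)
  note * = product_gradient_integral[where G=G and K=1, OF u G]
  show "integrable (counting) (\<lambda>c. \<bar>product_gradient u c\<bar>)" using *(1) by (simp add: eq)
  let ?q = "\<lambda>b. (heat_kernel u (b + 1))\<^sup>2"
  let ?g = "\<lambda>b. G (b, b) + G (b + 1, b + 1) - G (b, b + 1) - G (b + 1, b)"
  have g: "\<bar>?g b\<bar> \<le> 4" for b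
    using G[of "(b, b)"] G[of "(b + 1, b + 1)"] G[of "(b, b + 1)"] G[of "(b + 1, b)"] by linarith
  have i4: "integrable (counting) (\<lambda>b. ?q b * 4)"
    by (intro integrable_mult_left heat_kernel_square_shift u)
  have "(\<integral>b. ?q b * ?g b \<partial>counting) \<le> (\<integral>b. ?q b * 4 \<partial>counting)"
  proof (rule integral_mono[OF _ i4])
    show "integrable (counting) (\<lambda>b. ?q b * ?g b)"
    proof (rule Bochner_Integration.integrable_bound[OF i4])
      show "AE b in counting. norm (?q b * ?g b) \<le> norm (?q b * 4)"
        using g by (intro AE_I2) (simp add: abs_mult mult_left_mono)
    qed simp
    show "?q b * ?g b \<le> ?q b * 4" for b
      using g[of b] by (intro mult_left_mono) auto
  qed
  also have "\<dots> = 4 * heat_kernel (2 * u) 0"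
    using heat_kernel_square_shift(2)[OF u] by simp
  also have "\<dots> \<le> 4" using heat_kernel_bound[of "2 * u" 0] u by auto
  finally show "(\<integral>c. \<bar>product_gradient u c\<bar> \<partial>counting) \<le> 2"
    using *(2) by (simp add: eq)
qed

lemma both_even_bound: "\<bar>both_even a\<bar> \<le> 1"
  by (simp add: both_even_def)

text \<open>In the mixed second difference the constant and the one-particle terms \<open>C\<close>
  cancel, so translation effects of the alternating configuration disappear. What remains is (2 - 2
  * \<open>alt_heat s 1\<close>) / 4, and \<open>alt_heat s 1\<close> is minus the return
  probability at time 2 s.\<close>

lemma pair_sg_both_even:
  assumes s: "0 \<le> s"
  defines "G \<equiv> pair_sg s both_even"
  shows "G (b, b) + G (b + 1, b + 1) - G (b, b + 1) - G (b + 1, b) = (1 + heat_kernel (2 * s) 0) / 2"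
proof -
  let ?\<chi> = "\<lambda>x :: int. (- 1 :: real) ^ nat \<bar>x\<bar>"
  have \<chi>: "\<bar>?\<chi> x\<bar> \<le> 1" for x by simp
  have tri2: "\<bar>1 + p\<bar> \<le> 2" if "\<bar>p\<bar> \<le> 1" for p :: real
    using that by linarith
  have tri3: "\<bar>1 + p + q\<bar> \<le> 3" if "\<bar>p\<bar> \<le> 1" "\<bar>q\<bar> \<le> 1" for p q :: real
    using that by linarith
  have tri4: "\<bar>1 + p + q + r\<bar> \<le> 4" if "\<bar>p\<bar> \<le> 1" "\<bar>q\<bar> \<le> 1" "\<bar>r\<bar> \<le> 1" for p q r :: real
    using that by linarith
  define C where "C x = pair_sg s (\<lambda>a. ?\<chi> (fst a)) (x, x)" for x
  define \<Psi> where "\<Psi> = pair_sg s (\<lambda>a. ?\<chi> (fst a - snd a))"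
  have one: "pair_sg s (\<lambda>a. 1) a = 1" for a
    using expectation_stirring_pair[where F="\<lambda>_. 1" and K=1 and x="fst a" and y="snd a", OF s] by (simp add: prob_space)
  have G: "G (x, y) = 1 / 4 * (1 + C x + C y + \<Psi> (x, y))" for x y
  proof -
    have "G (x, y) = 1 / 4 * pair_sg s (\<lambda>a. 1 + ?\<chi> (fst a) + ?\<chi> (snd a) + ?\<chi> (fst a - snd a)) (x, y)"
      unfolding G_def both_even_decomp[abs_def]
    proof (rule pair_sg_cmult[where K=4])
      fix a :: "int \<times> int"
      show "\<bar>1 + ?\<chi> (fst a) + ?\<chi> (snd a) + ?\<chi> (fst a - snd a)\<bar> \<le> 4"
        by (intro tri4 \<chi>)
    qed
    also have "pair_sg s (\<lambda>a. 1 + ?\<chi> (fst a) + ?\<chi> (snd a) + ?\<chi> (fst a - snd a)) (x, y) =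
        pair_sg s (\<lambda>a. 1 + ?\<chi> (fst a) + ?\<chi> (snd a)) (x, y) + \<Psi> (x, y)"
      unfolding \<Psi>_def
    proof (rule pair_sg_add[where K=3 and K'=1])
      fix a :: "int \<times> int"
      show "\<bar>1 + ?\<chi> (fst a) + ?\<chi> (snd a)\<bar> \<le> 3"
        by (intro tri3 \<chi>)
    qed (rule \<chi>)
    also have "pair_sg s (\<lambda>a. 1 + ?\<chi> (fst a) + ?\<chi> (snd a)) (x, y) =
        pair_sg s (\<lambda>a. 1 + ?\<chi> (fst a)) (x, y) + pair_sg s (\<lambda>a. ?\<chi> (snd a)) (x, y)"
    proof (rule pair_sg_add[where K=2 and K'=1])
      fix a :: "int \<times> int"
      show "\<bar>1 + ?\<chi> (fst a)\<bar> \<le> 2" by (intro tri2 \<chi>)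
    qed (rule \<chi>)
    also have "pair_sg s (\<lambda>a. 1 + ?\<chi> (fst a)) (x, y) = 1 + pair_sg s (\<lambda>a. ?\<chi> (fst a)) (x, y)"
      by (subst pair_sg_add[where K=1 and K'=1]) (simp_all add: one)
    also have "pair_sg s (\<lambda>a. ?\<chi> (snd a)) (x, y) = C y"
      unfolding C_def by (rule pair_sg_marginal_snd[OF s \<chi>])
    also have "pair_sg s (\<lambda>a. ?\<chi> (fst a)) (x, y) = C x"
      unfolding C_def by (rule pair_sg_marginal_fst[OF s \<chi>])
    finally show ?thesis .
  qed
  show ?thesis
    unfolding G by (simp add: \<Psi>_def pair_sg_alternating[OF s] field_simps)
qed

text \<open>Self-adjointness of the semigroup for the counting measure: the sum over starting pairs
  is taken inside and becomes the evolution of \<open>both_even\<close>. The bound on the absolute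
  sum does not depend on time and licenses the later exchange with the time integral.\<close>

lemma even_sum_product_gradient:
  assumes s: "0 \<le> s" and u: "0 \<le> u"
  shows "integrable (counting) (\<lambda>a. both_even a * pair_sg s (product_gradient u) a)"
    and "(\<integral>a. both_even a * pair_sg s (product_gradient u) a \<partial>counting) =
       1 / 4 * (heat_kernel (2 * u) 0 * (1 + heat_kernel (2 * s) 0))"
    and "(\<integral>a. \<bar>both_even a * pair_sg s (product_gradient u) a\<bar> \<partial>counting) \<le> 2"
proof -
  interpret P: pair_sigma_finite "count_space (UNIV :: (int \<times> int) set)" "count_space (UNIV :: (int \<times> int) set)"
    by (rule pair_sigma_finite_count_space)
  define f where "f = (\<lambda>(c, a). product_gradient u c * (pair_kernel s c a * both_even a))"
  note ker = pair_sg_integral[where F=both_even and K=1, OF s both_even_bound]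
  have absf: "\<bar>f (c, a)\<bar> = \<bar>product_gradient u c\<bar> * (pair_kernel s c a * both_even a)" for c a
    using pair_kernel_nonneg[OF s, of c a] by (simp add: f_def abs_mult both_even_def)
  have in_abs: "(\<integral>a. \<bar>f (c, a)\<bar> \<partial>counting) = \<bar>product_gradient u c\<bar> * pair_sg s both_even c" for c
    unfolding absf by (simp add: ker(2))
  have bnd: "\<bar>pair_sg s both_even c\<bar> \<le> 1" for c
    by (rule pair_sg_contraction[OF s both_even_bound])
  have iabs: "integrable (counting) (\<lambda>c. \<bar>product_gradient u c\<bar> * pair_sg s both_even c)"
  proof (rule Bochner_Integration.integrable_bound[OF product_gradient_abs(1)[OF u]])
    show "AE c in counting. norm (\<bar>product_gradient u c\<bar> * pair_sg s both_even c) \<le> norm \<bar>product_gradient u c\<bar>"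
      using mult_left_mono[OF bnd, of "\<bar>product_gradient u _\<bar>"] by (intro AE_I2) (simp add: abs_mult)
  qed simp
  have fi: "integrable (counting \<Otimes>\<^sub>M counting) f"
  proof (rule P.Fubini_integrable)
    show "f \<in> borel_measurable (counting \<Otimes>\<^sub>M counting)"
      by (rule borel_measurable_pair_count) simp
    show "integrable (counting) (\<lambda>c. \<integral>a. norm (f (c, a)) \<partial>counting)"
      using iabs by (simp only: real_norm_def in_abs)
    show "AE c in counting. integrable (counting) (\<lambda>a. f (c, a))"
      unfolding f_def case_prod_conv by (intro AE_I2 integrable_mult_right ker)
  qed
  have fi': "integrable (counting \<Otimes>\<^sub>M counting) (case_prod (\<lambda>x y. f (x, y)))" using fi by simp
  have fa': "integrable (counting \<Otimes>\<^sub>M counting) (case_prod (\<lambda>x y. \<bar>f (x, y)\<bar>))"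
    using integrable_abs[OF fi] by (simp add: case_prod_beta')
  have inner: "(\<integral>c. f (c, a) \<partial>counting) = both_even a * pair_sg s (product_gradient u) a" for a
    unfolding pair_sg_integral(2)[where F="product_gradient u" and K=2 and a=a, OF s product_gradient_bound[OF u]]
      f_def case_prod_conv pair_kernel_sym[of s _ a]
    by (subst integral_mult_right_zero[symmetric]) (simp add: mult_ac)
  show "integrable (counting) (\<lambda>a. both_even a * pair_sg s (product_gradient u) a)"
    using P.integrable_snd[OF fi'] by (simp only: inner)
  have "(\<integral>a. both_even a * pair_sg s (product_gradient u) a \<partial>counting) = (\<integral>c. (\<integral>a. f (c, a) \<partial>counting) \<partial>counting)"
    using P.Fubini_integral[OF fi'] by (simp only: inner)
  also have "\<dots> = (\<integral>c. product_gradient u c * pair_sg s both_even c \<partial>counting)"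
    by (simp add: f_def ker(2))
  also have "\<dots> = (\<integral>b. (heat_kernel u (b + 1))\<^sup>2 * ((1 + heat_kernel (2 * s) 0) / 2) \<partial>counting) / 2"
    using product_gradient_integral(2)[where G="pair_sg s both_even" and K=1, OF u bnd] by (simp only: pair_sg_both_even[OF s])
  also have "\<dots> = 1 / 4 * (heat_kernel (2 * u) 0 * (1 + heat_kernel (2 * s) 0))"
    using heat_kernel_square_shift(2)[OF u] by simp
  finally show "(\<integral>a. both_even a * pair_sg s (product_gradient u) a \<partial>counting) =
       1 / 4 * (heat_kernel (2 * u) 0 * (1 + heat_kernel (2 * s) 0))" .
  have "(\<integral>a. \<bar>both_even a * pair_sg s (product_gradient u) a\<bar> \<partial>counting) \<le> (\<integral>a. (\<integral>c. \<bar>f (c, a)\<bar> \<partial>counting) \<partial>counting)"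
  proof (rule integral_mono)
    show "integrable (counting) (\<lambda>a. \<bar>both_even a * pair_sg s (product_gradient u) a\<bar>)"
      using P.integrable_snd[OF fi'] by (intro integrable_abs) (simp only: inner)
    show "integrable (counting) (\<lambda>a. \<integral>c. \<bar>f (c, a)\<bar> \<partial>counting)"
      using P.integrable_snd[OF fa'] by simp
    show "\<bar>both_even a * pair_sg s (product_gradient u) a\<bar> \<le> (\<integral>c. \<bar>f (c, a)\<bar> \<partial>counting)" for a
      unfolding inner[symmetric] by (rule integral_abs_bound)
  qed
  also have "\<dots> = (\<integral>c. (\<integral>a. \<bar>f (c, a)\<bar> \<partial>counting) \<partial>counting)"
    using P.Fubini_integral[OF fa'] by simp
  also have "\<dots> \<le> (\<integral>c. \<bar>product_gradient u c\<bar> \<partial>counting)"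
    unfolding in_abs
  proof (rule integral_mono[OF iabs product_gradient_abs(1)[OF u]])
    show "\<bar>product_gradient u c\<bar> * pair_sg s both_even c \<le> \<bar>product_gradient u c\<bar>" for c
      using bnd[of c] by (intro mult_left_le) auto
  qed
  also have "\<dots> \<le> 2" by (rule product_gradient_abs(2)[OF u])
  finally show "(\<integral>a. \<bar>both_even a * pair_sg s (product_gradient u) a\<bar> \<partial>counting) \<le> 2" .
qed

text \<open>The time integral from \<open>crossing_covariance\<close> is exchanged with the sum over
  starting pairs, and the inner sum is then explicit.\<close>

lemma even_sum_covariance:
  assumes t: "0 \<le> t"
  shows "(\<integral>a. both_even a * (pair_sg t both_nonneg a
       - crossing_prob t (fst a) * crossing_prob t (snd a)) \<partial>counting) =
     flux_variance t"
proof -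
  interpret C: sigma_finite_measure "count_space (UNIV :: (int \<times> int) set)"
    by (rule sigma_finite_measure_count_space_countable) simp
  interpret P: pair_sigma_finite "lborel :: real measure" "count_space (UNIV :: (int \<times> int) set)" ..
  define \<psi> where "\<psi> s a = both_even a * pair_sg s (product_gradient (t - s)) a" for s a
  define f where "f = (\<lambda>(s, a). indicator {0..t} s * \<psi> s a)"
  have set_int: "set_integrable lborel {0..t} (\<lambda>s. \<psi> s a)" for a
    unfolding \<psi>_def by (intro borel_integrable_atLeastAtMost' continuous_on_mult continuous_on_const crossing_covariance t)
  have inner: "(\<integral>s. f (s, a) \<partial>lborel) = both_even a * (pair_sg t both_nonneg a
       - crossing_prob t (fst a) * crossing_prob t (snd a))" for a
  proof -
    have "(\<integral>s. f (s, a) \<partial>lborel) = integral {0..t} (\<lambda>s. \<psi> s a)"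
      using set_borel_integral_eq_integral(2)[OF set_int[of a]] by (simp add: f_def set_lebesgue_integral_def)
    then show ?thesis
      by (simp add: \<psi>_def integral_unique[OF crossing_covariance(2)[OF t]])
  qed
  have meas: "f \<in> borel_measurable (lborel \<Otimes>\<^sub>M counting)"
  proof (rule borel_measurable_pair_count)
    show "(\<lambda>s. f (s, a)) \<in> borel_measurable lborel" for a
      using set_int[of a] by (auto simp: f_def set_integrable_def)
  qed
  have fi: "integrable (lborel \<Otimes>\<^sub>M counting) f"
  proof (rule P.Fubini_integrable[OF meas])
    show "AE s in lborel. integrable (counting) (\<lambda>a. f (s, a))"
    proof (rule AE_I2)
      fix s :: real
      show "integrable (counting) (\<lambda>a. f (s, a))"
      proof (cases "s \<in> {0..t}")
        case True
        then show ?thesis using even_sum_product_gradient(1)[of s "t - s"] by (simp add: f_def \<psi>_def)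
      qed (simp add: f_def)
    qed
    show "integrable lborel (\<lambda>s. \<integral>a. norm (f (s, a)) \<partial>counting)"
    proof (rule Bochner_Integration.integrable_bound)
      show "integrable lborel (\<lambda>s. indicator {0..t} s * (2 :: real))"
        by (intro integrable_mult_left integrable_real_indicator) (simp_all add: t)
      have "(\<lambda>s. \<integral>a. (\<lambda>(s, a). norm (f (s, a))) (s, a) \<partial>counting) \<in> borel_measurable lborel"
        using meas by (intro C.borel_measurable_lebesgue_integral) (simp add: case_prod_beta')
      then show "(\<lambda>s. \<integral>a. norm (f (s, a)) \<partial>counting) \<in> borel_measurable lborel" by simp
      show "AE s in lborel. norm (\<integral>a. norm (f (s, a)) \<partial>counting) \<le> norm (indicator {0..t} s * (2 :: real))"
      proof (rule AE_I2)
        fix s :: real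
        show "norm (\<integral>a. norm (f (s, a)) \<partial>counting) \<le> norm (indicator {0..t} s * (2 :: real))"
        proof (cases "s \<in> {0..t}")
          case True
          have "0 \<le> (\<integral>a. norm (f (s, a)) \<partial>counting)" by (rule integral_nonneg_AE) simp
          then show ?thesis using even_sum_product_gradient(3)[of s "t - s"] True by (simp add: f_def \<psi>_def)
        qed (simp add: f_def)
      qed
    qed
  qed
  have fi': "integrable (lborel \<Otimes>\<^sub>M counting) (case_prod (\<lambda>x y. f (x, y)))" using fi by simp
  have "(\<integral>a. both_even a * (pair_sg t both_nonneg a
       - crossing_prob t (fst a) * crossing_prob t (snd a)) \<partial>counting) = (\<integral>s. (\<integral>a. f (s, a) \<partial>counting) \<partial>lborel)"
    using P.Fubini_integral[OF fi'] by (simp only: inner)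
  also have "\<dots> = (\<integral>s. indicator {0..t} s * (1 / 4 * (heat_kernel (2 * (t - s)) 0 * (1 + heat_kernel (2 * s) 0))) \<partial>lborel)"
  proof (rule Bochner_Integration.integral_cong[OF refl])
    fix s :: real
    show "(\<integral>a. f (s, a) \<partial>counting) = indicator {0..t} s * (1 / 4 * (heat_kernel (2 * (t - s)) 0 * (1 + heat_kernel (2 * s) 0)))"
    proof (cases "s \<in> {0..t}")
      case True
      then show ?thesis using even_sum_product_gradient(2)[of s "t - s"] by (simp add: f_def \<psi>_def)
    qed (simp add: f_def)
  qed
  also have "\<dots> = integral {0..t} (\<lambda>s. 1 / 4 * (heat_kernel (2 * (t - s)) 0 * (1 + heat_kernel (2 * s) 0)))"
  proof -
    have "continuous_on {0..t} (\<lambda>s. 1 / 4 * (heat_kernel (2 * (t - s)) 0 * (1 + heat_kernel (2 * s) 0)))"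
      by (intro continuous_intros continuous_on_compose2[OF heat_kernel_continuous[of UNIV]]) auto
    from set_borel_integral_eq_integral(2)[OF borel_integrable_atLeastAtMost'[OF this]]
    show ?thesis by (simp add: set_lebesgue_integral_def)
  qed
  also have "\<dots> = flux_variance t"
    unfolding flux_variance_def by (rule integral_mult_right)
  finally show ?thesis .
qed

end

section \<open>The variance of the flux\<close>

text \<open>In the non-summable case both sides take the default value 0.\<close>

lemma infsum_eq_count_space_integral:
  fixes f :: "'b \<Rightarrow> real"
  shows "infsum f UNIV = (\<integral>x. f x \<partial>counting)"
proof (cases "integrable (counting) f")
  case True
  then have "Infinite_Set_Sum.abs_summable_on f UNIV" by (simp add: Infinite_Set_Sum.abs_summable_on_def)
  from infsetsum_infsum[OF this] show ?thesis by (simp add: infsetsum_def)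
next
  case False
  then have "\<not> f summable_on UNIV"
    using summable_on_iff_abs_summable_on_real[of f UNIV] abs_summable_equivalent[of f UNIV]
    by (metis Infinite_Set_Sum.abs_summable_on_def)
  then show ?thesis using False by (simp add: infsum_not_exists not_integrable_integral_eq)
qed

lemma integrable_exp_abs_int:
  assumes "0 < c"
  shows "integrable (counting) (\<lambda>x :: int. exp (- c * \<bar>real_of_int x\<bar>))"
proof -
  let ?f = "\<lambda>x :: int. exp (- c * \<bar>real_of_int x\<bar>)"
  have g: "summable (\<lambda>n. norm (exp (- c) ^ n))"
    using assms by (simp add: norm_power summable_geometric)
  have eq: "exp (- c) ^ n = exp (- c * real n)" for n
    by (simp add: exp_of_nat_mult[symmetric] mult.commute)
  have nat: "(\<lambda>n. exp (- c * real n)) summable_on UNIV"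
    using norm_summable_imp_summable_on[OF g] by (simp only: eq)
  have "?f summable_on range int"
    using nat by (subst summable_on_reindex) (auto simp: o_def)
  moreover have "?f summable_on range (\<lambda>n. - int n)"
    using nat by (subst summable_on_reindex) (auto simp: o_def inj_on_def)
  ultimately have "?f summable_on range int \<union> range (\<lambda>n. - int n)"
    by (rule summable_on_union)
  moreover have "range int \<union> range (\<lambda>n. - int n) = UNIV"
    by (auto simp: image_iff intro: int_cases2)
  ultimately have "(\<lambda>x. norm (?f x)) summable_on UNIV"
    by simp
  then have "Infinite_Set_Sum.abs_summable_on ?f UNIV"
    by (simp only: abs_summable_equivalent)
  then show ?thesis by (simp add: Infinite_Set_Sum.abs_summable_on_def)
qed

lemma integral_count_space_product:
  fixes g :: "'b :: countable \<Rightarrow> real" and h :: "'c :: countable \<Rightarrow> real"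
  assumes g: "integrable (counting) g" and h: "integrable (counting) h"
  shows "integrable (counting) (\<lambda>c. g (fst c) * h (snd c))"
    and "(\<integral>c. g (fst c) * h (snd c) \<partial>counting) = (\<integral>x. g x \<partial>counting) * (\<integral>y. h y \<partial>counting)"
proof -
  interpret P: pair_sigma_finite "count_space (UNIV :: 'b set)" "count_space (UNIV :: 'c set)"
    by (rule pair_sigma_finite_count_space)
  have eq: "count_space (UNIV :: 'b set) \<Otimes>\<^sub>M count_space (UNIV :: 'c set) = counting"
    by (simp add: pair_measure_countable)
  have "integrable (count_space (UNIV :: 'b set) \<Otimes>\<^sub>M count_space (UNIV :: 'c set)) (\<lambda>c. g (fst c) * h (snd c))"
  proof (rule P.Fubini_integrable)
    show "(\<lambda>c. g (fst c) * h (snd c)) \<in> borel_measurable (counting \<Otimes>\<^sub>M counting)"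
      unfolding eq by simp
    show "integrable (counting) (\<lambda>x. \<integral>y. norm (g (fst (x, y)) * h (snd (x, y))) \<partial>counting)"
      using g by (simp add: abs_mult)
    show "AE x in counting. integrable (counting) (\<lambda>y. g (fst (x, y)) * h (snd (x, y)))"
      using h by simp
  qed
  from this P.integral_fst'[OF this]
  show "integrable (counting) (\<lambda>c. g (fst c) * h (snd c))"
    and "(\<integral>c. g (fst c) * h (snd c) \<partial>counting) = (\<integral>x. g x \<partial>counting) * (\<integral>y. h y \<partial>counting)"
    unfolding eq by simp_all
qed

text \<open>Fubini for a random series, with a summable bound \<open>w\<close> on the absolute first
  moments.\<close>

lemma (in prob_space) expectation_count_space_integral:
  fixes f :: "'c :: countable \<Rightarrow> 'a \<Rightarrow> real"
  assumes m: "\<And>c. f c \<in> borel_measurable M" and b: "\<And>c. integrable M (f c)"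
    and w: "integrable (counting) w" "\<And>c. expectation (\<lambda>\<omega>. \<bar>f c \<omega>\<bar>) \<le> w c"
  shows "AE \<omega> in M. integrable (counting) (\<lambda>c. f c \<omega>)"
    and "integrable M (\<lambda>\<omega>. \<integral>c. f c \<omega> \<partial>counting)"
    and "expectation (\<lambda>\<omega>. \<integral>c. f c \<omega> \<partial>counting) = (\<integral>c. expectation (f c) \<partial>counting)"
    and "integrable (counting) (\<lambda>c. expectation (f c))"
proof -
  interpret C: sigma_finite_measure "count_space (UNIV :: 'c set)"
    by (rule sigma_finite_measure_count_space_countable) simp
  interpret P: pair_sigma_finite "count_space (UNIV :: 'c set)" M ..
  have int: "integrable (counting \<Otimes>\<^sub>M M) (case_prod f)"
  proof (rule P.Fubini_integrable)
    show "case_prod f \<in> borel_measurable (counting \<Otimes>\<^sub>M M)"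
      using m by (intro measurable_pair_measure_countable1) auto
    show "integrable (counting) (\<lambda>c. \<integral>\<omega>. norm (case_prod f (c, \<omega>)) \<partial>M)"
    proof (rule Bochner_Integration.integrable_bound[OF w(1)])
      show "AE c in counting. norm (\<integral>\<omega>. norm (case_prod f (c, \<omega>)) \<partial>M) \<le> norm (w c)"
      proof (rule AE_I2)
        fix c
        have "0 \<le> expectation (\<lambda>\<omega>. \<bar>f c \<omega>\<bar>)" by (rule integral_nonneg_AE) simp
        then show "norm (\<integral>\<omega>. norm (case_prod f (c, \<omega>)) \<partial>M) \<le> norm (w c)" using w(2)[of c] by simp
      qed
    qed simp
    show "AE c in counting. integrable M (\<lambda>\<omega>. case_prod f (c, \<omega>))" using b by simp
  qed
  show "AE \<omega> in M. integrable (counting) (\<lambda>c. f c \<omega>)"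
    using P.AE_integrable_snd[OF int] .
  show "integrable M (\<lambda>\<omega>. \<integral>c. f c \<omega> \<partial>counting)"
    using P.integrable_snd[OF int] .
  show "expectation (\<lambda>\<omega>. \<integral>c. f c \<omega> \<partial>counting) = (\<integral>c. expectation (f c) \<partial>counting)"
    using P.Fubini_integral[OF int] .
  show "integrable (counting) (\<lambda>c. expectation (f c))"
    using P.integrable_fst[OF int] .
qed

context ssep
begin

text \<open>One formula for both sums of the flux: it is +1 for an even x < 0 that ends in {0..}, -1
  for an even x >= 0 that ends below 0, and 0 otherwise. Subtracting the deterministic indicator
  makes the series converge without affecting covariances.\<close>

definition crossing :: "real \<Rightarrow> int \<Rightarrow> 'a \<Rightarrow> real" where
  "crossing t x \<omega> = of_bool (even x) * (of_bool (0 \<le> X x t \<omega>) - of_bool (0 \<le> x))"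

lemma crossing_measurable: "0 \<le> t \<Longrightarrow> crossing t x \<in> borel_measurable M"
  unfolding crossing_def[abs_def]
  using measurable_compose[OF X_measurable[of t x], of "\<lambda>z. of_bool (even x) * (of_bool (0 \<le> z) - of_bool (0 \<le> x))" borel]
  by simp

lemma crossing_bound: "\<bar>crossing t x \<omega>\<bar> \<le> 1"
  by (simp add: crossing_def)

text \<open>A particle has to travel at least the distance of x from the origin to contribute, so
  \<open>pair_sg_tail\<close> applies.\<close>

lemma expectation_abs_crossing:
  assumes t: "0 \<le> t"
  shows "expectation (\<lambda>\<omega>. \<bar>crossing t x \<omega>\<bar>) \<le> exp (4 * exp 1 * t) * exp (- \<bar>real_of_int x\<bar>)"
proof -
  define F where "F a = (if x < 0 then of_bool (0 \<le> fst a) else of_bool (fst a < 0) :: real)" for a :: "int \<times> int"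
  have F: "\<bar>F a\<bar> \<le> 1" for a by (simp add: F_def)
  have "expectation (\<lambda>\<omega>. \<bar>crossing t x \<omega>\<bar>) \<le> expectation (\<lambda>\<omega>. F (X x t \<omega>, X x t \<omega>))"
  proof (rule integral_mono)
    show "integrable M (\<lambda>\<omega>. \<bar>crossing t x \<omega>\<bar>)"
      by (intro integrable_abs integrable_const_bound[where B=1] crossing_measurable t) (simp_all add: crossing_bound)
    show "integrable M (\<lambda>\<omega>. F (X x t \<omega>, X x t \<omega>))"
      using measurable_compose[OF X_pair_measurable[OF t, of x x], of F borel] F
      by (intro integrable_const_bound[where B=1]) auto
    show "\<bar>crossing t x \<omega>\<bar> \<le> F (X x t \<omega>, X x t \<omega>)" for \<omega>
      by (auto simp: crossing_def F_def)
  qed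
  also have "\<dots> = pair_sg t F (x, x)"
    by (rule expectation_stirring_pair[OF t F])
  finally have "expectation (\<lambda>\<omega>. \<bar>crossing t x \<omega>\<bar>) \<le> pair_sg t F (x, x)" .
  moreover have "\<bar>pair_sg t F (x, x)\<bar> \<le> exp (4 * exp 1 * t) * exp (- real (nat \<bar>x\<bar>))"
    by (rule pair_sg_tail[OF F t]) (auto simp: F_def)
  moreover have "real (nat \<bar>x\<bar>) = \<bar>real_of_int x\<bar>" by simp
  ultimately show ?thesis by (simp only:)
qed

lemma flux_eq_crossings:
  "integrated_flux (\<lambda>x. even x) X t \<omega> =
     (\<integral>x. of_bool (x < 0 \<and> even x \<and> 0 \<le> X x t \<omega>) \<partial>counting) -
     (\<integral>x. of_bool (0 \<le> x \<and> even x \<and> X x t \<omega> < 0) \<partial>counting)"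
proof -
  have "(\<Sum>\<^sub>\<infinity>x\<in>{..<0}. of_bool (even x) * of_bool (X x t \<omega> \<ge> 0)) =
      (\<Sum>\<^sub>\<infinity>x. of_bool (x < 0 \<and> even x \<and> 0 \<le> X x t \<omega>) :: real)"
    by (rule infsum_cong_neutral) auto
  moreover have "(\<Sum>\<^sub>\<infinity>x\<in>{0..}. of_bool (even x) * of_bool (X x t \<omega> < 0)) =
      (\<Sum>\<^sub>\<infinity>x. of_bool (0 \<le> x \<and> even x \<and> X x t \<omega> < 0) :: real)"
    by (rule infsum_cong_neutral) auto
  ultimately show ?thesis by (simp only: integrated_flux_def infsum_eq_count_space_integral)
qed

text \<open>Written as counting-measure integrals, the two sums are measurable everywhere, including
  where they might diverge.\<close>

lemma flux_measurable:
  assumes t: "0 \<le> t"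
  shows "integrated_flux (\<lambda>x. even x) X t \<in> borel_measurable M"
proof -
  interpret C: sigma_finite_measure "count_space (UNIV :: int set)"
    by (rule sigma_finite_measure_count_space_countable) simp
  have "(\<lambda>\<omega>. \<integral>x. (of_bool (Q x (X x t \<omega>)) :: real) \<partial>counting) \<in> borel_measurable M" for Q
  proof -
    have "case_prod (\<lambda>\<omega> x. of_bool (Q x (X x t \<omega>)) :: real) \<in> borel_measurable (M \<Otimes>\<^sub>M counting)"
    proof (rule borel_measurable_pair_count)
      fix x
      show "(\<lambda>\<omega>. case_prod (\<lambda>\<omega> x. of_bool (Q x (X x t \<omega>)) :: real) (\<omega>, x)) \<in> borel_measurable M"
        using measurable_compose[OF X_measurable[OF t, of x], of "\<lambda>z. of_bool (Q x z) :: real" borel] by simp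
    qed
    then show ?thesis by (rule C.borel_measurable_lebesgue_integral)
  qed
  from this[of "\<lambda>x z. x < 0 \<and> even x \<and> 0 \<le> z"] this[of "\<lambda>x z. 0 \<le> x \<and> even x \<and> z < 0"]
  show ?thesis unfolding flux_eq_crossings[abs_def] by (rule borel_measurable_diff)
qed

lemma flux_eq_integral_crossing:
  assumes "integrable (counting) (\<lambda>x. crossing t x \<omega>)"
  shows "integrated_flux (\<lambda>x. even x) X t \<omega> = (\<integral>x. crossing t x \<omega> \<partial>counting)"
proof -
  have "integrable (counting) (\<lambda>x. of_bool (x < 0 \<and> even x \<and> 0 \<le> X x t \<omega>) :: real)"
    by (rule Bochner_Integration.integrable_bound[OF assms]) (auto simp: crossing_def)
  moreover have "integrable (counting) (\<lambda>x. of_bool (0 \<le> x \<and> even x \<and> X x t \<omega> < 0) :: real)"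
    by (rule Bochner_Integration.integrable_bound[OF assms]) (auto simp: crossing_def)
  ultimately have "integrated_flux (\<lambda>x. even x) X t \<omega> =
     (\<integral>x. of_bool (x < 0 \<and> even x \<and> 0 \<le> X x t \<omega>) - of_bool (0 \<le> x \<and> even x \<and> X x t \<omega> < 0) \<partial>counting)"
    unfolding flux_eq_crossings by (rule Bochner_Integration.integral_diff[symmetric])
  also have "\<dots> = (\<integral>x. crossing t x \<omega> \<partial>counting)"
    by (intro Bochner_Integration.integral_cong refl) (auto simp: crossing_def)
  finally show ?thesis .
qed

text \<open>The deterministic part of \<open>crossing\<close> drops out of the covariance, leaving
  that of the indicators of ending in {0..}.\<close>

lemma crossing_product_covariance:
  assumes t: "0 \<le> t"
  shows "expectation (\<lambda>\<omega>. crossing t x \<omega> * crossing t y \<omega>) - expectation (crossing t x) * expectation (crossing t y) =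
    both_even (x, y) * (pair_sg t both_nonneg (x, y) - crossing_prob t x * crossing_prob t y)"
proof -
  define I where "I x \<omega> = (of_bool (0 \<le> X x t \<omega>) :: real)" for x \<omega>
  have Im: "I x \<in> borel_measurable M" for x
    unfolding I_def[abs_def] using measurable_compose[OF X_measurable[OF t, of x], of "\<lambda>z. of_bool (0 \<le> z) :: real" borel] by simp
  have I1: "integrable M (I x)" for x
    by (rule integrable_const_bound[where B=1]) (simp_all add: I_def[of x] Im)
  have I2: "integrable M (\<lambda>\<omega>. I x \<omega> * I y \<omega>)" for x y
  proof (rule integrable_const_bound[where B=1])
    show "(\<lambda>\<omega>. I x \<omega> * I y \<omega>) \<in> borel_measurable M" by (intro borel_measurable_times Im)
  qed (simp add: I_def)
  have EI: "expectation (I x) = crossing_prob t x" for x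
    unfolding I_def[abs_def] crossing_prob_def
    using expectation_stirring_pair[where F="\<lambda>a. of_bool (0 \<le> fst a)" and K=1 and x=x and y=x, OF t] by simp
  have EII: "expectation (\<lambda>\<omega>. I x \<omega> * I y \<omega>) = pair_sg t both_nonneg (x, y)"
    unfolding I_def
    using expectation_stirring_pair[where F=both_nonneg and K=1 and x=x and y=y, OF t]
    by (simp add: both_nonneg_def of_bool_conj)
  have c1: "expectation (crossing t x) = of_bool (even x) * (crossing_prob t x - of_bool (0 \<le> x))" for x
  proof -
    have "expectation (crossing t x) = expectation (\<lambda>\<omega>. of_bool (even x) * (I x \<omega> - of_bool (0 \<le> x)))"
      unfolding crossing_def[abs_def] I_def ..
    also have "\<dots> = of_bool (even x) * (expectation (I x) - of_bool (0 \<le> x))"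
      by (subst Bochner_Integration.integral_mult_right_zero, subst Bochner_Integration.integral_diff[OF I1])
         (simp_all add: prob_space)
    finally show ?thesis by (simp only: EI)
  qed
  have "expectation (\<lambda>\<omega>. crossing t x \<omega> * crossing t y \<omega>) = expectation (\<lambda>\<omega>. both_even (x, y) *
      (I x \<omega> * I y \<omega> - (of_bool (0 \<le> x) * I y \<omega> + of_bool (0 \<le> y) * I x \<omega> - of_bool (0 \<le> x) * of_bool (0 \<le> y))))"
    by (intro Bochner_Integration.integral_cong refl) (auto simp: crossing_def I_def both_even_def)
  also have "\<dots> = both_even (x, y) * (expectation (\<lambda>\<omega>. I x \<omega> * I y \<omega>) -
      (of_bool (0 \<le> x) * expectation (I y) + of_bool (0 \<le> y) * expectation (I x) - of_bool (0 \<le> x) * of_bool (0 \<le> y)))"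
  proof -
    have iy: "integrable M (\<lambda>\<omega>. of_bool (0 \<le> x) * I y \<omega>)" and ix: "integrable M (\<lambda>\<omega>. of_bool (0 \<le> y) * I x \<omega>)"
      by (intro integrable_mult_right I1)+
    show ?thesis
      by (subst Bochner_Integration.integral_mult_right_zero,
          subst Bochner_Integration.integral_diff[OF I2 Bochner_Integration.integrable_diff[OF Bochner_Integration.integrable_add[OF iy ix] integrable_const]],
          subst Bochner_Integration.integral_diff[OF Bochner_Integration.integrable_add[OF iy ix] integrable_const],
          subst Bochner_Integration.integral_add[OF iy ix])
         (simp add: prob_space)
  qed
  finally show ?thesis
    unfolding c1 EI EII by (auto simp: both_even_def algebra_simps)
qed

text \<open>Both moments of the flux are written as sums over starting points, which is legitimate
  only almost surely and under the exponential bounds \<open>w1\<close> and \<open>w2\<close>. Their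
  difference is the double sum of covariances evaluated in
  \<open>even_sum_covariance\<close>.\<close>

lemma variance_flux:
  assumes t: "0 \<le> t"
  shows "variance (integrated_flux (\<lambda>x. even x) X t) =
    flux_variance t"
proof -
  let ?J = "integrated_flux (\<lambda>x. even x) X t"
  define B where "B = exp (4 * exp 1 * t)"
  have B: "0 \<le> B" by (simp add: B_def)
  define w1 where "w1 x = B * exp (- 1 * \<bar>real_of_int x\<bar>)" for x
  define w2 where "w2 c = B * (exp (- (1/2) * \<bar>real_of_int (fst c)\<bar>) * exp (- (1/2) * \<bar>real_of_int (snd c)\<bar>))" for c :: "int \<times> int"
  have w1: "integrable (counting) w1"
    unfolding w1_def[abs_def] by (intro integrable_mult_right integrable_exp_abs_int) simp
  have w2: "integrable (counting) w2"
    unfolding w2_def[abs_def] by (intro integrable_mult_right integral_count_space_product integrable_exp_abs_int) simp_all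
  have c1: "integrable M (crossing t x)" for x
    by (rule integrable_const_bound[where B=1]) (simp_all add: crossing_bound crossing_measurable t)
  define cc where "cc c \<omega> = crossing t (fst c) \<omega> * crossing t (snd c) \<omega>" for c \<omega>
  have ccm: "cc c \<in> borel_measurable M" for c
    unfolding cc_def[abs_def] by (intro borel_measurable_times crossing_measurable t)
  have ccb: "\<bar>cc c \<omega>\<bar> \<le> \<bar>crossing t (fst c) \<omega>\<bar>" "\<bar>cc c \<omega>\<bar> \<le> \<bar>crossing t (snd c) \<omega>\<bar>" for c \<omega>
    using mult_left_le[OF crossing_bound[of t "snd c" \<omega>], of "\<bar>crossing t (fst c) \<omega>\<bar>"]
      mult_left_le[OF crossing_bound[of t "fst c" \<omega>], of "\<bar>crossing t (snd c) \<omega>\<bar>"]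
    by (simp_all add: cc_def abs_mult mult.commute)
  have cci: "integrable M (cc c)" for c
    by (rule Bochner_Integration.integrable_bound[OF c1[of "fst c"] ccm]) (simp add: ccb)
  have e1: "expectation (\<lambda>\<omega>. \<bar>crossing t x \<omega>\<bar>) \<le> w1 x" for x
    using expectation_abs_crossing[OF t, of x] by (simp add: w1_def B_def)
  have e2: "expectation (\<lambda>\<omega>. \<bar>cc c \<omega>\<bar>) \<le> w2 c" for c
  proof -
    have "expectation (\<lambda>\<omega>. \<bar>cc c \<omega>\<bar>) \<le> expectation (\<lambda>\<omega>. \<bar>crossing t (fst c) \<omega>\<bar>)"
      by (intro integral_mono integrable_abs cci c1 ccb)
    moreover have "expectation (\<lambda>\<omega>. \<bar>cc c \<omega>\<bar>) \<le> expectation (\<lambda>\<omega>. \<bar>crossing t (snd c) \<omega>\<bar>)"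
      by (intro integral_mono integrable_abs cci c1 ccb)
    ultimately have le: "expectation (\<lambda>\<omega>. \<bar>cc c \<omega>\<bar>) \<le> min (w1 (fst c)) (w1 (snd c))"
      using e1[of "fst c"] e1[of "snd c"] by auto
    \<comment> \<open>The mean of the product is bounded by each single-particle bound, and a
      minimum is at most the average of the exponents. Halving the rate thus gives a product bound,
      summable over pairs.\<close>
    have "min (- \<bar>real_of_int (fst c)\<bar>) (- \<bar>real_of_int (snd c)\<bar>) \<le> - (1/2) * \<bar>real_of_int (fst c)\<bar> + - (1/2) * \<bar>real_of_int (snd c)\<bar>"
      by (simp add: min_def)
    then have "exp (min (- \<bar>real_of_int (fst c)\<bar>) (- \<bar>real_of_int (snd c)\<bar>)) \<le> exp (- (1/2) * \<bar>real_of_int (fst c)\<bar>) * exp (- (1/2) * \<bar>real_of_int (snd c)\<bar>)"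
      by (simp only: exp_add[symmetric] exp_le_cancel_iff)
    moreover have "min (w1 (fst c)) (w1 (snd c)) = B * exp (min (- \<bar>real_of_int (fst c)\<bar>) (- \<bar>real_of_int (snd c)\<bar>))"
      by (auto simp: w1_def min_def B_def)
    ultimately have "min (w1 (fst c)) (w1 (snd c)) \<le> w2 c"
      unfolding w2_def using B by (simp only: mult_left_mono)
    with le show ?thesis by linarith
  qed
  note E1 = expectation_count_space_integral[OF crossing_measurable[OF t] c1 w1 e1]
  note E2 = expectation_count_space_integral[OF ccm cci w2 e2]
  have J1: "AE \<omega> in M. ?J \<omega> = (\<integral>x. crossing t x \<omega> \<partial>counting)"
    using E1(1) by eventually_elim (rule flux_eq_integral_crossing)
  have J2: "AE \<omega> in M. (?J \<omega>)\<^sup>2 = (\<integral>c. cc c \<omega> \<partial>counting)"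
    using E1(1)
  proof eventually_elim
    case (elim \<omega>)
    show ?case
      unfolding flux_eq_integral_crossing[OF elim] cc_def power2_eq_square
      by (rule integral_count_space_product(2)[OF elim elim, symmetric])
  qed
  have Jm2: "(\<lambda>\<omega>. (?J \<omega>)\<^sup>2) \<in> borel_measurable M" by (intro borel_measurable_power flux_measurable t)
  have iJ: "integrable M ?J"
    using integrable_cong_AE[OF flux_measurable[OF t] borel_measurable_integrable[OF E1(2)] J1] E1(2) by simp
  have iJ2: "integrable M (\<lambda>\<omega>. (?J \<omega>)\<^sup>2)"
    using integrable_cong_AE[OF Jm2 borel_measurable_integrable[OF E2(2)] J2] E2(2) by simp
  have EJ: "expectation ?J = (\<integral>x. expectation (crossing t x) \<partial>counting)"
    using integral_cong_AE[OF flux_measurable[OF t] borel_measurable_integrable[OF E1(2)] J1] E1(3) by simp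
  have EJ2: "expectation (\<lambda>\<omega>. (?J \<omega>)\<^sup>2) = (\<integral>c. expectation (cc c) \<partial>counting)"
    using integral_cong_AE[OF Jm2 borel_measurable_integrable[OF E2(2)] J2] E2(3) by simp
  note prod = integral_count_space_product[OF E1(4) E1(4)]
  have "variance ?J = expectation (\<lambda>\<omega>. (?J \<omega>)\<^sup>2) - (expectation ?J)\<^sup>2"
    by (rule variance_eq[OF iJ iJ2])
  also have "\<dots> = (\<integral>c. expectation (cc c) - expectation (crossing t (fst c)) * expectation (crossing t (snd c)) \<partial>counting)"
    unfolding EJ EJ2 power2_eq_square[of "integral\<^sup>L _ _"] prod(2)[symmetric]
    by (rule Bochner_Integration.integral_diff[OF E2(4) prod(1), symmetric])
  also have "\<dots> = (\<integral>a. both_even a * (pair_sg t both_nonneg a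
       - crossing_prob t (fst a) * crossing_prob t (snd a)) \<partial>counting)"
  proof (rule Bochner_Integration.integral_cong[OF refl])
    fix c
    show "expectation (cc c) - expectation (crossing t (fst c)) * expectation (crossing t (snd c)) =
      both_even c * (pair_sg t both_nonneg c - crossing_prob t (fst c) * crossing_prob t (snd c))"
      using crossing_product_covariance[OF t, of "fst c" "snd c"] by (simp add: cc_def[abs_def])
  qed
  finally show ?thesis unfolding even_sum_covariance[OF t] .
qed

end

theorem theorem17:
  fixes M :: "'a measure" and N :: "int \<Rightarrow> real \<Rightarrow> 'a \<Rightarrow> nat" and X :: "int \<Rightarrow> real \<Rightarrow> 'a \<Rightarrow> int"
    and \<eta> :: "real \<Rightarrow> int \<Rightarrow> 'a \<Rightarrow> bool"
  assumes "ssep M N X (\<lambda>x. even x) \<eta>"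
  shows "((\<lambda>t. prob_space.variance M (integrated_flux (\<lambda>x. even x) X t) / sqrt t)
           \<longlongrightarrow> 1 / (4 * sqrt pi)) at_top"
proof -
  interpret ssep M N X "\<lambda>x. even x" \<eta> by (rule assms)
  have "\<forall>\<^sub>F t in at_top. flux_variance t / sqrt t =
      variance (integrated_flux (\<lambda>x. even x) X t) / sqrt t"
    using eventually_ge_at_top[of 0] by eventually_elim (simp only: variance_flux)
  with flux_variance_asymp show ?thesis by (rule Lim_transform_eventually)
qed

end
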